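(* Let $\Gamma$ be a finite Boolean constraint language such that $\mathrm{U\text{-}Max\text{-}Ones}(\Gamma)$ is NP-hard. Then there is some $R \in \{R_{IS^2_1}, R_{II_2}, R_{IN_2}, R_{IL_0}, R_{IL_2}, R_{IL_3}, R_{ID_2}\}$ such that $\mathrm{U\text{-}Max\text{-}Ones}(R) \le^{\mathrm{CV}} \mathrm{U\text{-}Max\text{-}Ones}(\Gamma)$.
   Context: Let $\mathbb{B}=\{0,1\}$. A (Boolean) constraint language is a finite set $\Gamma$ of finitary relations over $\mathbb{B}$; a single relation $R$ is identified with $\{R\}$. An instance of $\mathrm{W\text{-}Max\text{-}Ones}(\Gamma)$ consists of a finite set of variables $V=\{x_1,\dots,x_n\}$, a finite set of constraints $R(v_1,\dots,v_k)$ with $R\in\Gamma$ of arity $k$ and $v_1,\dots,v_k\in V$, and weights $w_i\in\mathbb{Q}_{\ge 0}$; a solution is a map $h:V\to\mathbb{B}$ with $(h(v_1),\dots,h(v_k))\in R$ for every constraint, and the goal is to maximize $\sum_i w_i h(x_i)$. $\mathrm{U\text{-}Max\text{-}Ones}(\Gamma)$ is the special case where all weights equal $1$. These are treated as decision problems: given additionally a number $k$, is there a solution with objective value at least $k$? The set of variables of an instance $I$ is denoted $\mathrm{var}(I)$. For two such problems $A_1,A_2$, a CV-reduction from $A_1$ to $A_2$ is a function $f$ from instances of $A_1$ to instances of $A_2$, computable in time polynomial in the size of $I$, such that $I$ is a yes-instance of $A_1$ iff $f(I)$ is a yes-instance of $A_2$, and $|\mathrm{var}(f(I))| = |\mathrm{var}(I)|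 + O(1)$; we write $A_1 \le^{\mathrm{CV}} A_2$ if such a reduction exists. The relations (tuples listed by their coordinates) are: $R_{IS^2_1}=\{(x_1,x_2,c_0)\in\mathbb{B}^3 : \neg(x_1\wedge x_2),\ c_0=0\}$; $R_{II_2}=\{(x_1,\dots,x_6,c_0,c_1)\in\mathbb{B}^8 : (x_1,x_2,x_3)\in\{(0,0,1),(0,1,0),(1,0,0)\},\ x_4=1-x_1,\ x_5=1-x_2,\ x_6=1-x_3,\ c_0=0,\ c_1=1\}$; $R_{IN_2}=\{(x_1,\dots,x_8)\in\mathbb{B}^8 : x_1+x_2+x_3+x_4 \text{ even},\ x_{4+i}=1-x_i \ (i=1,\dots,4),\ (x_1\wedge x_4)\leftrightarrow(x_2\wedge x_3)\}$; $R_{IL_0}=\{(x_1,x_2,x_3,c_0)\in\mathbb{B}^4 : x_1+x_2+x_3 \text{ even},\ c_0=0\}$; $R_{IL_2}=\{(x_1,\dots,x_6,c_0,c_1)\in\mathbb{B}^8 : x_1+x_2+x_3 \text{ even},\ x_{3+i}=1-x_i\ (i=1,2,3),\ c_0=0,\ c_1=1\}$; $R_{IL_3}=\{(x_1,\dots,x_8)\in\mathbb{B}^8 : x_1+x_2+x_3+x_4 \text{ even},\ x_{4+i}=1-x_i\ (i=1,\dots,4)\}$; $R_{ID_2}=\{(x_1,x_2,x_3,x_4,c_0,c_1)\in\mathbb{B}^6 : x_1\vee x_2,\ x_3=1-x_1,\ x_4=1-x_2,\ c_0=0,\ c_1=1\}$. *)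

theory Defs
  imports Main "HOL-Computational_Algebra.Polynomial"
begin

subsection \<open>Deterministic multitape Turing machines\<close>

text \<open>
  States are \<open>0, \<dots>, nstates M\<close>, with start state \<open>0\<close> and the single halting state \<open>nstates M\<close>.
  Symbols are \<open>0, \<dots>, nsyms M - 1\<close>, where \<open>0\<close> is the blank and \<open>1\<close>, \<open>2\<close> represent the bits
  \<open>False\<close>, \<open>True\<close>. Tapes are two-way infinite; a tape is its content together with the head
  position. A transition yields the next state and, for each tape, the symbol to write and the
  head movement.
\<close>

record tm =
  ntapes :: nat
  nsyms :: nat
  nstates :: nat
  delta :: "nat \<Rightarrow> nat list \<Rightarrow> nat \<times> (nat \<times> int) list"

type_synonym tape = "(int \<Rightarrow> nat) \<times> int"
type_synonym config = "nat \<times> tape list"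

definition turing_machine :: "tm \<Rightarrow> bool" where
  "turing_machine M \<longleftrightarrow> 1 \<le> ntapes M \<and> 3 \<le> nsyms M \<and>
     (\<forall>q<nstates M. \<forall>ss. length ss = ntapes M \<and> set ss \<subseteq> {..<nsyms M} \<longrightarrow>
        (case delta M q ss of (q', as) \<Rightarrow>
           q' \<le> nstates M \<and> length as = ntapes M \<and>
           (\<forall>(s, d)\<in>set as. s < nsyms M \<and> d \<in> {-1, 0, 1})))"

definition tape_read :: "tape \<Rightarrow> nat" where
  "tape_read = (\<lambda>(c, p). c p)"

definition tape_act :: "nat \<times> int \<Rightarrow> tape \<Rightarrow> tape" where
  "tape_act = (\<lambda>(s, d) (c, p). (c(p := s), p + d))"

definition tm_step :: "tm \<Rightarrow> config \<Rightarrow> config" where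
  "tm_step M = (\<lambda>(q, tps).
     if q < nstates M
     then (case delta M q (map tape_read tps) of (q', as) \<Rightarrow> (q', map2 tape_act as tps))
     else (q, tps))"

definition string_tape :: "bool list \<Rightarrow> int \<Rightarrow> nat" where
  "string_tape w = (\<lambda>i. if 0 \<le> i \<and> i < int (length w) then (if w ! nat i then 2 else 1) else 0)"

text \<open>The input strings are placed on the first tapes, all other tapes are blank.\<close>

definition tm_init :: "tm \<Rightarrow> bool list list \<Rightarrow> config" where
  "tm_init M ws =
     (0, map (\<lambda>i. (string_tape (if i < length ws then ws ! i else []), 0)) [0..<ntapes M])"

text \<open>
  \<open>M\<close>, started on the inputs \<open>ws\<close>, halts within \<open>t\<close> steps (a halted machine does not move any
  more) with exactly the string \<open>y\<close> on its last tape.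
\<close>

definition computes_within :: "tm \<Rightarrow> bool list list \<Rightarrow> nat \<Rightarrow> bool list \<Rightarrow> bool" where
  "computes_within M ws t y \<longleftrightarrow> length ws \<le> ntapes M \<and>
     (case (tm_step M ^^ t) (tm_init M ws) of (q, tps) \<Rightarrow>
        q = nstates M \<and> fst (last tps) = string_tape y)"


subsection \<open>Polynomial time, NP\<close>

text \<open>\<open>f\<close>, on the domain \<open>A\<close>, is polynomial-time computable with respect to the encodings
  \<open>encA\<close> of arguments and \<open>encB\<close> of results.\<close>

definition polytime_computable ::
    "('a \<Rightarrow> bool list) \<Rightarrow> 'a set \<Rightarrow> ('b \<Rightarrow> bool list) \<Rightarrow> ('a \<Rightarrow> 'b) \<Rightarrow> bool" where
  "polytime_computable encA A encB f \<longleftrightarrow>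
     (\<exists>M (p :: nat poly). turing_machine M \<and>
        (\<forall>x\<in>A. computes_within M [encA x] (poly p (length (encA x))) (encB (f x))))"

text \<open>Polynomial-time verifiers for certificates of polynomial length, the certificate being
  given on the second tape.\<close>

definition in_NP :: "bool list set \<Rightarrow> bool" where
  "in_NP L \<longleftrightarrow>
     (\<exists>M (V :: bool list \<Rightarrow> bool list \<Rightarrow> bool) (p :: nat poly) (q :: nat poly).
        turing_machine M \<and>
        (\<forall>x y. length y \<le> poly q (length x) \<longrightarrow>
           computes_within M [x, y] (poly p (length x)) [V x y]) \<and>
        L = {x. \<exists>y. length y \<le> poly q (length x) \<and> V x y})"


subsection \<open>Boolean relations and instances\<close>

text \<open>A relation is its arity together with its set of tuples; the arity is explicit because
  the empty relation does not determine it.\<close>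

type_synonym brel = "nat \<times> bool list set"

definition boolean_relation :: "brel \<Rightarrow> bool" where
  "boolean_relation R \<longleftrightarrow> (\<forall>t\<in>snd R. length t = fst R)"

definition constraint_language :: "brel set \<Rightarrow> bool" where
  "constraint_language \<Gamma> \<longleftrightarrow> finite \<Gamma> \<and> (\<forall>R\<in>\<Gamma>. boolean_relation R)"

text \<open>
  The variables of an instance are \<open>0, \<dots>, num_vars I - 1\<close>. The finite set of constraints is
  given by a list, each constraint being a relation with the tuple of variables it is applied to.
\<close>

record inst =
  num_vars :: nat
  constraints :: "(brel \<times> nat list) list"
  threshold :: nat

definition var :: "inst \<Rightarrow> nat set" where
  "var I = {..<num_vars I}"

definition instances :: "brel set \<Rightarrow> inst set" where
  "instances \<Gamma> = {I. \<forall>(R, vs)\<in>set (constraints I). R \<in> \<Gamma> \<and> length vs = fst R \<and> set vs \<subseteq> var I}"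

definition solution :: "inst \<Rightarrow> (nat \<Rightarrow> bool) \<Rightarrow> bool" where
  "solution I h \<longleftrightarrow> (\<forall>(R, vs)\<in>set (constraints I). map h vs \<in> snd R)"

text \<open>
  Encoding of instances as bit strings: the number of variables in unary (the size of an instance
  is at least its number of variables), the threshold in binary, and the constraints. Since the
  constraint language is fixed, a relation takes constant space; it is encoded by its arity and
  its truth table, whose length is determined by the arity.
\<close>

definition enc_unary :: "nat \<Rightarrow> bool list" where
  "enc_unary n = replicate n True @ [False]"

fun bits :: "nat \<Rightarrow> bool list" where
  "bits n = (if n = 0 then [] else odd n # bits (n div 2))"

declare bits.simps [simp del]

definition enc_binary :: "nat \<Rightarrow> bool list" where
  "enc_binary n = concat (map (\<lambda>b. [True, b]) (bits n)) @ [False]"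

definition enc_rel :: "brel \<Rightarrow> bool list" where
  "enc_rel R = enc_unary (fst R) @ map (\<lambda>t. t \<in> snd R) (List.n_lists (fst R) [False, True])"

definition enc_constraint :: "brel \<times> nat list \<Rightarrow> bool list" where
  "enc_constraint = (\<lambda>(R, vs). enc_rel R @ concat (map enc_unary vs))"

definition enc_inst :: "inst \<Rightarrow> bool list" where
  "enc_inst I = enc_unary (num_vars I) @ enc_binary (threshold I) @
     concat (map (\<lambda>c. True # enc_constraint c) (constraints I)) @ [False]"


subsection \<open>Decision problems and reductions\<close>

text \<open>A decision problem is its set of instances together with its set of yes-instances.\<close>

type_synonym problem = "inst set \<times> inst set"

definition U_Max_Ones :: "brel set \<Rightarrow> problem" where
  "U_Max_Ones \<Gamma> =
     (instances \<Gamma>,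
      {I \<in> instances \<Gamma>. \<exists>h. solution I h \<and> threshold I \<le> (\<Sum>x\<in>var I. of_bool (h x))})"

definition NP_hard :: "problem \<Rightarrow> bool" where
  "NP_hard A \<longleftrightarrow>
     (\<forall>L. in_NP L \<longrightarrow>
        (\<exists>f :: bool list \<Rightarrow> inst. polytime_computable id UNIV enc_inst f \<and>
           (\<forall>x. f x \<in> fst A) \<and> (\<forall>x. x \<in> L \<longleftrightarrow> f x \<in> snd A)))"

definition CV_reduction :: "problem \<Rightarrow> problem \<Rightarrow> (inst \<Rightarrow> inst) \<Rightarrow> bool" where
  "CV_reduction A B f \<longleftrightarrow>
     (\<forall>I\<in>fst A. f I \<in> fst B) \<and>
     polytime_computable enc_inst (fst A) enc_inst f \<and>
     (\<forall>I\<in>fst A. I \<in> snd A \<longleftrightarrow> f I \<in> snd B) \<and>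
     (\<exists>c. \<forall>I\<in>fst A. \<bar>int (card (var (f I))) - int (card (var I))\<bar> \<le> c)"

definition CV_reducible :: "problem \<Rightarrow> problem \<Rightarrow> bool"  (infix "\<le>\<^sub>C\<^sub>V" 50) where
  "A \<le>\<^sub>C\<^sub>V B \<longleftrightarrow> (\<exists>f. CV_reduction A B f)"


subsection \<open>The relations\<close>

definition R_IS2_1 :: brel where
  "R_IS2_1 = (3, {[x1, x2, c0] | x1 x2 c0. \<not> (x1 \<and> x2) \<and> c0 = False})"

definition R_II2 :: brel where
  "R_II2 = (8, {[x1, x2, x3, x4, x5, x6, c0, c1] | x1 x2 x3 x4 x5 x6 c0 c1.
     (x1, x2, x3) \<in> {(False, False, True), (False, True, False), (True, False, False)} \<and>
     x4 = (\<not> x1) \<and> x5 = (\<not> x2) \<and> x6 = (\<not> x3) \<and> c0 = False \<and> c1 = True})"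

definition R_IN2 :: brel where
  "R_IN2 = (8, {[x1, x2, x3, x4, x5, x6, x7, x8] | x1 x2 x3 x4 x5 x6 x7 x8.
     even (of_bool x1 + of_bool x2 + of_bool x3 + of_bool x4 :: nat) \<and>
     x5 = (\<not> x1) \<and> x6 = (\<not> x2) \<and> x7 = (\<not> x3) \<and> x8 = (\<not> x4) \<and>
     ((x1 \<and> x4) \<longleftrightarrow> (x2 \<and> x3))})"

definition R_IL0 :: brel where
  "R_IL0 = (4, {[x1, x2, x3, c0] | x1 x2 x3 c0.
     even (of_bool x1 + of_bool x2 + of_bool x3 :: nat) \<and> c0 = False})"

definition R_IL2 :: brel where
  "R_IL2 = (8, {[x1, x2, x3, x4, x5, x6, c0, c1] | x1 x2 x3 x4 x5 x6 c0 c1.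
     even (of_bool x1 + of_bool x2 + of_bool x3 :: nat) \<and>
     x4 = (\<not> x1) \<and> x5 = (\<not> x2) \<and> x6 = (\<not> x3) \<and> c0 = False \<and> c1 = True})"

definition R_IL3 :: brel where
  "R_IL3 = (8, {[x1, x2, x3, x4, x5, x6, x7, x8] | x1 x2 x3 x4 x5 x6 x7 x8.
     even (of_bool x1 + of_bool x2 + of_bool x3 + of_bool x4 :: nat) \<and>
     x5 = (\<not> x1) \<and> x6 = (\<not> x2) \<and> x7 = (\<not> x3) \<and> x8 = (\<not> x4)})"

definition R_ID2 :: brel where
  "R_ID2 = (6, {[x1, x2, x3, x4, c0, c1] | x1 x2 x3 x4 c0 c1.
     (x1 \<or> x2) \<and> x3 = (\<not> x1) \<and> x4 = (\<not> x2) \<and> c0 = False \<and> c1 = True})"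

end

theory Submission imports Defs begin

text \<open>
  The \<open>s\<close>-ary polymorphisms of \<open>\<Gamma>\<close>, read as tuples of length \<open>2 ^ s\<close>, form a relation that is a
  conjunction of \<open>\<Gamma>\<close>-constraints without auxiliary variables. If neither the constant 1, nor
  disjunction, nor both majority and minority are polymorphisms, then the binary and ternary
  polymorphisms fall into a few patterns, and in each of them identifying coordinates of this relation
  (with at most two extra global variables) yields one of the seven relations.

  In the three remaining cases \<open>U_Max_Ones \<Gamma>\<close> is decidable in polynomial time by propagating forced
  literals, with a greedy choice between the two flips of a component in the case of majority and
  minority. NP-hardness then gives a polynomial-time decision procedure for independent set, and the
  reduction outputs a trivial yes- or no-instance on the same variables.

  Polynomial-time computability is established through a class of functions on tree-encoded data that is
  closed under composition, case distinction and folds with polynomially bounded accumulators; it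
  compiles to Turing machines and can simulate them.
\<close>

section \<open>A stack language and its compilation to Turing machines\<close>

text \<open>P differing from NP is not assumed, so NP-hardness does not rule out the three tractable
  cases; there it must itself be turned into a reduction. The many-one reduction it supplies may
  increase the number of variables polynomially, so only its answer can be kept. It is given as a
  machine and the result has to be a machine, which is why polynomial-time functions are translated
  in both directions.

  In the other cases the bound on variables excludes existentially quantified gadgets, and every
  fresh variable counts in the objective. The tables are few: without conjunction and constant 0,
  identifying two arguments of an idempotent ternary polymorphism leaves a projection, so only
  projections, majority, minority and Pixley operations are possible, and the last generate both
  majority and minority. Complements and constants in the seven relations are forced entries of such
  tables.\<close>

type_synonym store = "nat \<Rightarrow> nat list"

abbreviation out_reg :: nat where "out_reg \<equiv> 7"

datatype com =
    Skip
  | Push nat nat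
  | Pop nat
  | Emit nat
  | Seq com com  (infixr \<open>;;\<close> 60)
  | Cond nat "nat set" com com
  | While nat "nat set" com

definition top_of :: "store \<Rightarrow> nat \<Rightarrow> nat" where
  "top_of s r = (case s r of [] \<Rightarrow> 0 | a # _ \<Rightarrow> a)"

text \<open>The numeral is the exact number of steps of the compiled machine.\<close>

inductive exec :: "com \<Rightarrow> store \<Rightarrow> nat \<Rightarrow> store \<Rightarrow> bool" where
  exec_Skip: "exec Skip s 0 s"
| exec_Push: "exec (Push r a) s 2 (s(r := a # s r))"
| exec_Pop: "exec (Pop r) s 1 (s(r := tl (s r)))"
| exec_Emit: "exec (Emit a) s 1 (s(out_reg := s out_reg @ [a]))"
| exec_Seq: "exec c s t s' \<Longrightarrow> exec d s' t' s'' \<Longrightarrow> exec (c ;; d) s (t + t') s''"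
| exec_CondT: "top_of s r \<in> A \<Longrightarrow> exec c s t s' \<Longrightarrow> exec (Cond r A c d) s (t + 1) s'"
| exec_CondF: "top_of s r \<notin> A \<Longrightarrow> exec d s t s' \<Longrightarrow> exec (Cond r A c d) s (t + 2) s'"
| exec_WhileF: "top_of s r \<notin> A \<Longrightarrow> exec (While r A c) s 1 s"
| exec_WhileT: "top_of s r \<in> A \<Longrightarrow> exec c s t s' \<Longrightarrow> exec (While r A c) s' t' s'' \<Longrightarrow>
    exec (While r A c) s (t + t' + 2) s''"

fun wf_com :: "com \<Rightarrow> bool" where
  "wf_com Skip = True"
| "wf_com (Push r a) = (r < out_reg \<and> a \<in> {1, 2})"
| "wf_com (Pop r) = (r < out_reg)"
| "wf_com (Emit a) = (a \<in> {1, 2})"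
| "wf_com (c ;; d) = (wf_com c \<and> wf_com d)"
| "wf_com (Cond r A c d) = (r < out_reg \<and> wf_com c \<and> wf_com d)"
| "wf_com (While r A c) = (r < out_reg \<and> wf_com c)"

text \<open>A rule that lengthens a register adds one symbol and costs at least one step. This later
  bounds the size of a result by the running time.\<close>

lemma exec_length: "exec c s t s' \<Longrightarrow> length (s' r) \<le> length (s r) + t"
  by (induction rule: exec.induct) (auto split: if_splits)

section \<open>Compilation to machine code\<close>

datatype instr = Act nat "nat option" int | Br nat "nat set" nat

fun code_len :: "com \<Rightarrow> nat" where
  "code_len Skip = 0"
| "code_len (Push r a) = 2"
| "code_len (Pop r) = 1"
| "code_len (Emit a) = 1"
| "code_len (c ;; d) = code_len c + code_len d"
| "code_len (Cond r A c d) = code_len c + code_len d + 2"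
| "code_len (While r A c) = code_len c + 2"

text \<open>Jump targets are absolute, so \<open>k\<close> is the address of the first instruction;
  \<open>Br 0 UNIV\<close> is an unconditional jump. A push moves left before it writes, hence two
  instructions. In a conditional the false branch comes first and must jump over the true branch,
  hence the surcharges 2 and 1 in \<open>exec\<close>.\<close>

fun compile :: "com \<Rightarrow> nat \<Rightarrow> instr list" where
  "compile Skip k = []"
| "compile (Push r a) k = [Act r None (-1), Act r (Some a) 0]"
| "compile (Pop r) k = [Act r (Some 0) 1]"
| "compile (Emit a) k = [Act out_reg (Some a) 1]"
| "compile (c ;; d) k = compile c k @ compile d (k + code_len c)"
| "compile (Cond r A c d) k =
     Br r A (k + code_len d + 2) # compile d (k + 1) @
     Br 0 UNIV (k + code_len d + 2 + code_len c) # compile c (k + code_len d + 2)"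
| "compile (While r A c) k =
     Br r (- A) (k + code_len c + 2) # compile c (k + 1) @ [Br 0 UNIV k]"

lemma length_compile [simp]: "length (compile c k) = code_len c"
  by (induction c k rule: compile.induct) auto

definition mk_tm :: "instr list \<Rightarrow> tm" where
  "mk_tm P = \<lparr>ntapes = Suc out_reg, nsyms = 3, nstates = length P,
     delta = (\<lambda>q ss. case P ! q of
         Act r w d \<Rightarrow> (Suc q, map (\<lambda>i. if i = r then (case w of None \<Rightarrow> ss ! i | Some a \<Rightarrow> a, d)
                                    else (ss ! i, 0)) [0..<Suc out_reg])
       | Br r A n \<Rightarrow> (if ss ! r \<in> A then n else Suc q, map (\<lambda>i. (ss ! i, 0)) [0..<Suc out_reg]))\<rparr>"

definition instr_ok :: "nat \<Rightarrow> instr \<Rightarrow> bool" where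
  "instr_ok m i = (case i of Act r w d \<Rightarrow> (\<forall>a. w = Some a \<longrightarrow> a < 3) \<and> d \<in> {-1, 0, 1}
     | Br r A n \<Rightarrow> n \<le> m)"

lemma instr_ok_mono: "instr_ok m i \<Longrightarrow> m \<le> n \<Longrightarrow> instr_ok n i"
  by (auto simp: instr_ok_def split: instr.splits)

text \<open>Jumps may lead just behind the code; for a whole program this address is the halting
  state.\<close>

lemma compile_ok: "wf_com c \<Longrightarrow> i \<in> set (compile c k) \<Longrightarrow> instr_ok (k + code_len c) i"
proof (induction c k rule: compile.induct)
  case (5 c d k)
  then show ?case
    by (auto intro: instr_ok_mono simp: algebra_simps)
next
  case (6 r A c d k)
  from 6(3,4) show ?case
    by (auto dest!: 6(1,2) intro: instr_ok_mono) (auto simp: instr_ok_def)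
next
  case (7 r A c k)
  from 7(2,3) show ?case
    by (auto dest!: 7(1) intro: instr_ok_mono) (auto simp: instr_ok_def)
qed (auto simp: instr_ok_def)

lemma turing_machine_mk_tm:
  assumes "\<forall>i\<in>set P. instr_ok (length P) i"
  shows "turing_machine (mk_tm P)"
proof -
  have "case delta (mk_tm P) q ss of (q', as) \<Rightarrow>
      q' \<le> nstates (mk_tm P) \<and> length as = ntapes (mk_tm P) \<and>
      (\<forall>(s, d)\<in>set as. s < nsyms (mk_tm P) \<and> d \<in> {- 1, 0, 1})"
    if q: "q < nstates (mk_tm P)" and ss: "length ss = ntapes (mk_tm P)" "set ss \<subseteq> {..<nsyms (mk_tm P)}"
    for q ss
  proof -
    have "instr_ok (length P) (P ! q)"
      using assms q by (auto simp: mk_tm_def)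
    moreover have "ss ! i < 3" if "i < Suc out_reg" for i
      using subsetD[OF ss(2) nth_mem[of i]] ss(1) that by (simp add: mk_tm_def)
    ultimately show ?thesis
      using q ss by (auto simp: mk_tm_def instr_ok_def less_Suc_eq split: instr.splits option.splits)
  qed
  then show ?thesis
    by (auto simp: turing_machine_def) (simp_all add: mk_tm_def)
qed

lemma tape_act_read: "tape_act (tape_read t, 0) t = t"
  by (cases t) (simp add: tape_act_def tape_read_def)

lemma step_Act:
  assumes "q < length P" "P ! q = Act r w d" "length tps = Suc out_reg" "r < Suc out_reg"
  shows "tm_step (mk_tm P) (q, tps) =
    (Suc q, tps[r := tape_act (case w of None \<Rightarrow> tape_read (tps ! r) | Some a \<Rightarrow> a, d) (tps ! r)])"
  using assms
  by (auto simp: tm_step_def mk_tm_def tape_act_read nth_list_update nth_upt split: option.splits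
      simp del: upt_Suc intro!: nth_equalityI)

lemma step_Br:
  assumes "q < length P" "P ! q = Br r A n" "length tps = Suc out_reg" "r < Suc out_reg"
  shows "tm_step (mk_tm P) (q, tps) = (if tape_read (tps ! r) \<in> A then n else Suc q, tps)"
  using assms
  by (auto simp: tm_step_def mk_tm_def tape_act_read nth_list_update nth_upt split: option.splits
      simp del: upt_Suc intro!: nth_equalityI)

definition list_tape :: "int \<Rightarrow> nat list \<Rightarrow> int \<Rightarrow> nat" where
  "list_tape p l = (\<lambda>i. if p \<le> i \<and> i < p + int (length l) then l ! nat (i - p) else 0)"

text \<open>A stack occupies its tape from the head to the right; the output tape is written from
  position 0 on, with the head behind the last symbol.\<close>

definition represents :: "store \<Rightarrow> tape list \<Rightarrow> bool" where
  "represents s tps \<longleftrightarrow> length tps = Suc out_reg \<and>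
     (\<forall>r<out_reg. fst (tps ! r) = list_tape (snd (tps ! r)) (s r)) \<and>
     tps ! out_reg = (list_tape 0 (s out_reg), int (length (s out_reg)))"

lemma represents_top: "represents s tps \<Longrightarrow> r < out_reg \<Longrightarrow> tape_read (tps ! r) = top_of s r"
  by (auto simp: represents_def tape_read_def top_of_def list_tape_def case_prod_beta split: list.splits)

lemma list_tape_push: "(list_tape p l)(p - 1 := a) = list_tape (p - 1) (a # l)"
  by (auto simp: list_tape_def fun_eq_iff nth_Cons' intro!: arg_cong[of _ _ "\<lambda>k. l ! k"])

text \<open>The popped cell is blanked because \<open>list_tape\<close> requires blanks to the left
  of the head.\<close>

lemma list_tape_pop: "(list_tape p l)(p := 0) = list_tape (p + 1) (tl l)"
  by (cases l) (auto simp: list_tape_def fun_eq_iff nth_Cons' intro!: arg_cong[of _ _ "\<lambda>k. _ ! k"])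

lemma list_tape_snoc: "(list_tape 0 l)(int (length l) := a) = list_tape 0 (l @ [a])"
  by (auto simp: list_tape_def fun_eq_iff nth_append)

lemma represents_upd:
  assumes "represents s tps" "r < out_reg" "fst t = list_tape (snd t) l"
  shows "represents (s(r := l)) (tps[r := t])"
  using assms by (auto simp: represents_def nth_list_update)

abbreviation runs :: "instr list \<Rightarrow> nat \<Rightarrow> config \<Rightarrow> config \<Rightarrow> bool" where
  "runs P n c c' \<equiv> (tm_step (mk_tm P) ^^ n) c = c'"

lemma runs_trans: "runs P m a b \<Longrightarrow> runs P n b c \<Longrightarrow> runs P (m + n) a c"
  by (subst add.commute) (simp add: funpow_add)

lemma runs_1: "tm_step (mk_tm P) a = b \<Longrightarrow> runs P 1 a b"
  by simp

text \<open>The code is embedded between arbitrary \<open>xs\<close> and \<open>ys\<close>, so that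
  the induction hypotheses for parts of a command speak about the same program \<open>P\<close>, at
  other addresses.\<close>

lemma compile_correct:
  assumes "exec c s t s'" "wf_com c" "P = xs @ compile c (length xs) @ ys" "represents s tps"
  shows "\<exists>tps'. represents s' tps' \<and> runs P t (length xs, tps) (length xs + code_len c, tps')"
  using assms
proof (induction c s t s' arbitrary: P xs ys tps rule: exec.induct)
  case (exec_Skip s)
  then show ?case by auto
next
  case (exec_Push r a s)
  let ?q = "length xs"
  obtain c p where cp: "tps ! r = (c, p)" by (cases "tps ! r")
  have len: "length tps = Suc out_reg" and r: "r < out_reg" and c: "c = list_tape p (s r)"
    using exec_Push cp by (auto simp: represents_def)
  have 1: "tm_step (mk_tm P) (?q, tps) = (Suc ?q, tps[r := (c, p - 1)])"
    using exec_Push len r cp by (subst step_Act) (auto simp: tape_act_def tape_read_def nth_append)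
  have 2: "tm_step (mk_tm P) (Suc ?q, tps[r := (c, p - 1)]) =
      (Suc (Suc ?q), tps[r := (c(p - 1 := a), p - 1)])"
    using exec_Push len r cp by (subst step_Act) (auto simp: tape_act_def tape_read_def nth_append)
  have "represents (s(r := a # s r)) (tps[r := (c(p - 1 := a), p - 1)])"
    using exec_Push r by (intro represents_upd) (auto simp: c list_tape_push)
  then show ?case
    using 1 2 by (intro exI[of _ "tps[r := (c(p - 1 := a), p - 1)]"]) (simp add: numeral_2_eq_2 del: fun_upd_apply)
next
  case (exec_Pop r s)
  let ?q = "length xs"
  obtain c p where cp: "tps ! r = (c, p)" by (cases "tps ! r")
  have len: "length tps = Suc out_reg" and r: "r < out_reg" and c: "c = list_tape p (s r)"
    using exec_Pop cp by (auto simp: represents_def)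
  have 1: "tm_step (mk_tm P) (?q, tps) = (Suc ?q, tps[r := (c(p := 0), p + 1)])"
    using exec_Pop len r cp by (subst step_Act) (auto simp: tape_act_def tape_read_def nth_append)
  have "represents (s(r := tl (s r))) (tps[r := (c(p := 0), p + 1)])"
    using exec_Pop r by (intro represents_upd) (auto simp: c list_tape_pop)
  then show ?case
    using 1 by (intro exI[of _ "tps[r := (c(p := 0), p + 1)]"]) (simp del: fun_upd_apply)
next
  case (exec_Emit a s)
  let ?q = "length xs" and ?t = "(list_tape 0 (s out_reg @ [a]), int (length (s out_reg)) + 1)"
  have len: "length tps = Suc out_reg"
    and o: "tps ! out_reg = (list_tape 0 (s out_reg), int (length (s out_reg)))"
    using exec_Emit by (auto simp: represents_def)
  have 1: "tm_step (mk_tm P) (?q, tps) = (Suc ?q, tps[out_reg := ?t])"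
    using exec_Emit len o
    by (subst step_Act) (auto simp: tape_act_def nth_append list_tape_snoc)
  have "represents (s(out_reg := s out_reg @ [a])) (tps[out_reg := ?t])"
    using exec_Emit len by (auto simp: represents_def)
  then show ?case
    using 1 by (intro exI[of _ "tps[out_reg := ?t]"]) (simp del: fun_upd_apply)
next
  case (exec_Seq c s t s' d t' s'')
  obtain tps1 where 1: "represents s' tps1" "runs P t (length xs, tps) (length xs + code_len c, tps1)"
    using exec_Seq.IH(1)[of P xs "compile d (length xs + code_len c) @ ys" tps] exec_Seq.prems by auto
  obtain tps2 where 2: "represents s'' tps2"
      "runs P t' (length xs + code_len c, tps1) (length xs + code_len c + code_len d, tps2)"
    using exec_Seq.IH(2)[of P "xs @ compile c (length xs)" ys tps1] exec_Seq.prems 1 by auto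
  show ?case
    using 2 runs_trans[OF 1(2) 2(2)] by (auto simp: add.assoc)
next
  case (exec_CondT s r A c t s' d)
  let ?q = "length xs"
  have len: "length tps = Suc out_reg" using exec_CondT by (auto simp: represents_def)
  have 1: "tm_step (mk_tm P) (?q, tps) = (?q + code_len d + 2, tps)"
    using exec_CondT len represents_top[of s tps r]
    by (subst step_Br[where r = r and A = A]) (auto simp: nth_append)
  obtain tps1 where 2: "represents s' tps1"
     "runs P t (?q + code_len d + 2, tps) (?q + code_len d + 2 + code_len c, tps1)"
    using exec_CondT.IH[of P "xs @ Br r A (?q + code_len d + 2) # compile d (?q + 1) @
        [Br 0 UNIV (?q + code_len d + 2 + code_len c)]" ys tps] exec_CondT.prems
    by auto
  show ?case
    using 2 runs_trans[OF runs_1[OF 1] 2(2)] by (auto simp: algebra_simps)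
next
  case (exec_CondF s r A d t s' c)
  let ?q = "length xs"
  have len: "length tps = Suc out_reg" using exec_CondF by (auto simp: represents_def)
  have 1: "tm_step (mk_tm P) (?q, tps) = (?q + 1, tps)"
    using exec_CondF len represents_top[of s tps r]
    by (subst step_Br[where r = r and A = A]) (auto simp: nth_append)
  obtain tps1 where 2: "represents s' tps1"
     "runs P t (?q + 1, tps) (?q + 1 + code_len d, tps1)"
    using exec_CondF.IH[of P "xs @ [Br r A (?q + code_len d + 2)]"
        "Br 0 UNIV (?q + code_len d + 2 + code_len c) # compile c (?q + code_len d + 2) @ ys" tps]
      exec_CondF.prems
    by auto
  have len: "length tps1 = Suc out_reg" using 2 by (auto simp: represents_def)
  have 3: "tm_step (mk_tm P) (?q + 1 + code_len d, tps1) = (?q + code_len d + 2 + code_len c, tps1)"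
    using exec_CondF.prems len
    by (subst step_Br[where r = 0 and A = UNIV]) (auto simp: nth_append nth_Cons')
  show ?case
    using 2 runs_trans[OF runs_trans[OF runs_1[OF 1] 2(2)] runs_1[OF 3]] by (auto simp: algebra_simps)
next
  case (exec_WhileF s r A c)
  let ?q = "length xs"
  have len: "length tps = Suc out_reg" using exec_WhileF by (auto simp: represents_def)
  have 1: "tm_step (mk_tm P) (?q, tps) = (?q + code_len c + 2, tps)"
    using exec_WhileF len represents_top[of s tps r]
    by (subst step_Br[where r = r and A = "- A"]) (auto simp: nth_append)
  show ?case
    using exec_WhileF 1 by auto
next
  case (exec_WhileT s r A c t s' t' s'')
  let ?q = "length xs"
  have len: "length tps = Suc out_reg" using exec_WhileT by (auto simp: represents_def)
  have 1: "tm_step (mk_tm P) (?q, tps) = (?q + 1, tps)"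
    using exec_WhileT len represents_top[of s tps r]
    by (subst step_Br[where r = r and A = "- A"]) (auto simp: nth_append)
  obtain tps1 where 2: "represents s' tps1" "runs P t (?q + 1, tps) (?q + 1 + code_len c, tps1)"
    using exec_WhileT.IH(1)[of P "xs @ [Br r (- A) (?q + code_len c + 2)]"
        "Br 0 UNIV ?q # ys" tps] exec_WhileT.prems
    by auto
  have len: "length tps1 = Suc out_reg" using 2 by (auto simp: represents_def)
  have 3: "tm_step (mk_tm P) (?q + 1 + code_len c, tps1) = (?q, tps1)"
    using exec_WhileT.prems len
    by (subst step_Br[where r = 0 and A = UNIV]) (auto simp: nth_append nth_Cons')
  obtain tps2 where 4: "represents s'' tps2" "runs P t' (?q, tps1) (?q + code_len (While r A c), tps2)"
    using exec_WhileT.IH(2)[of P xs ys tps1] exec_WhileT.prems 2(1) by blast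
  show ?case
    using 4 runs_trans[OF runs_trans[OF runs_trans[OF runs_1[OF 1] 2(2)] runs_1[OF 3]] 4(2)]
    by (auto simp: algebra_simps)
qed

abbreviation bit_sym :: "bool \<Rightarrow> nat" where "bit_sym b \<equiv> (if b then 2 else 1)"

definition init_store :: "bool list list \<Rightarrow> store" where
  "init_store ws = (\<lambda>r. if r < length ws then map bit_sym (ws ! r) else [])"

lemma string_tape_eq: "string_tape w = list_tape 0 (map bit_sym w)"
  by (auto simp: string_tape_def list_tape_def fun_eq_iff nth_map)

lemma halted_stays: "(tm_step M ^^ n) (nstates M, tps) = (nstates M, tps)"
  by (induction n) (auto simp: tm_step_def)

lemma computes_within_mk_tm:
  assumes "wf_com c" "length ws \<le> out_reg" "exec c (init_store ws) t s"
    "s out_reg = map bit_sym y" "t \<le> t'"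
  shows "computes_within (mk_tm (compile c 0)) ws t' y"
proof -
  let ?P = "compile c 0"
  have init: "tm_init (mk_tm ?P) ws =
      (0, map (\<lambda>i. (string_tape (if i < length ws then ws ! i else []), 0)) [0..<Suc out_reg])"
    (is "_ = (0, ?tps)")
    by (simp add: tm_init_def mk_tm_def)
  have "represents (init_store ws) ?tps"
    using assms(2)
    by (auto simp: represents_def init_store_def string_tape_eq simp del: upt_Suc)
  then obtain tps' where 1: "represents s tps'" "runs ?P t (0, ?tps) (code_len c, tps')"
    using compile_correct[OF assms(3,1), of ?P "[]" "[]" ?tps] by auto
  have ns: "nstates (mk_tm ?P) = code_len c"
    by (simp add: mk_tm_def)
  \<comment> \<open>Idling in the halting state turns the exact running time \<open>t\<close> into
    any larger bound \<open>t'\<close>.\<close>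
  have 2: "runs ?P (t + (t' - t)) (0, ?tps) (code_len c, tps')"
    using runs_trans[OF 1(2) halted_stays[of "t' - t" "mk_tm ?P" tps', unfolded ns]] .
  have "last tps' = tps' ! out_reg"
    using 1(1) by (subst last_conv_nth) (auto simp: represents_def)
  then have "fst (last tps') = string_tape y"
    using 1(1) assms(4) by (simp add: represents_def string_tape_eq)
  then show ?thesis
    using 2 assms(2,5) unfolding computes_within_def init by (simp add: ns) (simp add: mk_tm_def)
qed

lemma turing_machine_compile: "wf_com c \<Longrightarrow> turing_machine (mk_tm (compile c 0))"
  by (rule turing_machine_mk_tm) (auto dest: compile_ok)

section \<open>Polynomial-time functions on tree-encoded data\<close>

datatype val = VNil | VCons val val

text \<open>Preorder notation is self-delimiting: a value can be split off from whatever lies below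
  it on a stack by counting pending subtrees.\<close>

fun toks :: "val \<Rightarrow> nat list" where
  "toks VNil = [1]"
| "toks (VCons a b) = 2 # toks a @ toks b"

abbreviation vsz :: "val \<Rightarrow> nat" where "vsz v \<equiv> length (toks v)"

lemma vsz_pos: "1 \<le> vsz v"
  by (cases v) auto

lemma toks_subset: "set (toks v) \<subseteq> {1, 2}"
  by (induction v) auto

definition reaches :: "com \<Rightarrow> store \<Rightarrow> nat \<Rightarrow> store \<Rightarrow> bool" where
  "reaches c s T s' \<longleftrightarrow> (\<exists>t\<le>T. exec c s t s')"

lemma reaches_mono: "reaches c s T s' \<Longrightarrow> T \<le> T' \<Longrightarrow> reaches c s T' s'"
  unfolding reaches_def using le_trans by blast

lemma reaches_Skip: "reaches Skip s 0 s"
  unfolding reaches_def using exec_Skip by blast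

lemma reaches_Push: "reaches (Push r a) s 2 (s(r := a # s r))"
  unfolding reaches_def using exec_Push by blast

lemma reaches_Pop: "reaches (Pop r) s 1 (s(r := tl (s r)))"
  unfolding reaches_def using exec_Pop by blast

lemma reaches_Emit: "reaches (Emit a) s 1 (s(out_reg := s out_reg @ [a]))"
  unfolding reaches_def using exec_Emit by blast

lemma reaches_Seq: "reaches c s T s' \<Longrightarrow> reaches d s' T' s'' \<Longrightarrow> reaches (c ;; d) s (T + T') s''"
  unfolding reaches_def using exec_Seq add_mono by metis

lemma reaches_CondT: "top_of s r \<in> A \<Longrightarrow> reaches c s T s' \<Longrightarrow> reaches (Cond r A c d) s (T + 1) s'"
  unfolding reaches_def using exec_CondT add_le_mono1 by meson

lemma reaches_CondF: "top_of s r \<notin> A \<Longrightarrow> reaches d s T s' \<Longrightarrow> reaches (Cond r A c d) s (T + 2) s'"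
  unfolding reaches_def using exec_CondF add_le_mono1 by meson

lemma reaches_WhileF: "top_of s r \<notin> A \<Longrightarrow> reaches (While r A c) s 1 s"
  unfolding reaches_def using exec_WhileF by blast

lemma reaches_WhileT: "top_of s r \<in> A \<Longrightarrow> reaches c s T s' \<Longrightarrow> reaches (While r A c) s' T' s'' \<Longrightarrow>
    reaches (While r A c) s (T + T' + 2) s''"
  unfolding reaches_def by (meson add_mono add_le_mono1 exec_WhileT)

text \<open>Registers 0 and 1 hold the inputs. Values live on the stacks 2, 3 and 4; register 5 reverses
  a value in transit and register 6 counts the subtrees still to be read.\<close>

abbreviation "rM \<equiv> (2::nat)"
abbreviation "rA \<equiv> (3::nat)"
abbreviation "rE \<equiv> (4::nat)"
abbreviation "rB \<equiv> (5::nat)"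
abbreviation "rC \<equiv> (6::nat)"

section \<open>Moving, copying and discarding values\<close>

definition take_loop :: "nat \<Rightarrow> com" where
  "take_loop x = While rC {1} (Cond x {2} (Pop x ;; Push rB 2 ;; Push rC 1) (Pop x ;; Push rB 1 ;; Pop rC))"

definition drop_loop :: "nat \<Rightarrow> com" where
  "drop_loop x = While rC {1} (Cond x {2} (Pop x ;; Push rC 1) (Pop x ;; Pop rC))"

text \<open>The rest of the run is a parameter because both subtrees of a node are consumed by one
  and the same loop: the run on the second subtree is the continuation of the run on the first. A
  node replaces one pending subtree by two, a leaf completes one; either iteration costs at most 8
  steps.\<close>

lemma take_loop_step:
  assumes "s x = toks v @ r" "s rC = 1 # cs" "x < rB"
    "reaches (take_loop x) (s(x := r, rB := rev (toks v) @ s rB, rC := cs)) T s'"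
  shows "reaches (take_loop x) s (T + 8 * vsz v) s'"
  using assms
proof (induction v arbitrary: s r cs T)
  case VNil
  have 2: "reaches (Cond x {2} (Pop x ;; Push rB 2 ;; Push rC 1) (Pop x ;; Push rB 1 ;; Pop rC)) s ((1 + (2 + 1)) + 2)
     (s(x := r, rB := 1 # s rB, rC := cs))"
    using VNil.prems
    by (intro reaches_CondF, simp add: top_of_def)
       (rule reaches_Seq[OF reaches_Pop reaches_Seq[OF reaches_Push reaches_Pop], THEN back_subst[of "reaches _ _ _"]] | force simp: fun_eq_iff)+
  have 3: "reaches (take_loop x) (s(x := r, rB := 1 # s rB, rC := cs)) T s'"
    using VNil.prems(4) by (simp del: fun_upd_apply)
  have 1: "top_of s rC \<in> {1}"
    using VNil.prems by (simp add: top_of_def)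
  show ?case
    using reaches_mono[OF reaches_WhileT[OF 1 2 3[unfolded take_loop_def]]]
    unfolding take_loop_def by (simp del: fun_upd_apply)
next
  case (VCons a b)
  let ?s1 = "s(x := toks a @ toks b @ r, rB := 2 # s rB, rC := 1 # 1 # cs)"
  have 1: "reaches (Cond x {2} (Pop x ;; Push rB 2 ;; Push rC 1) (Pop x ;; Push rB 1 ;; Pop rC)) s ((1 + (2 + 2)) + 1) ?s1"
    using VCons.prems
    by (intro reaches_CondT, simp add: top_of_def)
       (rule reaches_Seq[OF reaches_Pop reaches_Seq[OF reaches_Push reaches_Push], THEN back_subst[of "reaches _ _ _"]] | force simp: fun_eq_iff)+
  let ?s2 = "?s1(x := toks b @ r, rB := rev (toks a) @ ?s1 rB, rC := 1 # cs)"
  have 2: "reaches (take_loop x) ?s2 (T + 8 * vsz b) s'"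
  proof (rule VCons.IH(2))
    have "?s2(x := r, rB := rev (toks b) @ ?s2 rB, rC := cs) =
        s(x := r, rB := rev (toks (VCons a b)) @ s rB, rC := cs)"
      using VCons.prems by (auto simp: fun_eq_iff)
    then show "reaches (take_loop x) (?s2(x := r, rB := rev (toks b) @ ?s2 rB, rC := cs)) T s'"
      using VCons.prems(4) by (simp only:)
  qed (use VCons.prems in auto)
  have 3: "reaches (take_loop x) ?s1 (T + 8 * vsz b + 8 * vsz a) s'"
    by (rule VCons.IH(1)[OF _ _ _ 2]) (use VCons.prems in auto)
  from reaches_WhileT[OF _ 1, of rC "{1}" "T + 8 * vsz b + 8 * vsz a" s'] 3 VCons.prems show ?case
    by (auto simp: take_loop_def top_of_def algebra_simps elim: reaches_mono)
qed

lemma drop_loop_step: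
  assumes "s x = toks v @ r" "s rC = 1 # cs" "x < rB"
    "reaches (drop_loop x) (s(x := r, rC := cs)) T s'"
  shows "reaches (drop_loop x) s (T + 8 * vsz v) s'"
  using assms
proof (induction v arbitrary: s r cs T)
  case VNil
  have 2: "reaches (Cond x {2} (Pop x ;; Push rC 1) (Pop x ;; Pop rC)) s ((1 + 1) + 2) (s(x := r, rC := cs))"
    using VNil.prems
    by (intro reaches_CondF, simp add: top_of_def)
       (rule reaches_Seq[OF reaches_Pop reaches_Pop, THEN back_subst[of "reaches _ _ _"]] | force simp: fun_eq_iff)+
  have 3: "reaches (drop_loop x) (s(x := r, rC := cs)) T s'"
    using VNil.prems(4) by (simp del: fun_upd_apply)
  have 1: "top_of s rC \<in> {1}"
    using VNil.prems by (simp add: top_of_def)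
  show ?case
    using reaches_mono[OF reaches_WhileT[OF 1 2 3[unfolded drop_loop_def]]]
    unfolding drop_loop_def by (simp del: fun_upd_apply)
next
  case (VCons a b)
  let ?s1 = "s(x := toks a @ toks b @ r, rC := 1 # 1 # cs)"
  have 1: "reaches (Cond x {2} (Pop x ;; Push rC 1) (Pop x ;; Pop rC)) s ((1 + 2) + 1) ?s1"
    using VCons.prems
    by (intro reaches_CondT, simp add: top_of_def)
       (rule reaches_Seq[OF reaches_Pop reaches_Push, THEN back_subst[of "reaches _ _ _"]] | force simp: fun_eq_iff)+
  let ?s2 = "?s1(x := toks b @ r, rC := 1 # cs)"
  have 2: "reaches (drop_loop x) ?s2 (T + 8 * vsz b) s'"
  proof (rule VCons.IH(2))
    have "?s2(x := r, rC := cs) = s(x := r, rC := cs)"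
      by (auto simp: fun_eq_iff)
    then show "reaches (drop_loop x) (?s2(x := r, rC := cs)) T s'"
      using VCons.prems(4) by (simp only:)
  qed (use VCons.prems in auto)
  have 3: "reaches (drop_loop x) ?s1 (T + 8 * vsz b + 8 * vsz a) s'"
    by (rule VCons.IH(1)[OF _ _ _ 2]) (use VCons.prems in auto)
  from reaches_WhileT[OF _ 1, of rC "{1}" "T + 8 * vsz b + 8 * vsz a" s'] 3 VCons.prems show ?case
    by (auto simp: drop_loop_def top_of_def algebra_simps elim: reaches_mono)
qed

definition unload :: "nat \<Rightarrow> com" where
  "unload y = While rB {1, 2} (Cond rB {2} (Push y 2 ;; Pop rB) (Push y 1 ;; Pop rB))"

text \<open>Reading a value consumes it, so a copy has to write it back to the source
  \<open>x\<close> as well.\<close>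

definition unload2 :: "nat \<Rightarrow> nat \<Rightarrow> com" where
  "unload2 x y = While rB {1, 2}
     (Cond rB {2} (Push x 2 ;; Push y 2 ;; Pop rB) (Push x 1 ;; Push y 1 ;; Pop rB))"

lemma unload:
  assumes "set u \<subseteq> {1, 2}" "s rB = u" "y < rB"
  shows "reaches (unload y) s (7 * length u + 1) (s(rB := [], y := rev u @ s y))"
  using assms
proof (induction u arbitrary: s)
  case Nil
  then have "s(rB := [], y := rev [] @ s y) = s" by auto
  then show ?case using Nil reaches_WhileF[of s rB "{1,2}"]
    by (simp add: unload_def top_of_def del: fun_upd_apply)
next
  case (Cons a u)
  let ?s1 = "s(y := a # s y, rB := u)"
  have 2: "reaches (Cond rB {2} (Push y 2 ;; Pop rB) (Push y 1 ;; Pop rB)) s (3 + 2) ?s1"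
  proof (cases "a = 2")
    case True
    have "reaches (Push y 2 ;; Pop rB) s (2 + 1) ?s1"
      using Cons.prems True
      by (rule_tac reaches_Seq[OF reaches_Push reaches_Pop, THEN back_subst[of "reaches _ _ _"]]) (auto simp: fun_eq_iff)
    then show ?thesis
      using Cons.prems True by (intro reaches_mono[OF reaches_CondT]) (auto simp: top_of_def)
  next
    case False
    have "reaches (Push y 1 ;; Pop rB) s (2 + 1) ?s1"
      using Cons.prems False
      by (rule_tac reaches_Seq[OF reaches_Push reaches_Pop, THEN back_subst[of "reaches _ _ _"]]) (auto simp: fun_eq_iff)
    then show ?thesis
      using Cons.prems False by (intro reaches_mono[OF reaches_CondF]) (auto simp: top_of_def)
  qed
  have 4: "?s1(rB := [], y := rev u @ ?s1 y) = s(rB := [], y := rev (a # u) @ s y)"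
    using Cons.prems by (auto simp: fun_eq_iff)
  have 3: "reaches (unload y) ?s1 (7 * length u + 1) (?s1(rB := [], y := rev u @ ?s1 y))"
    using Cons.prems by (intro Cons.IH) auto
  have 1: "top_of s rB \<in> {1, 2}"
    using Cons.prems by (auto simp: top_of_def)
  show ?case
    using reaches_mono[OF reaches_WhileT[OF 1 2 3[unfolded unload_def 4]]]
    unfolding unload_def by (simp del: fun_upd_apply)
qed

lemma unload2:
  assumes "set u \<subseteq> {1, 2}" "s rB = u" "x < rB" "y < rB" "x \<noteq> y"
  shows "reaches (unload2 x y) s (9 * length u + 1) (s(rB := [], x := rev u @ s x, y := rev u @ s y))"
  using assms
proof (induction u arbitrary: s)
  case Nil
  then have "s(rB := [], x := rev [] @ s x, y := rev [] @ s y) = s" by auto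
  then show ?case using Nil reaches_WhileF[of s rB "{1,2}"]
    by (simp add: unload2_def top_of_def del: fun_upd_apply)
next
  case (Cons a u)
  let ?s1 = "s(x := a # s x, y := a # s y, rB := u)"
  have 2: "reaches (Cond rB {2} (Push x 2 ;; Push y 2 ;; Pop rB) (Push x 1 ;; Push y 1 ;; Pop rB)) s (5 + 2) ?s1"
  proof (cases "a = 2")
    case True
    have "reaches (Push x 2 ;; Push y 2 ;; Pop rB) s (2 + (2 + 1)) ?s1"
      using Cons.prems True
      by (rule_tac reaches_Seq[OF reaches_Push reaches_Seq[OF reaches_Push reaches_Pop], THEN back_subst[of "reaches _ _ _"]]) (auto simp: fun_eq_iff)
    then show ?thesis
      using Cons.prems True by (intro reaches_mono[OF reaches_CondT]) (auto simp: top_of_def)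
  next
    case False
    have "reaches (Push x 1 ;; Push y 1 ;; Pop rB) s (2 + (2 + 1)) ?s1"
      using Cons.prems False
      by (rule_tac reaches_Seq[OF reaches_Push reaches_Seq[OF reaches_Push reaches_Pop], THEN back_subst[of "reaches _ _ _"]]) (auto simp: fun_eq_iff)
    then show ?thesis
      using Cons.prems False by (intro reaches_mono[OF reaches_CondF]) (auto simp: top_of_def)
  qed
  have 4: "?s1(rB := [], x := rev u @ ?s1 x, y := rev u @ ?s1 y) =
      s(rB := [], x := rev (a # u) @ s x, y := rev (a # u) @ s y)"
    using Cons.prems by (auto simp: fun_eq_iff)
  have 3: "reaches (unload2 x y) ?s1 (9 * length u + 1) (?s1(rB := [], x := rev u @ ?s1 x, y := rev u @ ?s1 y))"
    using Cons.prems by (intro Cons.IH) auto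
  have 1: "top_of s rB \<in> {1, 2}"
    using Cons.prems by (auto simp: top_of_def)
  show ?case
    using reaches_mono[OF reaches_WhileT[OF 1 2 3[unfolded unload2_def 4]]]
    unfolding unload2_def by (simp del: fun_upd_apply)
qed

definition move :: "nat \<Rightarrow> nat \<Rightarrow> com" where
  "move x y = Push rC 1 ;; take_loop x ;; unload y"

definition copy :: "nat \<Rightarrow> nat \<Rightarrow> com" where
  "copy x y = Push rC 1 ;; take_loop x ;; unload2 x y"

definition discard :: "nat \<Rightarrow> com" where
  "discard x = Push rC 1 ;; drop_loop x"

lemma take_loop:
  assumes "s x = toks v @ r" "s rB = []" "s rC = [1]" "x < rB"
  shows "reaches (take_loop x) s (1 + 8 * vsz v) (s(x := r, rB := rev (toks v), rC := []))"
  using reaches_WhileF[of "s(x := r, rB := rev (toks v), rC := [])" rC "{1}"] assms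
  by (intro take_loop_step[of s x v r "[]"]) (auto simp: take_loop_def top_of_def)

lemma move:
  assumes "s x = toks v @ r" "s rB = []" "s rC = []" "x < rB" "y < rB" "x \<noteq> y"
  shows "reaches (move x y) s (20 * vsz v) (s(x := r, y := toks v @ s y))"
proof -
  let ?s1 = "s(rC := 1 # s rC)"
  let ?s2 = "?s1(x := r, rB := rev (toks v), rC := [])"
  have 2: "reaches (take_loop x) ?s1 (1 + 8 * vsz v) ?s2"
    by (rule take_loop) (use assms in auto)
  have 3: "reaches (unload y) ?s2 (7 * vsz v + 1) (?s2(rB := [], y := toks v @ ?s2 y))"
    using unload[of "rev (toks v)" ?s2 y] assms toks_subset by simp
  have "?s2(rB := [], y := toks v @ ?s2 y) = s(x := r, y := toks v @ s y)"
    using assms by (auto simp: fun_eq_iff)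
  with reaches_Seq[OF reaches_Push reaches_Seq[OF 2 3]] show ?thesis
    unfolding move_def using vsz_pos[of v] by (auto intro: reaches_mono)
qed

lemma copy:
  assumes "s x = toks v @ r" "s rB = []" "s rC = []" "x < rB" "y < rB" "x \<noteq> y"
  shows "reaches (copy x y) s (22 * vsz v) (s(y := toks v @ s y))"
proof -
  let ?s1 = "s(rC := 1 # s rC)"
  let ?s2 = "?s1(x := r, rB := rev (toks v), rC := [])"
  have 2: "reaches (take_loop x) ?s1 (1 + 8 * vsz v) ?s2"
    by (rule take_loop) (use assms in auto)
  have 3: "reaches (unload2 x y) ?s2 (9 * vsz v + 1) (?s2(rB := [], x := toks v @ ?s2 x, y := toks v @ ?s2 y))"
    using unload2[of "rev (toks v)" ?s2 x y] assms toks_subset by simp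
  have "?s2(rB := [], x := toks v @ ?s2 x, y := toks v @ ?s2 y) = s(y := toks v @ s y)"
    using assms by (auto simp: fun_eq_iff)
  with reaches_Seq[OF reaches_Push reaches_Seq[OF 2 3]] show ?thesis
    unfolding copy_def using vsz_pos[of v] by (auto intro: reaches_mono)
qed

lemma discard:
  assumes "s x = toks v @ r" "s rC = []" "x < rB"
  shows "reaches (discard x) s (20 * vsz v) (s(x := r))"
proof -
  let ?s1 = "s(rC := 1 # s rC)"
  have e: "?s1(x := r, rC := []) = s(x := r)"
    using assms by (auto simp: fun_eq_iff)
  have 2: "reaches (drop_loop x) ?s1 (1 + 8 * vsz v) (?s1(x := r, rC := []))"
    using reaches_WhileF[of "?s1(x := r, rC := [])" rC "{1}"] assms
    by (intro drop_loop_step[of ?s1 x v r "[]"]) (auto simp: drop_loop_def top_of_def)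
  from reaches_Seq[OF reaches_Push 2] show ?thesis
    unfolding discard_def e using vsz_pos[of v] by (auto intro: reaches_mono)
qed

lemma wf_moves [simp]:
  "x < rB \<Longrightarrow> y < rB \<Longrightarrow> wf_com (move x y)"
  "x < rB \<Longrightarrow> y < rB \<Longrightarrow> wf_com (copy x y)"
  "x < rB \<Longrightarrow> wf_com (discard x)"
  by (auto simp: move_def copy_def discard_def take_loop_def drop_loop_def unload_def unload2_def)

section \<open>Tree encodings of data\<close>

class venc =
  fixes ve :: "'a \<Rightarrow> val"

abbreviation vs :: "'a::venc \<Rightarrow> nat" where "vs x \<equiv> vsz (ve x)"

instantiation bool :: venc begin
definition ve_bool :: "bool \<Rightarrow> val" where "ve_bool b = (if b then VCons VNil VNil else VNil)"
instance ..
end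

instantiation unit :: venc begin
definition ve_unit :: "unit \<Rightarrow> val" where "ve_unit u = VNil"
instance ..
end

instantiation nat :: venc begin
text \<open>Numbers are unary, with the same tree as a list of that many units; a loop counter is
  thus a list, and a bound on a number is a bound on its size.\<close>

primrec ve_nat :: "nat \<Rightarrow> val" where
  "ve_nat 0 = VNil"
| "ve_nat (Suc n) = VCons VNil (ve_nat n)"
instance ..
end

instantiation list :: (venc) venc begin
primrec ve_list :: "'a list \<Rightarrow> val" where
  "ve_list [] = VNil"
| "ve_list (x # xs) = VCons (ve x) (ve_list xs)"
instance ..
end

instantiation prod :: (venc, venc) venc begin
primrec ve_prod :: "'a \<times> 'b \<Rightarrow> val" where
  "ve_prod (a, b) = VCons (ve a) (ve b)"
instance ..
end

lemma vs_nat: "vs (n :: nat) = 2 * n + 1"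
  by (induction n) auto

lemma vs_mem: "x \<in> set xs \<Longrightarrow> vs x \<le> vs xs"
  by (induction xs) auto

lemma length_le_vs: "length xs \<le> vs xs"
  by (induction xs) auto

lemma vs_append: "vs (xs @ ys) \<le> vs xs + vs ys"
  by (induction xs) auto

lemma vs_bool: "vs (b :: bool) \<le> 3"
  by (simp add: ve_bool_def)

section \<open>The class of polynomial-time functions\<close>

definition mem :: "store \<Rightarrow> nat list \<Rightarrow> nat list \<Rightarrow> nat list \<Rightarrow> store" where
  "mem s m a e = s(rM := m, rA := a, rE := e, rB := [], rC := [])"

lemma mem_simps [simp]: "mem s m a e rM = m" "mem s m a e rA = a" "mem s m a e rE = e"
  "mem s m a e rB = []" "mem s m a e rC = []"
  by (auto simp: mem_def)

lemma mem_upd [simp]: "(mem s m a e)(rM := x) = mem s x a e" "(mem s m a e)(rA := x) = mem s m x e"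
  "(mem s m a e)(rE := x) = mem s m a x"
  by (auto simp: mem_def fun_eq_iff)

lemma move_MA: "reaches (move rM rA) (mem s (toks v @ m) a e) (20 * vsz v) (mem s m (toks v @ a) e)"
  using move[of "mem s (toks v @ m) a e" rM v m rA] by (simp del: fun_upd_apply)

lemma move_ME: "reaches (move rM rE) (mem s (toks v @ m) a e) (20 * vsz v) (mem s m a (toks v @ e))"
  using move[of "mem s (toks v @ m) a e" rM v m rE] by (simp del: fun_upd_apply)

lemma move_AM: "reaches (move rA rM) (mem s m (toks v @ a) e) (20 * vsz v) (mem s (toks v @ m) a e)"
  using move[of "mem s m (toks v @ a) e" rA v a rM] by (simp del: fun_upd_apply)

lemma move_EM: "reaches (move rE rM) (mem s m a (toks v @ e)) (20 * vsz v) (mem s (toks v @ m) a e)"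
  using move[of "mem s m a (toks v @ e)" rE v e rM] by (simp del: fun_upd_apply)

lemma copy_MA: "reaches (copy rM rA) (mem s (toks v @ m) a e) (22 * vsz v) (mem s (toks v @ m) (toks v @ a) e)"
  using copy[of "mem s (toks v @ m) a e" rM v m rA] by (simp del: fun_upd_apply)

lemma discard_M: "reaches (discard rM) (mem s (toks v @ m) a e) (20 * vsz v) (mem s m a e)"
  using discard[of "mem s (toks v @ m) a e" rM v m] by (simp del: fun_upd_apply)

lemma push_M: "reaches (Push rM x) (mem s m a e) 2 (mem s (x # m) a e)"
  using reaches_Push[of rM x "mem s m a e"] by (simp del: fun_upd_apply)

lemma pop_M: "reaches (Pop rM) (mem s (x # m) a e) 1 (mem s m a e)"
  using reaches_Pop[of rM "mem s (x # m) a e"] by (simp del: fun_upd_apply)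

text \<open>The rest \<open>m\<close> of the main stack and the two other stacks are arbitrary and
  come back unchanged. This frame condition is what allows programs to be nested.\<close>

definition computes :: "com \<Rightarrow> ('a::venc \<Rightarrow> 'b::venc) \<Rightarrow> ('a \<Rightarrow> nat) \<Rightarrow> bool" where
  "computes c f T \<longleftrightarrow> wf_com c \<and>
     (\<forall>x s m a e. reaches c (mem s (toks (ve x) @ m) a e) (T x) (mem s (toks (ve (f x)) @ m) a e))"

lemma computesD:
  "computes c f T \<Longrightarrow>
    reaches c (mem s (toks (ve x) @ m) a e) (T x) (mem s (toks (ve (f x)) @ m) a e)"
  unfolding computes_def by blast

definition pbd :: "('a::venc \<Rightarrow> nat) \<Rightarrow> bool" where
  "pbd T \<longleftrightarrow> (\<exists>p :: nat poly. \<forall>x. T x \<le> poly p (vs x))"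

definition fp :: "('a::venc \<Rightarrow> 'b::venc) \<Rightarrow> bool" where
  "fp f \<longleftrightarrow> (\<exists>c T. computes c f T \<and> pbd T)"

lemma poly_nat_mono: "m \<le> n \<Longrightarrow> poly (p :: nat poly) m \<le> poly p n"
  by (induction p) (auto intro: add_mono mult_mono)

lemma pbd_mono: "pbd T' \<Longrightarrow> (\<And>x. T x \<le> T' x) \<Longrightarrow> pbd T"
  unfolding pbd_def by (meson le_trans)

lemma pbd_const: "pbd (\<lambda>x. n)"
  unfolding pbd_def by (rule exI[of _ "[:n:]"]) simp

lemma pbd_vs: "pbd (\<lambda>x. vs x)"
  unfolding pbd_def by (rule exI[of _ "[:0, 1:]"]) simp

lemma pbd_add:
  assumes "pbd F" "pbd G" shows "pbd (\<lambda>x. F x + G x)"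
proof -
  obtain p q where "\<And>x. F x \<le> poly p (vs x)" "\<And>x. G x \<le> poly q (vs x)"
    using assms unfolding pbd_def by blast
  then have "F x + G x \<le> poly (p + q) (vs x)" for x
    by (simp add: add_mono)
  then show ?thesis unfolding pbd_def by blast
qed

lemma pbd_mult:
  assumes "pbd F" "pbd G" shows "pbd (\<lambda>x. F x * G x)"
proof -
  obtain p q where "\<And>x. F x \<le> poly p (vs x)" "\<And>x. G x \<le> poly q (vs x)"
    using assms unfolding pbd_def by blast
  then have "F x * G x \<le> poly (p * q) (vs x)" for x
    by (simp add: mult_mono)
  then show ?thesis unfolding pbd_def by blast
qed

lemma pbd_poly:
  assumes "pbd F" shows "pbd (\<lambda>x. poly p (F x))"
proof -
  obtain q where "\<And>x. F x \<le> poly q (vs x)"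
    using assms unfolding pbd_def by blast
  then have "poly p (F x) \<le> poly (pcompose p q) (vs x)" for x
    by (simp add: poly_pcompose poly_nat_mono)
  then show ?thesis unfolding pbd_def by blast
qed

lemma pbd_Suc: "pbd F \<Longrightarrow> pbd (\<lambda>x. Suc (F x))"
  using pbd_add[OF pbd_const, of F 1] by simp

lemma pbd_comp:
  assumes "pbd T" "pbd (\<lambda>x. vs (g x))" shows "pbd (\<lambda>x. T (g x))"
proof -
  obtain p where "\<And>x. T x \<le> poly p (vs x)"
    using assms unfolding pbd_def by blast
  with pbd_poly[OF assms(2), of p] show ?thesis
    by (auto intro: pbd_mono)
qed

lemmas pbd_intros = pbd_const pbd_vs pbd_add pbd_mult pbd_Suc

text \<open>A step lengthens a stack by at most one symbol, so the output is no longer than input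
  plus running time. Composition rests on this, since the second function runs in time polynomial in
  the output of the first.\<close>

lemma fp_size:
  assumes "fp f" shows "pbd (\<lambda>x. vs (f x))"
proof -
  obtain c T where c: "computes c f T" "pbd T"
    using assms unfolding fp_def by blast
  have "vs (f x) \<le> vs x + T x" for x
  proof -
    obtain t where "t \<le> T x" "exec c (mem (\<lambda>_. []) (toks (ve x) @ []) [] []) t
        (mem (\<lambda>_. []) (toks (ve (f x)) @ []) [] [])"
      using c(1) unfolding computes_def reaches_def by blast
    with exec_length[OF this(2), of rM] show ?thesis by simp
  qed
  with c(2) show ?thesis
    by (auto intro!: pbd_mono[of "\<lambda>x. vs x + T x"] pbd_intros)
qed

lemma fp_id: "fp (\<lambda>x. x)"
  unfolding fp_def computes_def
  by (rule exI[of _ Skip], rule exI[of _ "\<lambda>x. 0"]) (auto intro: reaches_Skip pbd_const)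

lemma fp_comp:
  assumes "fp g" "fp f" shows "fp (\<lambda>x. f (g x))"
proof -
  obtain c T d T' where c: "computes c g T" "pbd T" and d: "computes d f T'" "pbd T'"
    using assms unfolding fp_def by blast
  have "computes (c ;; d) (\<lambda>x. f (g x)) (\<lambda>x. T x + T' (g x))"
    using c(1) d(1) unfolding computes_def
    by (auto intro!: reaches_Seq[OF computesD[OF c(1)] computesD[OF d(1)]])
  moreover have "pbd (\<lambda>x. T x + T' (g x))"
    using c(2) pbd_comp[OF d(2) fp_size[OF assms(1)]] by (rule pbd_add)
  ultimately show ?thesis unfolding fp_def by blast
qed

text \<open>Only trees matter to a program. A cons cell is a pair, a successor is a pair with a
  unit, and a number is a list of units, so these conversions cost nothing.\<close>

lemma fp_recode: "fp f \<Longrightarrow> (\<And>x. ve (g x) = ve (f x)) \<Longrightarrow> fp g"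
  unfolding fp_def computes_def by auto

fun push_all :: "nat list \<Rightarrow> com" where
  "push_all [] = Skip"
| "push_all (x # xs) = push_all xs ;; Push rM x"

lemma push_all: "reaches (push_all xs) (mem s m a e) (2 * length xs) (mem s (xs @ m) a e)"
proof (induction xs)
  case (Cons x xs)
  from reaches_Seq[OF this push_M, of x] show ?case by (auto elim: reaches_mono)
qed (auto intro: reaches_Skip)

lemma wf_push_all: "set xs \<subseteq> {1, 2} \<Longrightarrow> wf_com (push_all xs)"
  by (induction xs) auto

lemma fp_const: "fp (\<lambda>x. c)"
proof -
  let ?c = "discard rM ;; push_all (toks (ve c))"
  have "computes ?c (\<lambda>x. c) (\<lambda>x. 20 * vs x + 2 * vs c)"
    using wf_push_all[OF toks_subset] unfolding computes_def
    by (auto intro!: reaches_Seq[OF discard_M push_all])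
  moreover have "pbd (\<lambda>x :: 'a. 20 * vs x + 2 * vs c)"
    by (intro pbd_intros)
  ultimately show ?thesis unfolding fp_def by blast
qed

lemma fp_pair:
  assumes "fp f" "fp g" shows "fp (\<lambda>x. (f x, g x))"
proof -
  obtain c T d T' where c: "computes c f T" "pbd T" and d: "computes d g T'" "pbd T'"
    using assms unfolding fp_def by blast
  let ?T = "\<lambda>x. 22 * vs x + (T' x + (20 * vs x + (T x + 2)))"
  \<comment> \<open>The second component lies deeper on the stack and is therefore computed first;
    the final 2 is the token that joins the two values.\<close>
  have "reaches (copy rM rA ;; d ;; move rA rM ;; c ;; Push rM 2) (mem s (toks (ve x) @ m) a e) (?T x)
      (mem s (2 # toks (ve (f x)) @ toks (ve (g x)) @ m) a e)" for x s m a e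
    by (rule reaches_Seq[OF copy_MA reaches_Seq[OF computesD[OF d(1)] reaches_Seq[OF move_AM
        reaches_Seq[OF computesD[OF c(1)] push_M]]]])
  then have "computes (copy rM rA ;; d ;; move rA rM ;; c ;; Push rM 2) (\<lambda>x. (f x, g x)) ?T"
    using c(1) d(1) unfolding computes_def by simp
  moreover have "pbd ?T"
    using c(2) d(2) by (intro pbd_add pbd_mult pbd_const pbd_vs)
  ultimately show ?thesis unfolding fp_def by blast
qed

lemma fp_fst_raw: "fp fst"
proof -
  let ?c = "Pop rM ;; move rM rA ;; discard rM ;; move rA rM"
  let ?T = "\<lambda>x. 1 + (20 * vs x + (20 * vs x + 20 * vs x))"
  have "reaches ?c (mem s (toks (ve (u, v)) @ m) a e) (1 + (20 * vs u + (20 * vs v + 20 * vs u)))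
      (mem s (toks (ve u) @ m) a e)" for u :: 'a and v :: 'b and s m a e
  proof -
    have "toks (ve (u, v)) @ m = 2 # toks (ve u) @ toks (ve v) @ m" by simp
    then show ?thesis
      by (simp only:) (rule reaches_Seq[OF pop_M reaches_Seq[OF move_MA reaches_Seq[OF discard_M move_AM]]])
  qed
  then have "reaches ?c (mem s (toks (ve (u, v)) @ m) a e) (?T (u, v)) (mem s (toks (ve u) @ m) a e)"
    for u :: 'a and v :: 'b and s m a e
    by (rule reaches_mono) simp
  then have "computes ?c (fst :: 'a \<times> 'b \<Rightarrow> 'a) ?T"
    unfolding computes_def by (auto simp del: toks.simps ve_prod.simps)
  moreover have "pbd ?T"
    by (intro pbd_intros)
  ultimately show ?thesis unfolding fp_def by blast
qed

lemma fp_snd_raw: "fp snd"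
proof -
  let ?c = "Pop rM ;; discard rM"
  let ?T = "\<lambda>x. 1 + 20 * vs x"
  have "reaches ?c (mem s (toks (ve (u, v)) @ m) a e) (1 + 20 * vs u) (mem s (toks (ve v) @ m) a e)"
    for u :: 'a and v :: 'b and s m a e
  proof -
    have "toks (ve (u, v)) @ m = 2 # toks (ve u) @ toks (ve v) @ m" by simp
    then show ?thesis
      by (simp only:) (rule reaches_Seq[OF pop_M discard_M])
  qed
  then have "reaches ?c (mem s (toks (ve (u, v)) @ m) a e) (?T (u, v)) (mem s (toks (ve v) @ m) a e)"
    for u :: 'a and v :: 'b and s m a e
    by (rule reaches_mono) simp
  then have "computes ?c (snd :: 'a \<times> 'b \<Rightarrow> 'b) ?T"
    unfolding computes_def by (auto simp del: toks.simps ve_prod.simps)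
  moreover have "pbd ?T"
    by (intro pbd_intros)
  ultimately show ?thesis unfolding fp_def by blast
qed

lemma fp_fst: "fp f \<Longrightarrow> fp (\<lambda>x. fst (f x))"
  by (rule fp_comp[OF _ fp_fst_raw])

lemma fp_snd: "fp f \<Longrightarrow> fp (\<lambda>x. snd (f x))"
  by (rule fp_comp[OF _ fp_snd_raw])

text \<open>The common shape of case distinctions on lists, numbers and truth values.\<close>

lemma fp_vcase:
  fixes g :: "'a::venc \<times> 'b::venc \<times> 'c::venc \<Rightarrow> 'd::venc"
  assumes "fp l" "fp f" "fp g"
    and h: "\<And>x. (ve (l x) = VNil \<and> h x = f x) \<or>
      (\<exists>y z. ve (l x) = VCons (ve y) (ve z) \<and> h x = g (x, y, z))"
  shows "fp h"
proof -
  obtain cl Tl cf Tf cg Tg where c: "computes cl l Tl" "pbd Tl"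
      "computes cf f Tf" "pbd Tf" "computes cg g Tg" "pbd Tg"
    using assms unfolding fp_def by blast
  obtain pg where pg: "\<And>x. Tg x \<le> poly pg (vs x)"
    using c(6) unfolding pbd_def by blast
  \<comment> \<open>In the second branch the tree of \<open>l x\<close> already is the pair
    \<open>(y, z)\<close>; placing \<open>x\<close> and the token 2 on top of it gives the triple
    for \<open>g\<close>.\<close>
  let ?p = "Pop rM ;; move rA rM ;; cf" and ?q = "move rA rM ;; Push rM 2 ;; cg"
  let ?c = "copy rM rA ;; cl ;; Cond rM {1} ?p ?q"
  let ?T = "\<lambda>x. 22 * vs x + (Tl x + (1 + 20 * vs x + Tf x + 4 + poly pg (1 + vs x + vs (l x))))"
  have "reaches ?c (mem s (toks (ve x) @ m) a e) (?T x) (mem s (toks (ve (h x)) @ m) a e)" for x s m a e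
  proof -
    let ?s = "mem s (toks (ve (l x)) @ m) (toks (ve x) @ a) e"
    have 1: "reaches (Cond rM {1} ?p ?q) ?s
        (1 + 20 * vs x + Tf x + 4 + poly pg (1 + vs x + vs (l x))) (mem s (toks (ve (h x)) @ m) a e)"
      using h[of x]
    proof
      assume hx: "ve (l x) = VNil \<and> h x = f x"
      then have s: "?s = mem s (1 # m) (toks (ve x) @ a) e" by simp
      have "reaches ?p ?s (1 + (20 * vs x + Tf x)) (mem s (toks (ve (h x)) @ m) a e)"
        unfolding s conjunct2[OF hx]
        by (rule reaches_Seq[OF pop_M reaches_Seq[OF move_AM computesD[OF c(3)]]])
      then show ?thesis
        by (intro reaches_mono[OF reaches_CondT]) (auto simp: top_of_def hx)
    next
      assume "\<exists>y z. ve (l x) = VCons (ve y) (ve z) \<and> h x = g (x, y, z)"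
      then obtain y z where yz: "ve (l x) = VCons (ve y) (ve z)" "h x = g (x, y, z)" by blast
      have e: "2 # toks (ve x) @ toks (ve (l x)) @ m = toks (ve (x, y, z)) @ m"
        by (simp add: yz)
      have "reaches ?q ?s (20 * vs x + (2 + Tg (x, y, z))) (mem s (toks (ve (h x)) @ m) a e)"
        unfolding yz(2)
        by (rule reaches_Seq[OF move_AM reaches_Seq[OF
            push_M[of 2 s "toks (ve x) @ toks (ve (l x)) @ m" a e, unfolded e] computesD[OF c(5)]]])
      moreover have "Tg (x, y, z) \<le> poly pg (1 + vs x + vs (l x))"
        using pg[of "(x, y, z)"] by (simp add: yz)
      ultimately show ?thesis
        by (intro reaches_mono[OF reaches_CondF]) (auto simp: top_of_def yz)
    qed
    show ?thesis
      by (rule reaches_Seq[OF copy_MA reaches_Seq[OF computesD[OF c(1)] 1]])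
  qed
  then have "computes ?c h ?T"
    using c unfolding computes_def by auto
  moreover have "pbd ?T"
    using c by (intro pbd_add pbd_mult pbd_const pbd_vs pbd_poly fp_size assms)
  ultimately show ?thesis unfolding fp_def by blast
qed

text \<open>The list lies above the accumulator. In each round the tail waits in \<open>rE\<close>,
  while the head, passed through \<open>rA\<close>, is joined with the accumulator to the argument
  of \<open>c\<close>. The loop stops at the token 1 of the empty list, which the caller
  removes.\<close>

definition fold_loop :: "com \<Rightarrow> com" where
  "fold_loop c = While rM {2}
     (Pop rM ;; move rM rA ;; move rM rE ;; move rA rM ;; Push rM 2 ;; c ;; move rE rM)"

lemma fold_loop:
  assumes c: "computes c f T"
    and W: "\<And>k. k < length xs \<Longrightarrow> T (xs ! k, fold (curry f) (take k xs) acc) \<le> W"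
    and N: "vs xs \<le> N"
  shows "reaches (fold_loop c) (mem s (toks (ve xs) @ toks (ve acc) @ m) a e)
     (length xs * (W + 80 * N + 5) + 1) (mem s (1 # toks (ve (fold (curry f) xs acc)) @ m) a e)"
  using W N
proof (induction xs arbitrary: acc)
  case Nil
  show ?case
    using reaches_WhileF[of "mem s (1 # toks (ve acc) @ m) a e" rM "{2}"]
    by (simp add: fold_loop_def top_of_def)
next
  case (Cons x xs)
  let ?s = "mem s (toks (ve (x # xs)) @ toks (ve acc) @ m) a e"
  let ?s' = "mem s (toks (ve xs) @ toks (ve (f (x, acc))) @ m) a e"
  have 1: "reaches (Pop rM ;; move rM rA ;; move rM rE ;; move rA rM ;; Push rM 2 ;; c ;; move rE rM) ?s
      (1 + (20 * vs x + (20 * vs xs + (20 * vs x + (2 + (T (x, acc) + 20 * vs xs)))))) ?s'"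
  proof -
    have "toks (ve (x # xs)) @ toks (ve acc) @ m = 2 # toks (ve x) @ toks (ve xs) @ toks (ve acc) @ m"
      by simp
    moreover have e: "2 # toks (ve x) @ toks (ve acc) @ m = toks (ve (x, acc)) @ m"
      by simp
    moreover have "reaches (Push rM 2 ;; c ;; move rE rM)
        (mem s (toks (ve x) @ toks (ve acc) @ m) a (toks (ve xs) @ e))
        (2 + (T (x, acc) + 20 * vs xs)) ?s'"
      by (rule reaches_Seq[OF push_M[of 2 s "toks (ve x) @ toks (ve acc) @ m", unfolded e]
          reaches_Seq[OF computesD[OF c] move_EM]])
    ultimately show ?thesis
      using reaches_Seq[OF pop_M reaches_Seq[OF move_MA reaches_Seq[OF move_ME reaches_Seq[OF move_AM]]]]
      by (simp only:)
  qed
  have 2: "reaches (fold_loop c) ?s' (length xs * (W + 80 * N + 5) + 1)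
      (mem s (1 # toks (ve (fold (curry f) xs (f (x, acc)))) @ m) a e)"
  proof (rule Cons.IH)
    show "T (xs ! k, fold (curry f) (take k xs) (f (x, acc))) \<le> W" if "k < length xs" for k
      using Cons.prems(1)[of "Suc k"] that by (simp add: curry_def)
  qed (use Cons.prems in simp)
  have 3: "T (x, acc) \<le> W" "vs x + vs xs \<le> N"
    using Cons.prems(1)[of 0] Cons.prems(2) by auto
  have "top_of ?s rM \<in> {2}" by (simp add: top_of_def)
  from reaches_mono[OF reaches_WhileT[OF this 1 2[unfolded fold_loop_def]]] 3 show ?case
    unfolding fold_loop_def by (simp add: curry_def)
qed

text \<open>All intermediate accumulators are bounded by assumption, since a polynomial-time step
  that doubles its argument would make them exponentially large.\<close>

lemma fp_fold_raw:
  fixes f :: "'x::venc \<times> 's::venc \<Rightarrow> 's" and l :: "'e::venc \<Rightarrow> 'x list"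
  assumes "fp f" "fp l" "fp a" "pbd B"
    and B: "\<And>e k. vs (fold (curry f) (take k (l e)) (a e)) \<le> B e"
  shows "fp (\<lambda>e. fold (curry f) (l e) (a e))"
proof -
  obtain c T where c: "computes c f T" "pbd T"
    using assms unfolding fp_def by blast
  obtain p where p: "\<And>x. T x \<le> poly p (vs x)"
    using c(2) unfolding pbd_def by blast
  let ?c = "Pop rM ;; fold_loop c ;; Pop rM"
  obtain d T' where d: "computes d (\<lambda>e. (l e, a e)) T'" "pbd T'"
    using fp_pair[OF assms(2,3)] unfolding fp_def by blast
  let ?W = "\<lambda>e. poly p (1 + vs (l e) + B e)"
  let ?T = "\<lambda>e. T' e + (1 + (vs (l e) * (?W e + 80 * vs (l e) + 5) + 1 + 1))"
  have "reaches (d ;; ?c) (mem s (toks (ve e) @ m) x y) (?T e)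
      (mem s (toks (ve (fold (curry f) (l e) (a e))) @ m) x y)" for s m e x y
  proof -
    have "T (l e ! k, fold (curry f) (take k (l e)) (a e)) \<le> ?W e" if "k < length (l e)" for k
    proof -
      have "vs (l e ! k, fold (curry f) (take k (l e)) (a e)) \<le> 1 + vs (l e) + B e"
        using vs_mem[OF nth_mem[OF that]] B[of k e] by simp
      then show ?thesis using p poly_nat_mono le_trans by blast
    qed
    from fold_loop[OF c(1) this order.refl]
    have 1: "reaches (fold_loop c) (mem s (toks (ve (l e)) @ toks (ve (a e)) @ m) x y)
       (vs (l e) * (?W e + 80 * vs (l e) + 5) + 1) (mem s (1 # toks (ve (fold (curry f) (l e) (a e))) @ m) x y)"
      by (rule reaches_mono) (auto intro!: mult_right_mono length_le_vs)
    have "reaches d (mem s (toks (ve e) @ m) x y) (T' e)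
        (mem s (2 # toks (ve (l e)) @ toks (ve (a e)) @ m) x y)"
      using d(1) unfolding computes_def by simp
    from reaches_Seq[OF this reaches_Seq[OF pop_M reaches_Seq[OF 1 pop_M]]] show ?thesis .
  qed
  then have "computes (d ;; ?c) (\<lambda>e. fold (curry f) (l e) (a e)) ?T"
    using c d unfolding computes_def by (auto simp: fold_loop_def)
  moreover have "pbd ?T"
    using c d by (intro pbd_add pbd_mult pbd_const pbd_vs pbd_poly fp_size assms)
  ultimately show ?thesis unfolding fp_def by blast
qed

text \<open>The parameter \<open>e\<close> travels with the accumulator as a second
  component.\<close>

lemma fp_fold_bounded:
  fixes st :: "'x::venc \<Rightarrow> 's::venc \<Rightarrow> 'e::venc \<Rightarrow> 's" and l :: "'e \<Rightarrow> 'x list"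
  assumes "fp (\<lambda>p. st (fst p) (fst (snd p)) (snd (snd p)))" "fp l" "fp a" "pbd B"
    and B: "\<And>e k. vs (fold (\<lambda>x s. st x s e) (take k (l e)) (a e)) \<le> B e"
  shows "fp (\<lambda>e. fold (\<lambda>x s. st x s e) (l e) (a e))"
proof -
  let ?f = "\<lambda>p :: 'x \<times> 's \<times> 'e. (st (fst p) (fst (snd p)) (snd (snd p)), snd (snd p))"
  have eq: "fold (curry ?f) xs (s, e) = (fold (\<lambda>x s. st x s e) xs s, e)" for xs s e
    by (induction xs arbitrary: s) auto
  have "fp (\<lambda>e. fold (curry ?f) (l e) (a e, e))"
  proof (rule fp_fold_raw)
    show "fp ?f" by (intro fp_pair assms fp_snd fp_id)
    show "fp (\<lambda>e. (a e, e))" by (intro fp_pair assms fp_id)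
    show "pbd (\<lambda>e. 1 + B e + vs e)" by (intro pbd_intros assms)
    show "vs (fold (curry ?f) (take k (l e)) (a e, e)) \<le> 1 + B e + vs e" for e k
      using B[of e k] by (simp add: eq)
  qed (rule assms)
  from fp_fst[OF this] show ?thesis by (simp add: eq)
qed

text \<open>Growth by an additive amount that depends on the parameter alone sums to a polynomial
  over the length of the list. The invariant supplies what the growth estimate needs to know about
  the accumulator.\<close>

lemma fp_fold_inv:
  fixes st :: "'x::venc \<Rightarrow> 's::venc \<Rightarrow> 'e::venc \<Rightarrow> 's" and l :: "'e \<Rightarrow> 'x list"
  assumes st: "fp (\<lambda>p. st (fst p) (fst (snd p)) (snd (snd p)))" and "fp l" "fp a" "pbd G"
    and inv0: "\<And>e. I e (a e)"
    and inv: "\<And>e x s. x \<in> set (l e) \<Longrightarrow> I e s \<Longrightarrow> I e (st x s e) \<and> vs (st x s e) \<le> vs s + G e"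
  shows "fp (\<lambda>e. fold (\<lambda>x s. st x s e) (l e) (a e))"
proof (rule fp_fold_bounded[OF st])
  show "pbd (\<lambda>e. vs (a e) + vs (l e) * G e)"
    by (intro pbd_intros fp_size assms)
  have "vs (fold (\<lambda>x s. st x s e) xs s) \<le> vs s + length xs * G e"
    if "set xs \<subseteq> set (l e)" "I e s" for e xs s
    using that
  proof (induction xs arbitrary: s)
    case (Cons x xs)
    from Cons.IH[of "st x s e"] inv[of x e s] Cons.prems show ?case by auto
  qed simp
  then have "vs (fold (\<lambda>x s. st x s e) (take k (l e)) (a e)) \<le> vs (a e) + length (take k (l e)) * G e" for e k
    using inv0 set_take_subset[of k "l e"] by blast
  moreover have "vs (a e) + length (take k (l e)) * G e \<le> vs (a e) + vs (l e) * G e" for e k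
    using length_le_vs[of "l e"] by (intro add_left_mono mult_right_mono) auto
  ultimately show "vs (fold (\<lambda>x s. st x s e) (take k (l e)) (a e)) \<le> vs (a e) + vs (l e) * G e" for e k
    using le_trans by blast
qed (rule assms)+

lemmas fp_fold = fp_fold_inv[where I = "\<lambda>_ _. True", simplified]

subsection \<open>A library of polynomial-time functions\<close>

named_theorems fp_intros

declare fp_id [fp_intros] fp_const [fp_intros] fp_pair [fp_intros] fp_fst [fp_intros] fp_snd [fp_intros]

lemma fp_eqI: "fp f \<Longrightarrow> (\<And>e. g e = f e) \<Longrightarrow> fp g"
  by (rule fp_recode) auto

lemma fp_if [fp_intros]:
  assumes "fp c" "fp f" "fp g" shows "fp (\<lambda>e. if c e then f e else g e)"
  by (rule fp_vcase[where l = c and f = g and g = "\<lambda>p :: _ \<times> unit \<times> unit. f (fst p)"])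
     (auto intro: assms fp_comp[OF fp_fst[OF fp_id]] simp: ve_bool_def ve_unit_def)

lemma fp_Cons [fp_intros]: "fp f \<Longrightarrow> fp g \<Longrightarrow> fp (\<lambda>e. f e # g e)"
  by (erule (1) fp_recode[OF fp_pair]) simp

lemma fp_Suc [fp_intros]: "fp f \<Longrightarrow> fp (\<lambda>e. Suc (f e))"
  by (erule fp_recode[OF fp_pair[OF fp_const[of "()"]]]) (simp add: ve_unit_def)

lemma fp_case_list [fp_intros]:
  assumes "fp l" "fp f" "fp (\<lambda>p. g (fst p) (fst (snd p)) (snd (snd p)))"
  shows "fp (\<lambda>e. case l e of [] \<Rightarrow> f e | y # ys \<Rightarrow> g e y ys)"
  by (rule fp_vcase[OF assms]) (auto split: list.splits)

lemma fp_case_nat [fp_intros]: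
  assumes "fp l" "fp f" "fp (\<lambda>p. g (fst p) (snd p))"
  shows "fp (\<lambda>e. case l e of 0 \<Rightarrow> f e | Suc n \<Rightarrow> g e n)"
proof (rule fp_vcase[OF assms(1,2)])
  show "fp (\<lambda>p :: _ \<times> unit \<times> nat. g (fst p) (snd (snd p)))"
    using fp_comp[OF _ assms(3), of "\<lambda>p. (fst p, snd (snd p))"] by (simp add: fp_intros)
qed (auto split: nat.splits simp: ve_unit_def)

lemma fp_Not [fp_intros]: "fp f \<Longrightarrow> fp (\<lambda>e. \<not> f e)"
  by (rule fp_eqI[OF fp_if[OF _ fp_const[of False] fp_const[of True]]]) auto

lemma fp_conj [fp_intros]: "fp f \<Longrightarrow> fp g \<Longrightarrow> fp (\<lambda>e. f e \<and> g e)"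
  by (rule fp_eqI[OF fp_if[OF _ _ fp_const[of False]], of f g]) auto

lemma fp_rev [fp_intros]:
  assumes "fp l" shows "fp (\<lambda>e. rev (l e))"
proof -
  have "fp (\<lambda>e. fold (\<lambda>x s. x # s) (l e) [])"
  proof (rule fp_fold[where G = "\<lambda>e. 1 + vs (l e)"])
    show "vs (x # s) \<le> vs s + (1 + vs (l e))" if "x \<in> set (l e)" for x s e
      using vs_mem[OF that] by simp
  qed (intro fp_intros assms pbd_intros fp_size)+
  then show ?thesis by (simp add: fold_Cons_rev)
qed

lemma fp_append [fp_intros]:
  assumes "fp f" "fp g" shows "fp (\<lambda>e. f e @ g e)"
proof -
  have "fp (\<lambda>e. fold (\<lambda>x s. x # s) (rev (f e)) (g e))"
  proof (rule fp_fold[where G = "\<lambda>e. 1 + vs (f e)"])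
    show "vs (x # s) \<le> vs s + (1 + vs (f e))" if "x \<in> set (rev (f e))" for x s e
      using vs_mem[of x "f e"] that by simp
  qed (intro fp_intros assms pbd_intros fp_size)+
  then show ?thesis by (simp add: fold_Cons_rev)
qed

lemma fp_size_elem:
  assumes "fp l" "fp (\<lambda>p. f (fst p) (snd p))"
  shows "\<exists>G. pbd G \<and> (\<forall>e. \<forall>x\<in>set (l e). vs (f x e) \<le> G e)"
proof -
  obtain p where p: "\<And>x e. vs (f x e) \<le> poly p (vs (x, e))"
    using fp_size[OF assms(2)] unfolding pbd_def by (auto simp del: ve_prod.simps)
  have "vs (f x e) \<le> poly p (1 + vs (l e) + vs e)" if "x \<in> set (l e)" for x e
    by (rule order.trans[OF p poly_nat_mono]) (use vs_mem[OF that] in simp)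
  moreover have "pbd (\<lambda>e. poly p (1 + vs (l e) + vs e))"
    by (intro pbd_intros pbd_poly fp_size assms)
  ultimately show ?thesis by blast
qed

lemma fp_concat_map [fp_intros]:
  assumes "fp l" "fp (\<lambda>p. f (fst p) (snd p))"
  shows "fp (\<lambda>e. concat (map (\<lambda>x. f x e) (l e)))"
proof -
  obtain G where G: "pbd G" "\<And>e x. x \<in> set (l e) \<Longrightarrow> vs (f x e) \<le> G e"
    using fp_size_elem[OF assms] by blast
  have "fp (\<lambda>e. fold (\<lambda>x s. f x e @ s) (rev (l e)) [])"
  proof (rule fp_fold[where G = G])
    show "fp (\<lambda>p. f (fst p) (snd (snd p)) @ fst (snd p))"
      using fp_comp[OF _ assms(2), of "\<lambda>p. (fst p, snd (snd p))"]
      by (intro fp_append) (simp_all add: fp_intros)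
    show "vs (f x e @ s) \<le> vs s + G e" if "x \<in> set (rev (l e))" for x s e
      using vs_append[of "f x e" s] G(2)[of x e] that by simp
  qed (intro fp_intros assms G)+
  moreover have "fold (\<lambda>x s. f x e @ s) (rev xs) [] = concat (map (\<lambda>x. f x e) xs)" for xs e
    by (induction xs) auto
  ultimately show ?thesis by simp
qed

lemma fp_map [fp_intros]:
  assumes "fp l" "fp (\<lambda>p. f (fst p) (snd p))"
  shows "fp (\<lambda>e. map (\<lambda>x. f x e) (l e))"
proof -
  have "fp (\<lambda>e. concat (map (\<lambda>x. [f x e]) (l e)))"
    by (intro fp_intros assms)
  moreover have "concat (map (\<lambda>x. [f x e]) xs) = map (\<lambda>x. f x e) xs" for xs e
    by (induction xs) auto
  ultimately show ?thesis by simp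
qed

lemma fp_filter [fp_intros]:
  assumes "fp l" "fp (\<lambda>p. f (fst p) (snd p))"
  shows "fp (\<lambda>e. filter (\<lambda>x. f x e) (l e))"
proof -
  have "fp (\<lambda>e. concat (map (\<lambda>x. if f x e then [x] else []) (l e)))"
    by (intro fp_intros assms)
  moreover have "concat (map (\<lambda>x. if f x e then [x] else []) xs) = filter (\<lambda>x. f x e) xs" for xs e
    by (induction xs) auto
  ultimately show ?thesis by simp
qed

lemma fp_null [fp_intros]: "fp l \<Longrightarrow> fp (\<lambda>e. l e = [])"
  by (rule fp_eqI[OF fp_case_list[OF _ fp_const[of True] fp_const[of False]], of l]) (auto split: list.splits)

lemma fp_ball [fp_intros]:
  assumes "fp l" "fp (\<lambda>p. f (fst p) (snd p))"
  shows "fp (\<lambda>e. \<forall>x\<in>set (l e). f x e)"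
proof -
  have "fp (\<lambda>e. filter (\<lambda>x. \<not> f x e) (l e) = [])"
    by (intro fp_intros assms)
  then show ?thesis by (simp add: filter_empty_conv)
qed

lemma fp_bex [fp_intros]:
  assumes "fp l" "fp (\<lambda>p. f (fst p) (snd p))"
  shows "fp (\<lambda>e. \<exists>x\<in>set (l e). f x e)"
proof -
  have "fp (\<lambda>e. \<not> (\<forall>x\<in>set (l e). \<not> f x e))"
    by (intro fp_intros assms)
  then show ?thesis by simp
qed

lemma fp_tl [fp_intros]: "fp l \<Longrightarrow> fp (\<lambda>e. tl (l e))"
  using fp_case_list[of l "\<lambda>_. []" "\<lambda>_ _ ys. ys"] by (simp add: fp_intros tl_def)

definition hdd :: "'a \<Rightarrow> 'a list \<Rightarrow> 'a" where
  "hdd d l = (case l of [] \<Rightarrow> d | x # _ \<Rightarrow> x)"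

lemma fp_hdd [fp_intros]: "fp l \<Longrightarrow> fp (\<lambda>e. hdd d (l e))"
  unfolding hdd_def by (intro fp_intros)

lemma fp_length [fp_intros]:
  assumes "fp l" shows "fp (\<lambda>e. length (l e))"
proof -
  have "fp (\<lambda>e. fold (\<lambda>x s. Suc s) (l e) 0)"
    by (rule fp_fold[where G = "\<lambda>e. 2"]) (intro fp_intros assms pbd_intros | simp)+
  moreover have "fold (\<lambda>x s. Suc s) xs n = n + length xs" for xs :: "'b list" and n
    by (induction xs arbitrary: n) auto
  ultimately show ?thesis by simp
qed

lemma fp_replicate_unit: "fp n \<Longrightarrow> fp (\<lambda>e. replicate (n e) ())"
proof (erule fp_recode)
  have "ve (replicate k ()) = ve k" for k
    by (induction k) (auto simp: ve_unit_def)
  then show "ve (replicate (n x) ()) = ve (n x)" for x .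
qed

lemma fp_funpow_inv:
  fixes st :: "'s::venc \<Rightarrow> 'e::venc \<Rightarrow> 's"
  assumes st: "fp (\<lambda>p. st (fst p) (snd p))" and "fp n" "fp a" "pbd G"
    and inv0: "\<And>e. I e (a e)"
    and inv: "\<And>e s. I e s \<Longrightarrow> I e (st s e) \<and> vs (st s e) \<le> vs s + G e"
  shows "fp (\<lambda>e. ((\<lambda>s. st s e) ^^ n e) (a e))"
proof -
  have "fp (\<lambda>p :: unit \<times> 's \<times> 'e. st (fst (snd p)) (snd (snd p)))"
    using fp_comp[OF _ st, of "\<lambda>p. snd p"] by (simp add: fp_intros)
  then have "fp (\<lambda>e. fold (\<lambda>u s. st s e) (replicate (n e) ()) (a e))"
    by (rule fp_fold_inv[where I = I and G = G]) (use assms in \<open>auto intro: fp_replicate_unit\<close>)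
  then show ?thesis by (simp add: fold_replicate)
qed

lemmas fp_funpow = fp_funpow_inv[where I = "\<lambda>_ _. True", simplified]

lemma fp_nat_pred [fp_intros]: "fp f \<Longrightarrow> fp (\<lambda>e. f e - Suc 0)"
  by (rule fp_eqI[OF fp_case_nat[OF _ fp_const[of 0] fp_snd[OF fp_id]], of f]) (auto split: nat.splits)

lemma fp_add [fp_intros]:
  fixes f :: "'a::venc \<Rightarrow> nat" assumes "fp f" "fp g" shows "fp (\<lambda>e. f e + g e)"
proof -
  have "fp (\<lambda>e. ((\<lambda>s. Suc s) ^^ f e) (g e))"
    by (rule fp_funpow[where G = "\<lambda>e. 2"]) (intro fp_intros assms pbd_intros | simp)+
  moreover have "((\<lambda>s. Suc s) ^^ m) n = m + n" for m n by (induction m) auto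
  ultimately show ?thesis by simp
qed

lemma fp_minus [fp_intros]:
  fixes f :: "'a::venc \<Rightarrow> nat" assumes "fp f" "fp g" shows "fp (\<lambda>e. f e - g e)"
proof -
  have "fp (\<lambda>e. ((\<lambda>s. s - Suc 0) ^^ g e) (f e))"
    by (rule fp_funpow[where G = "\<lambda>e. 0"]) (intro fp_intros assms pbd_intros | simp add: vs_nat)+
  moreover have "((\<lambda>s. s - Suc 0) ^^ m) n = n - m" for m n by (induction m) auto
  ultimately show ?thesis by simp
qed

lemma fp_mult [fp_intros]:
  fixes f :: "'a::venc \<Rightarrow> nat" assumes "fp f" "fp g" shows "fp (\<lambda>e. f e * g e)"
proof -
  have "fp (\<lambda>e. ((\<lambda>s. s + g e) ^^ f e) 0)"
  proof (rule fp_funpow[where G = "\<lambda>e. vs (g e)"])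
    show "fp (\<lambda>p. fst p + g (snd p))"
      by (intro fp_intros fp_comp[OF _ assms(2)])
  qed (intro fp_intros assms pbd_intros fp_size | simp add: vs_nat)+
  moreover have "((\<lambda>s. s + n) ^^ m) 0 = m * n" for m n :: nat by (induction m) auto
  ultimately show ?thesis by simp
qed

lemma fp_le [fp_intros]:
  fixes f :: "'a::venc \<Rightarrow> nat" assumes "fp f" "fp g" shows "fp (\<lambda>e. f e \<le> g e)"
proof -
  have "fp (\<lambda>e. case f e - g e of 0 \<Rightarrow> True | Suc _ \<Rightarrow> False)"
    by (intro fp_intros assms)
  then show ?thesis by (rule fp_eqI) (auto split: nat.splits)
qed

lemma fp_less [fp_intros]:
  fixes f :: "'a::venc \<Rightarrow> nat" assumes "fp f" "fp g" shows "fp (\<lambda>e. f e < g e)"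
  by (rule fp_eqI[OF fp_le[OF fp_Suc[OF assms(1)] assms(2)]]) auto

lemma fp_eq_nat [fp_intros]:
  fixes f :: "'a::venc \<Rightarrow> nat" assumes "fp f" "fp g" shows "fp (\<lambda>e. f e = g e)"
  by (rule fp_eqI[OF fp_conj[OF fp_le[OF assms] fp_le[OF assms(2,1)]]]) auto

lemma fp_iff [fp_intros]: "fp f \<Longrightarrow> fp g \<Longrightarrow> fp (\<lambda>e. f e = (g e :: bool))"
  by (rule fp_eqI[OF fp_if[OF _ _ fp_Not], of f g g]) auto

lemma fp_poly [fp_intros]:
  fixes f :: "'a::venc \<Rightarrow> nat" assumes "fp f" shows "fp (\<lambda>e. poly p (f e))"
proof (induction p)
  case 0
  show ?case by (simp add: fp_const)
next
  case (pCons a p)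
  show ?case
    by (simp only: poly_pCons) (intro fp_add fp_mult fp_const assms pCons.IH)
qed

lemma fp_drop [fp_intros]:
  assumes "fp n" "fp l" shows "fp (\<lambda>e. drop (n e) (l e))"
proof -
  have "fp (\<lambda>e. ((\<lambda>s. tl s) ^^ n e) (l e))"
  proof (rule fp_funpow[where G = "\<lambda>e. 0"])
    show "vs (tl s) \<le> vs s + 0" for s :: "'b list" by (cases s) auto
  qed (intro fp_intros assms pbd_intros)+
  moreover have "((\<lambda>s. tl s) ^^ m) xs = drop m xs" for m and xs :: "'b list"
    by (induction m) (auto simp: drop_Suc tl_drop)
  ultimately show ?thesis by simp
qed

definition nthd :: "'a \<Rightarrow> 'a list \<Rightarrow> nat \<Rightarrow> 'a" where
  "nthd d l n = hdd d (drop n l)"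

lemma nthd_eq: "nthd d l n = (if n < length l then l ! n else d)"
  by (auto simp: nthd_def hdd_def hd_drop_conv_nth[symmetric] split: list.splits)

lemma fp_nthd [fp_intros]: "fp l \<Longrightarrow> fp n \<Longrightarrow> fp (\<lambda>e. nthd d (l e) (n e))"
  unfolding nthd_def by (intro fp_intros)

lemma fp_upt [fp_intros]:
  assumes "fp n" shows "fp (\<lambda>e. [0..<n e])"
proof -
  let ?st = "\<lambda>s :: nat \<times> nat list. (fst s - Suc 0, (fst s - Suc 0) # snd s)"
  have "fp (\<lambda>e. (?st ^^ n e) (n e, []))"
  \<comment> \<open>The list is built downwards; the counter never exceeds \<open>n e\<close>, which
    bounds each number put in front.\<close>
  proof (rule fp_funpow_inv[where G = "\<lambda>e. 1 + vs (n e)" and I = "\<lambda>e s. fst s \<le> n e"])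
    show "fst (?st s) \<le> n e \<and> vs (?st s) \<le> vs s + (1 + vs (n e))" if "fst s \<le> n e" for e s
      using that by (cases s) (auto simp: vs_nat)
  qed (intro fp_intros assms pbd_intros fp_size | simp)+
  then have "fp (\<lambda>e. snd ((?st ^^ n e) (n e, [])))"
    by (rule fp_snd)
  moreover have "k \<le> m \<Longrightarrow> (?st ^^ k) (m, []) = (m - k, [m - k..<m])" for k m
    by (induction k) (auto simp: upt_conv_Cons Suc_diff_Suc)
  ultimately show ?thesis by simp
qed

lemma fp_zip [fp_intros]:
  fixes f :: "'e::venc \<Rightarrow> 'a::venc list" and g :: "'e \<Rightarrow> 'b::venc list"
  assumes "fp f" "fp g" shows "fp (\<lambda>e. zip (f e) (g e))"
proof -
  let ?st = "\<lambda>(x :: 'b) (s :: 'a list \<times> ('a \<times> 'b) list). case fst s of [] \<Rightarrow> s | a # as \<Rightarrow> (as, (a, x) # snd s)"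
  have "fp (\<lambda>e. fold (\<lambda>x s. ?st x s) (g e) (f e, []))"
  proof (rule fp_fold[where G = "\<lambda>e. 1 + vs (g e)"])
    show "vs (?st x s) \<le> vs s + (1 + vs (g e))" if "x \<in> set (g e)" for x e s
      using vs_mem[OF that] by (cases s) (auto split: list.splits)
  qed (intro fp_intros assms pbd_intros fp_size)+
  then have "fp (\<lambda>e. rev (snd (fold ?st (g e) (f e, []))))"
    by (intro fp_intros)
  moreover have "snd (fold ?st ys (xs, zs)) = rev (zip xs ys) @ zs" for xs ys zs
  proof (induction ys arbitrary: xs zs)
    case (Cons y ys)
    then show ?case
    proof (cases xs)
      case Nil
      have "fold ?st ys ([], zs) = ([], zs)" by (induction ys) auto
      then show ?thesis using Nil by simp
    qed simp
  qed simp
  ultimately show ?thesis by simp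
qed

instantiation val :: venc begin
definition ve_val :: "val \<Rightarrow> val" where "ve_val v = v"
instance ..
end

lemma fp_eq_val: "fp (\<lambda>u :: val. u = v)"
proof (induction v)
  case VNil
  have "fp (\<lambda>p :: val \<times> val \<times> val. False)" by (rule fp_const)
  from fp_vcase[OF fp_id fp_const[of True] this, where h = "\<lambda>u. u = VNil"] show ?case
    by (auto simp: ve_val_def) (metis val.exhaust)
next
  case (VCons v w)
  have "fp (\<lambda>p :: val \<times> val \<times> val. fst (snd p) = v \<and> snd (snd p) = w)"
    by (intro fp_intros fp_comp[OF _ VCons.IH(1)] fp_comp[OF _ VCons.IH(2)])
  from fp_vcase[OF fp_id fp_const[of False] this, where h = "\<lambda>u. u = VCons v w"] show ?case
    by (auto simp: ve_val_def) (metis val.exhaust)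
qed

lemma fp_eq_const:
  assumes "inj (ve :: 'b::venc \<Rightarrow> val)" "fp (f :: 'a::venc \<Rightarrow> 'b)"
  shows "fp (\<lambda>e. f e = c)"
proof -
  have "fp (\<lambda>e. ve (f e))"
    by (rule fp_recode[OF assms(2)]) (simp add: ve_val_def)
  from fp_comp[OF this fp_eq_val[of "ve c"]] show ?thesis
    by (rule fp_eqI) (use assms(1) in \<open>auto dest: injD\<close>)
qed

text \<open>Finitely many comparisons with constants realise an arbitrary function on a finite set.
  In this way the transition function of a machine, about which nothing else is known, becomes
  computable in the class.\<close>

lemma fp_finite_lookup:
  assumes inj: "inj (ve :: 'b::venc \<Rightarrow> val)" and "finite S" and f: "fp (f :: 'a::venc \<Rightarrow> 'b)"
  shows "fp (\<lambda>e. if f e \<in> S then F (f e) else d)"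
  using \<open>finite S\<close>
proof (induction S rule: finite_induct)
  case empty
  show ?case by (simp add: fp_const)
next
  case (insert c S)
  show ?case
    by (rule fp_eqI[OF fp_if[OF fp_eq_const[OF inj f, of c] fp_const[of "F c"] insert.IH]]) auto
qed

lemma inj_ve_nat: "inj (ve :: nat \<Rightarrow> val)"
proof (rule injI)
  fix x y :: nat
  assume "ve x = ve y"
  then have "vs x = vs y" by (rule arg_cong)
  then show "x = y" by (simp add: vs_nat)
qed

lemma inj_ve_list:
  assumes "inj (ve :: 'a::venc \<Rightarrow> val)" shows "inj (ve :: 'a list \<Rightarrow> val)"
proof (rule injI)
  show "ve x = ve y \<Longrightarrow> x = y" for x y :: "'a list"
  proof (induction x arbitrary: y)
    case Nil
    then show ?case by (cases y) auto
  next
    case (Cons a x)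
    then show ?case by (cases y) (auto dest: injD[OF assms])
  qed
qed

lemma inj_ve_prod:
  assumes "inj (ve :: 'a::venc \<Rightarrow> val)" "inj (ve :: 'b::venc \<Rightarrow> val)"
  shows "inj (ve :: 'a \<times> 'b \<Rightarrow> val)"
  by (rule injI) (auto dest: injD[OF assms(1)] injD[OF assms(2)])

subsection \<open>From polynomial-time functions to Turing machines\<close>

lemma push_all_any: "reaches (push_all xs) s (2 * length xs) (s(rM := xs @ s rM))"
proof (induction xs)
  case Nil
  show ?case using reaches_Skip[of s] by simp
next
  case (Cons x xs)
  from reaches_Seq[OF this reaches_Push[of rM x]]
  show ?case by (simp del: fun_upd_apply add: fun_upd_same)
qed

text \<open>A list tree grows from its last element, so the input is first reversed into
  \<open>rB\<close>. The blocks 2, 2, 1, 1 and 2, 1 are a cons token followed by the tree of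
  \<open>True\<close> or \<open>False\<close>.\<close>

definition load :: "nat \<Rightarrow> com" where
  "load r = While r {1, 2} (Cond r {2} (Push rB 2) (Push rB 1) ;; Pop r) ;; Push rM 1 ;;
     While rB {1, 2} (Cond rB {2} (push_all [2, 2, 1, 1]) (push_all [2, 1]) ;; Pop rB)"

lemma load_loop1:
  assumes "s r = map bit_sym w" "r < rM"
  shows "reaches (While r {1, 2} (Cond r {2} (Push rB 2) (Push rB 1) ;; Pop r)) s (7 * length w + 1)
     (s(r := [], rB := rev (map bit_sym w) @ s rB))"
  using assms
proof (induction w arbitrary: s)
  case Nil
  then have "s(r := [], rB := rev (map bit_sym []) @ s rB) = s" by auto
  then show ?case using Nil reaches_WhileF[of s r "{1,2}"]
    by (simp add: top_of_def del: fun_upd_apply)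
next
  case (Cons b w)
  let ?s1 = "s(rB := bit_sym b # s rB, r := map bit_sym w)"
  have "reaches (Cond r {2} (Push rB 2) (Push rB 1)) s (2 + 2) (s(rB := bit_sym b # s rB))"
  proof (cases b)
    case True
    then show ?thesis using Cons.prems reaches_Push[of rB 2 s]
      by (intro reaches_mono[OF reaches_CondT]) (auto simp: top_of_def)
  next
    case False
    then show ?thesis using Cons.prems reaches_Push[of rB 1 s]
      by (intro reaches_mono[OF reaches_CondF]) (auto simp: top_of_def)
  qed
  from reaches_Seq[OF this reaches_Pop[of r]]
  have 2: "reaches (Cond r {2} (Push rB 2) (Push rB 1) ;; Pop r) s (2 + 2 + 1) ?s1"
    using Cons.prems by simp
  have 3: "reaches (While r {1, 2} (Cond r {2} (Push rB 2) (Push rB 1) ;; Pop r)) ?s1 (7 * length w + 1)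
      (?s1(r := [], rB := rev (map bit_sym w) @ ?s1 rB))"
    using Cons.prems by (intro Cons.IH) auto
  have 4: "?s1(r := [], rB := rev (map bit_sym w) @ ?s1 rB) = s(r := [], rB := rev (map bit_sym (b # w)) @ s rB)"
    using Cons.prems by (auto simp: fun_eq_iff)
  have 1: "top_of s r \<in> {1, 2}"
    using Cons.prems by (auto simp: top_of_def)
  show ?case
    using reaches_mono[OF reaches_WhileT[OF 1 2 3[unfolded 4]]] by (simp del: fun_upd_apply)
qed

lemma load_loop2:
  assumes "s rB = map bit_sym u" "s rM = toks (ve (v :: bool list)) @ m"
  shows "reaches (While rB {1, 2} (Cond rB {2} (push_all [2, 2, 1, 1]) (push_all [2, 1]) ;; Pop rB)) s
     (13 * length u + 1) (s(rB := [], rM := toks (ve (rev u @ v)) @ m))"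
  using assms
proof (induction u arbitrary: s v)
  case Nil
  then have "s(rB := [], rM := toks (ve (rev [] @ v)) @ m) = s" by auto
  then show ?case using Nil reaches_WhileF[of s rB "{1,2}"]
    by (simp add: top_of_def del: fun_upd_apply)
next
  case (Cons b u)
  let ?s1 = "s(rM := toks (ve (b # v)) @ m, rB := map bit_sym u)"
  have "reaches (Cond rB {2} (push_all [2, 2, 1, 1]) (push_all [2, 1])) s (8 + 2)
      (s(rM := toks (ve (b # v)) @ m))"
  proof (cases b)
    case True
    then show ?thesis using Cons.prems push_all_any[of "[2, 2, 1, 1]" s]
      by (intro reaches_mono[OF reaches_CondT]) (auto simp: top_of_def ve_bool_def)
  next
    case False
    then show ?thesis using Cons.prems push_all_any[of "[2, 1]" s]
      by (intro reaches_mono[OF reaches_CondF]) (auto simp: top_of_def ve_bool_def)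
  qed
  from reaches_Seq[OF this reaches_Pop[of rB]]
  have 2: "reaches (Cond rB {2} (push_all [2, 2, 1, 1]) (push_all [2, 1]) ;; Pop rB) s (8 + 2 + 1) ?s1"
    using Cons.prems by simp
  have 3: "reaches (While rB {1, 2} (Cond rB {2} (push_all [2, 2, 1, 1]) (push_all [2, 1]) ;; Pop rB)) ?s1
      (13 * length u + 1) (?s1(rB := [], rM := toks (ve (rev u @ b # v)) @ m))"
    using Cons.prems by (intro Cons.IH) auto
  have 4: "?s1(rB := [], rM := toks (ve (rev u @ b # v)) @ m) =
      s(rB := [], rM := toks (ve (rev (b # u) @ v)) @ m)"
    by (auto simp: fun_eq_iff)
  have 1: "top_of s rB \<in> {1, 2}"
    using Cons.prems by (auto simp: top_of_def)
  show ?case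
    using reaches_mono[OF reaches_WhileT[OF 1 2 3[unfolded 4]]] by (simp del: fun_upd_apply)
qed

lemma load:
  assumes "s r = map bit_sym w" "r < rM" "s rB = []"
  shows "reaches (load r) s (20 * length w + 4) (s(r := [], rM := toks (ve w) @ s rM))"
proof -
  let ?s1 = "s(r := [], rB := rev (map bit_sym w) @ s rB)"
  let ?s2 = "?s1(rM := 1 # ?s1 rM)"
  have 1: "reaches (While rB {1, 2} (Cond rB {2} (push_all [2, 2, 1, 1]) (push_all [2, 1]) ;; Pop rB)) ?s2
     (13 * length (rev w) + 1) (?s2(rB := [], rM := toks (ve (rev (rev w) @ [])) @ s rM))"
    using assms by (intro load_loop2) (auto simp: rev_map)
  have e: "?s2(rB := [], rM := toks (ve (rev (rev w) @ [])) @ s rM) = s(r := [], rM := toks (ve w) @ s rM)"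
    using assms by (auto simp: fun_eq_iff)
  from reaches_mono[OF reaches_Seq[OF load_loop1[of s r w, OF assms(1,2)] reaches_Seq[OF reaches_Push 1[unfolded e]]]]
  show ?thesis unfolding load_def by (simp del: fun_upd_apply)
qed

definition unload_out :: com where
  "unload_out = While rM {2} (Pop rM ;; Cond rM {2} (Pop rM ;; Pop rM ;; Pop rM ;; Emit 2) (Pop rM ;; Emit 1))"

lemma unload_out:
  assumes "s rM = toks (ve (y :: bool list)) @ m"
  shows "reaches unload_out s (9 * length y + 1) (s(rM := 1 # m, out_reg := s out_reg @ map bit_sym y))"
  using assms
proof (induction y arbitrary: s)
  case Nil
  then have "s(rM := 1 # m, out_reg := s out_reg @ map bit_sym []) = s" by auto
  then show ?case using Nil reaches_WhileF[of s rM "{2}"]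
    by (simp add: unload_out_def top_of_def del: fun_upd_apply)
next
  case (Cons b y)
  let ?s0 = "s(rM := tl (s rM))"
  let ?s1 = "s(rM := toks (ve y) @ m, out_reg := s out_reg @ [bit_sym b])"
  have "reaches (Cond rM {2} (Pop rM ;; Pop rM ;; Pop rM ;; Emit 2) (Pop rM ;; Emit 1)) ?s0 (4 + 2) ?s1"
  proof (cases b)
    case True
    have "reaches (Pop rM ;; Pop rM ;; Pop rM ;; Emit 2) ?s0 (1 + (1 + (1 + 1))) ?s1"
      by (rule reaches_Seq[OF reaches_Pop reaches_Seq[OF reaches_Pop reaches_Seq[OF reaches_Pop reaches_Emit]],
            THEN back_subst[of "reaches _ _ _"]])
         (use True Cons.prems in \<open>auto simp: fun_eq_iff ve_bool_def\<close>)
    then show ?thesis using True Cons.prems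
      by (intro reaches_mono[OF reaches_CondT]) (auto simp: top_of_def ve_bool_def)
  next
    case False
    have "reaches (Pop rM ;; Emit 1) ?s0 (1 + 1) ?s1"
      by (rule reaches_Seq[OF reaches_Pop reaches_Emit, THEN back_subst[of "reaches _ _ _"]])
         (use False Cons.prems in \<open>auto simp: fun_eq_iff ve_bool_def\<close>)
    then show ?thesis using False Cons.prems
      by (intro reaches_mono[OF reaches_CondF]) (auto simp: top_of_def ve_bool_def)
  qed
  note 2 = reaches_Seq[OF reaches_Pop[of rM s] this]
  have 3: "reaches unload_out ?s1 (9 * length y + 1) (?s1(rM := 1 # m, out_reg := ?s1 out_reg @ map bit_sym y))"
    by (intro Cons.IH) auto
  have 4: "?s1(rM := 1 # m, out_reg := ?s1 out_reg @ map bit_sym y) =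
      s(rM := 1 # m, out_reg := s out_reg @ map bit_sym (b # y))"
    by (auto simp: fun_eq_iff)
  have 1: "top_of s rM \<in> {2}"
    using Cons.prems by (auto simp: top_of_def)
  show ?case
    using reaches_mono[OF reaches_WhileT[OF 1 2 3[unfolded unload_out_def 4]]]
    unfolding unload_out_def by (simp del: fun_upd_apply)
qed

lemma vs_bools: "vs (w :: bool list) \<le> 4 * length w + 1"
proof (induction w)
  case (Cons b w)
  then show ?case using vs_bool[of b] by simp
qed simp

lemma fp_turing_machine:
  assumes "fp (g :: bool list \<Rightarrow> bool list)"
  shows "\<exists>M p. turing_machine M \<and> (\<forall>w. computes_within M [w] (poly p (length w)) (g w))"
proof -
  obtain c T where c: "computes c g T" "pbd T"
    using assms unfolding fp_def by blast
  let ?T = "\<lambda>w. 20 * length w + 4 + (T w + (9 * length (g w) + 1))"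
  have "pbd (\<lambda>w. 20 * vs w + 4 + (T w + (9 * vs (g w) + 1)))"
    by (intro pbd_intros fp_size assms c)
  then have "pbd ?T"
    by (rule pbd_mono) (intro add_mono mult_left_mono length_le_vs order.refl zero_le)
  then obtain p where p: "\<And>w. ?T w \<le> poly p (vs w)"
    unfolding pbd_def by blast
  let ?c = "load 0 ;; c ;; unload_out"
  have wf: "wf_com ?c"
    using c(1) by (simp add: computes_def load_def unload_out_def)
  \<comment> \<open>The inner polynomial is the bound \<open>4 * length w + 1\<close> on the tree
    size of a bit list.\<close>
  have "computes_within (mk_tm (compile ?c 0)) [w] (poly (pcompose p [:1, 4:]) (length w)) (g w)" for w
  proof -
    let ?s = "mem (\<lambda>_. []) (toks (ve w) @ []) [] []"
    have "reaches (load 0) (init_store [w]) (20 * length w + 4)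
        ((init_store [w])(0 := [], rM := toks (ve w) @ init_store [w] rM))"
      by (rule load) (auto simp: init_store_def)
    moreover have "(init_store [w])(0 := [], rM := toks (ve w) @ init_store [w] rM) = ?s"
      by (auto simp: mem_def init_store_def fun_eq_iff)
    ultimately have 1: "reaches (load 0) (init_store [w]) (20 * length w + 4) ?s"
      by (simp only:)
    have 2: "reaches unload_out (mem (\<lambda>_. []) (toks (ve (g w)) @ []) [] []) (9 * length (g w) + 1)
      ((mem (\<lambda>_. []) (toks (ve (g w)) @ []) [] [])(rM := 1 # [], out_reg :=
         mem (\<lambda>_. []) (toks (ve (g w)) @ []) [] [] out_reg @ map bit_sym (g w)))" (is "reaches _ _ _ ?s'")
      by (rule unload_out) simp
    obtain t where t: "t \<le> ?T w" "exec ?c (init_store [w]) t ?s'"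
      using reaches_Seq[OF 1 reaches_Seq[OF computesD[OF c(1)] 2]] unfolding reaches_def by auto
    show ?thesis
    proof (rule computes_within_mk_tm[OF wf _ t(2)])
      show "?s' out_reg = map bit_sym (g w)" by (simp add: mem_def)
      have "?T w \<le> poly p (1 + 4 * length w)"
        by (rule order.trans[OF p poly_nat_mono]) (use vs_bools[of w] in simp)
      with t(1) show "t \<le> poly (pcompose p [:1, 4:]) (length w)"
        by (simp add: poly_pcompose mult.commute)
    qed simp
  qed
  with turing_machine_compile[OF wf] show ?thesis by blast
qed

lemma fp_turing_machine2:
  assumes "fp (g :: bool list \<times> bool list \<Rightarrow> bool list)"
  shows "\<exists>M p. turing_machine M \<and>
    (\<forall>v w. computes_within M [v, w] (poly p (length v + length w)) (g (v, w)))"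
proof -
  obtain c T where c: "computes c g T" "pbd T"
    using assms unfolding fp_def by blast
  let ?T = "\<lambda>u. 20 * length (snd u) + 4 + (20 * length (fst u) + 4 + (2 + (T u + (9 * length (g u) + 1))))"
  have "pbd (\<lambda>u. 20 * vs (snd u) + 4 + (20 * vs (fst u) + 4 + (2 + (T u + (9 * vs (g u) + 1)))))"
    by (intro pbd_intros fp_size assms c fp_intros)
  then have "pbd ?T"
    by (rule pbd_mono) (intro add_mono mult_left_mono length_le_vs order.refl zero_le)
  then obtain p where p: "\<And>u. ?T u \<le> poly p (vs u)"
    unfolding pbd_def by blast
  \<comment> \<open>The second input is loaded first, so that the first one comes to lie above it
    and the token 2 makes them a pair. The pair has size at most 3 plus four times the total length,
    hence \<open>[:3, 4:]\<close> below.\<close>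
  let ?c = "load 1 ;; load 0 ;; Push rM 2 ;; c ;; unload_out"
  have wf: "wf_com ?c"
    using c(1) by (simp add: computes_def load_def unload_out_def)
  have "computes_within (mk_tm (compile ?c 0)) [v, w] (poly (pcompose p [:3, 4:]) (length v + length w)) (g (v, w))" for v w
  proof -
    let ?i = "init_store [v, w]"
    let ?i1 = "?i(1 := [], rM := toks (ve w) @ ?i rM)"
    let ?i2 = "?i1(0 := [], rM := toks (ve v) @ ?i1 rM)"
    let ?s = "mem (\<lambda>_. []) (toks (ve (v, w)) @ []) [] []"
    have 1: "reaches (load 1) ?i (20 * length w + 4) ?i1"
      by (rule load) (auto simp: init_store_def)
    have 2: "reaches (load 0) ?i1 (20 * length v + 4) ?i2"
      by (rule load) (auto simp: init_store_def)
    have "?i2(rM := 2 # ?i2 rM) = ?s"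
      by (auto simp: mem_def init_store_def fun_eq_iff less_Suc_eq)
    with reaches_Push[of rM 2 ?i2] have 3: "reaches (Push rM 2) ?i2 2 ?s"
      by (simp only:)
    have 4: "reaches unload_out (mem (\<lambda>_. []) (toks (ve (g (v, w))) @ []) [] []) (9 * length (g (v, w)) + 1)
      ((mem (\<lambda>_. []) (toks (ve (g (v, w))) @ []) [] [])(rM := 1 # [], out_reg :=
         mem (\<lambda>_. []) (toks (ve (g (v, w))) @ []) [] [] out_reg @ map bit_sym (g (v, w))))" (is "reaches _ _ _ ?s'")
      by (rule unload_out) simp
    obtain t where t: "t \<le> ?T (v, w)" "exec ?c (init_store [v, w]) t ?s'"
      using reaches_Seq[OF 1 reaches_Seq[OF 2 reaches_Seq[OF 3 reaches_Seq[OF computesD[OF c(1)] 4]]]]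
      unfolding reaches_def by auto
    show ?thesis
    proof (rule computes_within_mk_tm[OF wf _ t(2)])
      show "?s' out_reg = map bit_sym (g (v, w))" by (simp add: mem_def)
      have "?T (v, w) \<le> poly p (3 + 4 * (length v + length w))"
        by (rule order.trans[OF p poly_nat_mono]) (use vs_bools[of v] vs_bools[of w] in simp)
      with t(1) show "t \<le> poly (pcompose p [:3, 4:]) (length v + length w)"
        by (simp add: poly_pcompose mult.commute)
    qed simp
  qed
  with turing_machine_compile[OF wf] show ?thesis by blast
qed

lemma polytime_computableI:
  assumes "fp g" "\<And>x. x \<in> A \<Longrightarrow> g (encA x) = encB (f x)"
  shows "polytime_computable encA A encB f"
proof -
  obtain M p where "turing_machine M" "\<forall>w. computes_within M [w] (poly p (length w)) (g w)"
    using fp_turing_machine[OF assms(1)] by blast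
  then show ?thesis
    unfolding polytime_computable_def by (intro exI[of _ M] exI[of _ p]) (auto simp flip: assms(2))
qed

text \<open>If certificates are no longer than the input, a time bound in the joint length is one in
  twice the input length. This is enough for independent set, the only problem to which it is
  applied.\<close>

lemma in_NP_I:
  fixes V :: "bool list \<Rightarrow> bool list \<Rightarrow> bool"
  assumes "fp (\<lambda>u. V (fst u) (snd u))"
  shows "in_NP {x. \<exists>y. length y \<le> length x \<and> V x y}"
proof -
  have "fp (\<lambda>u. [V (fst u) (snd u)])"
    by (intro fp_intros assms)
  then obtain M p where M: "turing_machine M"
      "\<And>v w. computes_within M [v, w] (poly p (length v + length w)) [V v w]"
    using fp_turing_machine2 by fastforce
  have le: "poly p (length x + length y) \<le> poly (pcompose p [:0, 2:]) (length x)"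
    if "length y \<le> length x" for x y :: "bool list"
    using that by (auto simp: poly_pcompose intro!: poly_nat_mono)
  have mono: "computes_within M ws t y" if "computes_within M ws t' y" "t' \<le> t" for ws t t' y
  proof -
    obtain q tps where q: "(tm_step M ^^ t') (tm_init M ws) = (q, tps)"
      by (cases "(tm_step M ^^ t') (tm_init M ws)")
    have "(tm_step M ^^ (t - t' + t')) (tm_init M ws) = (nstates M, tps)"
      using that(1) q unfolding funpow_add by (simp add: computes_within_def halted_stays)
    then show ?thesis using that q by (simp add: computes_within_def)
  qed
  show ?thesis
    unfolding in_NP_def
  proof (intro exI conjI allI impI)
    show "turing_machine M" by fact
    show "computes_within M [x, y] (poly (pcompose p [:0, 2:]) (length x)) [V x y]"
      if "length y \<le> poly [:0, 1:] (length x)" for x y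
      using mono[OF M(2) le] that by simp
  qed simp
qed

subsection \<open>Simulation of Turing machines\<close>

text \<open>A tape is split at the head into the reversed left part and the right part.\<close>

type_synonym stape = "nat list \<times> nat list"

definition stape_cell :: "stape \<Rightarrow> int \<Rightarrow> int \<Rightarrow> nat" where
  "stape_cell t p j = (if p \<le> j then nthd 0 (snd t) (nat (j - p)) else nthd 0 (fst t) (nat (p - 1 - j)))"

text \<open>Cells beyond the two lists count as blank, so either list may carry surplus blanks at
  its far end and the representation is not unique.\<close>

definition sim_tape :: "stape \<Rightarrow> tape \<Rightarrow> bool" where
  "sim_tape t tp \<longleftrightarrow> fst tp = stape_cell t (snd tp)"

text \<open>Head movements become natural numbers because integers have no tree encoding.\<close>

definition dcode :: "int \<Rightarrow> nat" where
  "dcode d = (if d = 1 then 1 else if d = - 1 then 2 else 0)"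

definition sact :: "nat \<times> nat \<Rightarrow> stape \<Rightarrow> stape" where
  "sact a t = (if snd a = 0 then (fst t, fst a # tl (snd t))
     else if snd a = 1 then (fst a # fst t, tl (snd t))
     else (tl (fst t), hdd 0 (fst t) # fst a # tl (snd t)))"

lemma fp_sact: "fp (\<lambda>u. sact (fst u) (snd u))"
  unfolding sact_def by (intro fp_intros)

lemma nthd_simps [simp]: "nthd d [] n = d" "nthd d (x # l) 0 = x" "nthd d (x # l) (Suc n) = nthd d l n"
  "nthd d (tl l) n = nthd d l (Suc n)"
  by (cases l; auto simp: nthd_eq)+

lemma hdd_nthd: "hdd d l = nthd d l 0"
  by (simp add: nthd_def)

lemma nthd_Cons_nat: "0 < i \<Longrightarrow> nthd d (x # l) (nat i) = nthd d l (nat (i - 1))"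
  by (metis Suc_nat_eq_nat_zadd1 add.commute diff_add_cancel nthd_simps(3) zle_diff1_eq)

lemma sim_tape_act:
  assumes "sim_tape t tp" "d \<in> {-1, 0, 1}"
  shows "sim_tape (sact (x, dcode d) t) (tape_act (x, d) tp)"
proof -
  obtain c p where tp: "tp = (c, p)" by (cases tp)
  have c: "c = stape_cell t p" using assms(1) by (simp add: sim_tape_def tp)
  have S: "Suc (nat i) = nat (i + 1)" if "0 \<le> i" for i using that by simp
  show ?thesis
    using assms(2)
    by (auto simp: sim_tape_def tp c tape_act_def sact_def dcode_def fun_eq_iff stape_cell_def
        hdd_nthd nthd_Cons_nat S intro!: arg_cong[of _ _ "nthd 0 _"])
qed

lemma sim_tape_read: "sim_tape t tp \<Longrightarrow> tape_read tp = hdd 0 (snd t)"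
  by (simp add: sim_tape_def tape_read_def stape_cell_def hdd_nthd case_prod_beta)

text \<open>The represented cells form an interval starting at \<open>a\<close>, and everything
  outside it is blank. The nonblank cells of \<open>string_tape y\<close> are consecutive and spell
  \<open>y\<close>, so deleting blanks recovers \<open>y\<close> wherever the head has
  stopped.\<close>

lemma sim_tape_string:
  assumes "sim_tape t (string_tape y, p)"
  shows "filter (\<lambda>s. s \<noteq> 0) (rev (fst t) @ snd t) = map bit_sym y"
proof -
  let ?c = "string_tape y" and ?N = "length (fst t) + length (snd t)"
  define a where "a = p - int (length (fst t))"
  have c: "?c = stape_cell t p" using assms by (simp add: sim_tape_def)
  have l: "rev (fst t) @ snd t = map (\<lambda>i. ?c (a + int i)) [0..<?N]"
    by (auto simp: c stape_cell_def a_def nthd_eq nth_append rev_nth intro!: nth_equalityI arg_cong[of _ _ "nth _"])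
  have out: "?c j = 0" if "j < a \<or> a + int ?N \<le> j" for j
    using that by (auto simp: c stape_cell_def a_def nthd_eq)
  show ?thesis
  proof (cases "y = []")
    case True
    then have "?c = (\<lambda>_. 0)" by (auto simp: string_tape_def fun_eq_iff)
    then show ?thesis unfolding l using True by (simp add: filter_empty_conv)
  next
    case False
    let ?n = "length y"
    have "?c 0 \<noteq> 0" "?c (int ?n - 1) \<noteq> 0"
      using False by (auto simp: string_tape_def Suc_le_eq)
    then have a: "a \<le> 0" "int ?n \<le> a + int ?N"
      using out[of 0] out[of "int ?n - 1"] by force+
    define k where "k = nat (- a)"
    have k: "a = - int k" using a by (simp add: k_def)
    have "?N = k + ?n + (?N - (k + ?n))" using a k by linarith
    then have "[0..<?N] = [0..<k] @ [k..<k + ?n] @ [k + ?n..<?N]"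
      by (metis append.assoc le_add1 upt_add_eq_append zero_le)
    moreover have "filter (\<lambda>s. s \<noteq> 0) (map (\<lambda>i. ?c (a + int i)) [0..<k]) = []"
      by (auto simp: filter_empty_conv k string_tape_def)
    moreover have "filter (\<lambda>s. s \<noteq> 0) (map (\<lambda>i. ?c (a + int i)) [k + ?n..<?N]) = []"
      by (auto simp: filter_empty_conv k string_tape_def)
    moreover have "map (\<lambda>i. ?c (a + int i)) [k..<k + ?n] = map bit_sym y"
      by (auto simp: k string_tape_def intro!: nth_equalityI)
    ultimately show ?thesis
      unfolding l by (simp add: filter_id_conv) auto
  qed
qed

type_synonym sconfig = "nat \<times> stape list"

definition sim_entry :: "tm \<Rightarrow> nat \<times> nat list \<Rightarrow> nat \<times> (nat \<times> nat) list" where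
  "sim_entry M z = (fst (delta M (fst z) (snd z)),
     map (\<lambda>a. (fst a, dcode (snd a))) (snd (delta M (fst z) (snd z))))"

definition sim_keys :: "tm \<Rightarrow> (nat \<times> nat list) set" where
  "sim_keys M = {..<nstates M} \<times> {ss. set ss \<subseteq> {..<nsyms M} \<and> length ss = ntapes M}"

text \<open>Well-typed states and symbols form a finite set of keys; the default outside it is never
  consulted in a run that satisfies \<open>sconf_ok\<close>.\<close>

definition sim_lookup :: "tm \<Rightarrow> nat \<times> nat list \<Rightarrow> nat \<times> (nat \<times> nat) list" where
  "sim_lookup M z = (if z \<in> sim_keys M then sim_entry M z else (0, []))"

definition sim_step :: "tm \<Rightarrow> sconfig \<Rightarrow> sconfig" where
  "sim_step M cf = (if fst cf < nstates M
     then (fst (sim_lookup M (fst cf, map (\<lambda>t. hdd 0 (snd t)) (snd cf))),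
       map (\<lambda>u. sact (fst u) (snd u))
         (zip (snd (sim_lookup M (fst cf, map (\<lambda>t. hdd 0 (snd t)) (snd cf)))) (snd cf)))
     else cf)"

lemma fp_sim_step: "fp f \<Longrightarrow> fp (\<lambda>e. sim_step M (f e))"
proof -
  have "finite (sim_keys M)"
    unfolding sim_keys_def by (intro finite_cartesian_product finite_lists_length_eq) auto
  then have lk: "fp (\<lambda>e. sim_lookup M (g e))" if "fp g" for g :: "'b::venc \<Rightarrow> _"
    unfolding sim_lookup_def using that
    by (intro fp_finite_lookup inj_ve_prod inj_ve_nat inj_ve_list)
  show "fp f \<Longrightarrow> fp (\<lambda>e. sim_step M (f e))"
    unfolding sim_step_def by (intro fp_intros lk fp_comp[OF _ fp_sact])
qed

definition sconf_ok :: "tm \<Rightarrow> sconfig \<Rightarrow> bool" where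
  "sconf_ok M cf \<longleftrightarrow> fst cf \<le> nstates M \<and> length (snd cf) = ntapes M \<and>
     (\<forall>t\<in>set (snd cf). set (fst t) \<union> set (snd t) \<subseteq> {..<nsyms M})"

lemma sact_ok:
  assumes "set (fst t) \<union> set (snd t) \<subseteq> {..<n}" "x < n"
  shows "set (fst (sact (x, d) t)) \<union> set (snd (sact (x, d) t)) \<subseteq> {..<n}"
  using assms by (cases t; cases "fst t"; cases "snd t") (auto simp: sact_def hdd_def)

lemma vs_sact: "x < n \<Longrightarrow> vs (sact (x, d) t) \<le> vs t + (2 * n + 4)"
  by (cases t; cases "fst t"; cases "snd t") (auto simp: sact_def hdd_def vs_nat)

lemma vs_sact_list:
  assumes "\<And>a. a \<in> set as \<Longrightarrow> fst a < n"
  shows "vs (map (\<lambda>u. sact (fst u) (snd u)) (zip as ts)) \<le> vs ts + length ts * (2 * n + 4)"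
  using assms
proof (induction ts arbitrary: as)
  case (Cons t ts)
  show ?case
  proof (cases as)
    case (Cons a as')
    then show ?thesis
      using Cons.IH[of as'] Cons.prems vs_sact[of "fst a" n "snd a" t] by fastforce
  qed simp
qed simp

lemma list_all2_last: "list_all2 P xs ys \<Longrightarrow> xs \<noteq> [] \<Longrightarrow> P (last xs) (last ys)"
  by (induction rule: list_all2_induct) (auto simp: list_all2_Cons1)

context
  fixes M
  assumes M: "turing_machine M"
begin

lemma sim_key:
  assumes "sconf_ok M cf" "fst cf < nstates M"
  shows "(fst cf, map (\<lambda>t. hdd 0 (snd t)) (snd cf)) \<in> sim_keys M"
  using assms M unfolding sconf_ok_def sim_keys_def turing_machine_def
  by (fastforce simp: hdd_def split: list.splits)

lemma delta_ok:
  assumes "(q, ss) \<in> sim_keys M"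
  shows "fst (delta M q ss) \<le> nstates M" "length (snd (delta M q ss)) = ntapes M"
    "\<And>a. a \<in> set (snd (delta M q ss)) \<Longrightarrow> fst a < nsyms M \<and> snd a \<in> {-1, 0, 1}"
  using assms M unfolding turing_machine_def sim_keys_def by (fastforce simp: case_prod_beta)+

text \<open>A step adds at most one symbol and one blank per tape, and symbols stay below
  \<open>nsyms M\<close>, so growth per step is bounded by a constant of the machine, as iteration
  requires.\<close>

lemma sim_step_ok:
  assumes "sconf_ok M cf"
  shows "sconf_ok M (sim_step M cf) \<and>
    vs (sim_step M cf) \<le> vs cf + (2 * nstates M + 2 + ntapes M * (2 * nsyms M + 4))"
proof (cases "fst cf < nstates M")
  case True
  let ?z = "(fst cf, map (\<lambda>t. hdd 0 (snd t)) (snd cf))"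
  let ?d = "delta M (fst ?z) (snd ?z)"
  note z = sim_key[OF assms True]
  note d = delta_ok[OF z]
  have step: "sim_step M cf = (fst ?d, map (\<lambda>u. sact (fst u) (snd u))
      (zip (map (\<lambda>a. (fst a, dcode (snd a))) (snd ?d)) (snd cf)))"
    using True z by (simp add: sim_step_def sim_lookup_def sim_entry_def)
  have "sconf_ok M (sim_step M cf)"
    unfolding step sconf_ok_def
  proof (intro conjI ballI)
    fix t assume "t \<in> set (snd (fst ?d, map (\<lambda>u. sact (fst u) (snd u))
      (zip (map (\<lambda>a. (fst a, dcode (snd a))) (snd ?d)) (snd cf))))"
    then obtain w where w: "w \<in> set (zip (map (\<lambda>a. (fst a, dcode (snd a))) (snd ?d)) (snd cf))"
        "t = sact (fst w) (snd w)"
      by auto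
    have "(fst w, snd w) \<in> set (zip (map (\<lambda>a. (fst a, dcode (snd a))) (snd ?d)) (snd cf))"
      using w(1) by simp
    note u = set_zip_rightD[OF this] and a = set_zip_leftD[OF this]
    obtain a where "fst w = (fst a, dcode (snd a))" "a \<in> set (snd ?d)"
      using a by auto
    then show "set (fst t) \<union> set (snd t) \<subseteq> {..<nsyms M}"
      using sact_ok[of "snd w" "nsyms M" "fst a" "dcode (snd a)"] d(3)[of a] assms u w(2)
      by (simp add: sconf_ok_def)
  qed (use d assms in \<open>auto simp: sconf_ok_def\<close>)
  moreover have "vs (map (\<lambda>u. sact (fst u) (snd u))
      (zip (map (\<lambda>a. (fst a, dcode (snd a))) (snd ?d)) (snd cf))) \<le>
      vs (snd cf) + length (snd cf) * (2 * nsyms M + 4)"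
    by (rule vs_sact_list) (use d(3) in auto)
  then have "vs (sim_step M cf) \<le> vs cf + (2 * nstates M + 2 + ntapes M * (2 * nsyms M + 4))"
    unfolding step using d(1) assms by (cases cf) (auto simp: sconf_ok_def vs_nat)
  ultimately show ?thesis by blast
qed (use assms in \<open>auto simp: sim_step_def\<close>)

lemma sim_step_correct:
  assumes "sconf_ok M cf" "list_all2 sim_tape (snd cf) tps"
  shows "fst (sim_step M cf) = fst (tm_step M (fst cf, tps)) \<and>
    list_all2 sim_tape (snd (sim_step M cf)) (snd (tm_step M (fst cf, tps)))"
proof (cases "fst cf < nstates M")
  case True
  let ?z = "(fst cf, map (\<lambda>t. hdd 0 (snd t)) (snd cf))"
  let ?d = "delta M (fst ?z) (snd ?z)"
  note z = sim_key[OF assms(1) True]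
  note d = delta_ok[OF z]
  have step: "sim_step M cf = (fst ?d, map (\<lambda>u. sact (fst u) (snd u))
      (zip (map (\<lambda>a. (fst a, dcode (snd a))) (snd ?d)) (snd cf)))"
    using True z by (simp add: sim_step_def sim_lookup_def sim_entry_def)
  have len: "length tps = ntapes M" "length (snd cf) = ntapes M"
    using assms by (auto simp: sconf_ok_def list_all2_lengthD)
  have "map tape_read tps = map (\<lambda>t. hdd 0 (snd t)) (snd cf)"
    using assms(2) len by (auto simp: list_all2_conv_all_nth sim_tape_read intro!: nth_equalityI)
  then have "tm_step M (fst cf, tps) = (fst ?d, map2 tape_act (snd ?d) tps)"
    using True by (simp add: tm_step_def case_prod_beta)
  moreover have "list_all2 sim_tape (snd (sim_step M cf)) (map2 tape_act (snd ?d) tps)"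
    unfolding step
  proof (rule list_all2_all_nthI)
    fix i assume "i < length (snd (fst ?d, map (\<lambda>u. sact (fst u) (snd u))
      (zip (map (\<lambda>a. (fst a, dcode (snd a))) (snd ?d)) (snd cf))))"
    then have i: "i < ntapes M" by (simp add: len)
    have "sim_tape (sact (fst (snd ?d ! i), dcode (snd (snd ?d ! i))) (snd cf ! i))
        (tape_act (fst (snd ?d ! i), snd (snd ?d ! i)) (tps ! i))"
      using d(3)[of "snd ?d ! i"] i d(2) assms(2) len
      by (intro sim_tape_act) (auto simp: list_all2_conv_all_nth)
    then show "sim_tape (snd (fst ?d, map (\<lambda>u. sact (fst u) (snd u))
      (zip (map (\<lambda>a. (fst a, dcode (snd a))) (snd ?d)) (snd cf))) ! i) (map2 tape_act (snd ?d) tps ! i)"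
      using i d(2) len by simp
  qed (use d(2) len in simp)
  ultimately show ?thesis by (simp add: step)
qed (use assms in \<open>auto simp: sim_step_def tm_step_def\<close>)

lemma sim_steps_correct:
  assumes "sconf_ok M cf" "list_all2 sim_tape (snd cf) tps"
  shows "fst ((sim_step M ^^ n) cf) = fst ((tm_step M ^^ n) (fst cf, tps)) \<and>
    list_all2 sim_tape (snd ((sim_step M ^^ n) cf)) (snd ((tm_step M ^^ n) (fst cf, tps))) \<and>
    sconf_ok M ((sim_step M ^^ n) cf)"
proof (induction n)
  case (Suc n)
  then show ?case
    using sim_step_correct[of "(sim_step M ^^ n) cf" "snd ((tm_step M ^^ n) (fst cf, tps))"]
      sim_step_ok[of "(sim_step M ^^ n) cf"] by simp
qed (use assms in simp)

text \<open>This converse of \<open>fp_turing_machine\<close> makes the reduction provided by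
  NP-hardness, which is given by a machine, available for composition.\<close>

lemma fp_of_turing_machine:
  assumes "\<And>x. computes_within M [x] (poly p (length x)) (g x)"
  shows "fp g"
proof -
  let ?init = "\<lambda>x :: bool list. (0 :: nat, ([], map bit_sym x) # replicate (ntapes M - 1) ([], []))"
  let ?run = "\<lambda>x. (sim_step M ^^ poly p (length x)) (?init x)"
  have nt: "1 \<le> ntapes M" "3 \<le> nsyms M" using M by (auto simp: turing_machine_def)
  have ok: "sconf_ok M (?init x)" for x
    using nt by (auto simp: sconf_ok_def)
  have "fp (\<lambda>x. ((\<lambda>s. sim_step M s) ^^ poly p (length x)) (?init x))"
    by (rule fp_funpow_inv[where I = "\<lambda>_. sconf_ok M" and
          G = "\<lambda>_. 2 * nstates M + 2 + ntapes M * (2 * nsyms M + 4)"])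
       (use ok sim_step_ok in \<open>auto intro!: fp_intros fp_sim_step pbd_intros\<close>)
  then have run: "fp ?run" by simp
  \<comment> \<open>The output tape is the last one, hence the head of the reversed list; after
    deletion of blanks the symbol 2 stands for \<open>True\<close>.\<close>
  have "fp (\<lambda>x. map (\<lambda>s. s = 2) (filter (\<lambda>s. s \<noteq> 0)
      (rev (fst (hdd ([], []) (rev (snd (?run x))))) @ snd (hdd ([], []) (rev (snd (?run x)))))))"
    by (intro fp_intros fp_comp[OF _ run])
  then show ?thesis
  proof (rule fp_eqI)
    fix x
    let ?tps = "map (\<lambda>i. (string_tape (if i < length [x] then [x] ! i else []), 0)) [0..<ntapes M] :: tape list"
    have st: "sim_tape ([], map bit_sym w) (string_tape w, 0)" for w
      by (auto simp: sim_tape_def stape_cell_def string_tape_def nthd_eq fun_eq_iff)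
    have "list_all2 sim_tape (snd (?init x)) ?tps"
      using nt st[of x] st[of "[]"] by (auto simp: list_all2_conv_all_nth nth_Cons')
    from sim_steps_correct[OF ok this, of "poly p (length x)"]
    have run: "list_all2 sim_tape (snd (?run x)) (snd ((tm_step M ^^ poly p (length x)) (tm_init M [x])))"
      and ok: "sconf_ok M (?run x)"
      by (auto simp: tm_init_def)
    let ?fin = "snd ((tm_step M ^^ poly p (length x)) (tm_init M [x]))"
    have "snd (?run x) \<noteq> []" using ok nt by (auto simp: sconf_ok_def)
    then have "sim_tape (last (snd (?run x))) (last ?fin)"
      by (rule list_all2_last[OF run])
    moreover have "hdd ([], []) (rev ts) = last ts" if "ts \<noteq> []" for ts :: "stape list"
      using that by (cases ts rule: rev_cases) (auto simp: hdd_def)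
    note this[OF \<open>snd (?run x) \<noteq> []\<close>]
    moreover have "fst (last ?fin) = string_tape (g x)"
      using assms[of x] by (simp add: computes_within_def case_prod_beta)
    ultimately have "filter (\<lambda>s. s \<noteq> 0) (rev (fst (hdd ([], []) (rev (snd (?run x))))) @
        snd (hdd ([], []) (rev (snd (?run x))))) = map bit_sym (g x)"
      using sim_tape_string[of "last (snd (?run x))" "g x" "snd (last ?fin)"] by (simp only: prod.collapse flip: \<open>fst (last ?fin) = string_tape (g x)\<close>)
    then show "g x = map (\<lambda>s. s = 2) (filter (\<lambda>s. s \<noteq> 0)
      (rev (fst (hdd ([], []) (rev (snd (?run x))))) @ snd (hdd ([], []) (rev (snd (?run x))))))"
      by (auto simp: comp_def intro!: nth_equalityI)
  qed
qed

end

lemma fp_of_polytime_computable: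
  assumes "polytime_computable id UNIV enc f"
  shows "fp (\<lambda>x. enc (f x))"
  using assms unfolding polytime_computable_def by (auto intro: fp_of_turing_machine)

section \<open>Parsing and printing instances\<close>

lemma fp_takeWhile [fp_intros]:
  fixes l :: "'e::venc \<Rightarrow> 'a::venc list"
  assumes "fp l" "fp (\<lambda>p. P (fst p) (snd p))"
  shows "fp (\<lambda>e. takeWhile (\<lambda>x. P x e) (l e))"
proof -
  let ?st = "\<lambda>x (s :: bool \<times> 'a list) e. if fst s \<and> P x e then (True, x # snd s) else (False, snd s)"
  have "fp (\<lambda>e. fold (\<lambda>x s. ?st x s e) (l e) (True, []))"
  proof (rule fp_fold[where G = "\<lambda>e. 4 + vs (l e)"])
    show "fp (\<lambda>p. ?st (fst p) (fst (snd p)) (snd (snd p)))"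
      using fp_comp[OF fp_pair[OF fp_fst[OF fp_id] fp_snd[OF fp_snd[OF fp_id]]] assms(2)]
      by (intro fp_intros) simp
    show "vs (?st x s e) \<le> vs s + (4 + vs (l e))" if "x \<in> set (l e)" for x s e
      using vs_mem[OF that] by (cases s) (auto simp: ve_bool_def)
  qed (intro fp_intros assms pbd_intros fp_size)+
  then have "fp (\<lambda>e. rev (snd (fold (\<lambda>x s. ?st x s e) (l e) (True, []))))"
    by (intro fp_intros)
  moreover have "snd (fold (\<lambda>x s. ?st x s e) xs (b, ys)) = rev (if b then takeWhile (\<lambda>x. P x e) xs else []) @ ys"
    for xs b ys e
    by (induction xs arbitrary: b ys) auto
  ultimately show ?thesis by simp
qed

definition parse_unary :: "bool list \<Rightarrow> nat \<times> bool list" where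
  "parse_unary w = (length (takeWhile (\<lambda>b. b) w), drop (Suc (length (takeWhile (\<lambda>b. b) w))) w)"

lemma fp_parse_unary [fp_intros]: "fp f \<Longrightarrow> fp (\<lambda>e. parse_unary (f e))"
  unfolding parse_unary_def by (intro fp_intros)

lemma parse_unary_enc [simp]: "parse_unary (enc_unary n @ w) = (n, w)"
proof -
  have "takeWhile (\<lambda>b. b) (enc_unary n @ w) = replicate n True"
    by (induction n) (auto simp: enc_unary_def)
  then show ?thesis by (simp add: parse_unary_def enc_unary_def)
qed

text \<open>The step does nothing at the terminating \<open>False\<close>, so as many rounds as the
  input has symbols are always enough and never too many.\<close>

definition parse_bits_step :: "bool list \<times> bool list \<Rightarrow> bool list \<times> bool list" where
  "parse_bits_step s = (case fst s of [] \<Rightarrow> s | x # r \<Rightarrow>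
     (if x then (case r of [] \<Rightarrow> s | b # r' \<Rightarrow> (r', b # snd s)) else s))"

lemma parse_bits_step_simps [simp]:
  "parse_bits_step (False # w, a) = (False # w, a)"
  "parse_bits_step (True # b # w, a) = (w, b # a)"
  by (simp_all add: parse_bits_step_def)

definition parse_bits :: "bool list \<Rightarrow> bool list \<times> bool list" where
  "parse_bits w = (rev (snd ((parse_bits_step ^^ length w) (w, []))),
     tl (fst ((parse_bits_step ^^ length w) (w, []))))"

lemma fp_parse_bits [fp_intros]:
  assumes "fp f" shows "fp (\<lambda>e. parse_bits (f e))"
proof -
  have "fp (\<lambda>w. ((\<lambda>s. parse_bits_step s) ^^ length w) (w, []))"
  proof (rule fp_funpow[where G = "\<lambda>w. 0"])
    show "fp (\<lambda>p. parse_bits_step (fst p))"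
      unfolding parse_bits_step_def by (intro fp_intros)
    show "vs (parse_bits_step s) \<le> vs s + 0" for s
      by (cases s) (auto simp: parse_bits_step_def ve_bool_def split: list.splits)
  qed (intro fp_intros pbd_intros)+
  then show ?thesis
    unfolding parse_bits_def using assms by (intro fp_intros fp_comp[OF assms]) simp_all
qed

lemma parse_bits_enc [simp]: "parse_bits (concat (map (\<lambda>b. [True, b]) bs) @ False # w) = (bs, w)"
proof -
  have "length bs \<le> k \<Longrightarrow>
      (parse_bits_step ^^ k) (concat (map (\<lambda>b. [True, b]) bs) @ False # w, a) = (False # w, rev bs @ a)" for k a
  proof (induction k arbitrary: bs a)
    case (Suc k)
    show ?case
    proof (cases bs)
      case Nil
      have "(parse_bits_step ^^ k) (False # w, a) = (False # w, a)"
        using Suc.IH[of "[]" a] by simp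
      then show ?thesis by (simp add: Nil del: funpow.simps add: funpow_Suc_right)
    next
      case (Cons b bs')
      then show ?thesis
        using Suc.IH[of bs' "b # a"] Suc.prems
        by (simp del: funpow.simps add: funpow_Suc_right)
    qed
  qed auto
  moreover have "length bs \<le> length (concat (map (\<lambda>b. [True, b]) bs) @ False # w)"
    by (induction bs) auto
  ultimately have eq: "(parse_bits_step ^^ length (concat (map (\<lambda>b. [True, b]) bs) @ False # w))
      (concat (map (\<lambda>b. [True, b]) bs) @ False # w, []) = (False # w, rev bs @ [])"
    by blast
  show ?thesis unfolding parse_bits_def eq by simp
qed

fun strip :: "bool list \<Rightarrow> bool list \<Rightarrow> bool \<times> bool list" where
  "strip [] w = (True, w)"
| "strip (b # p) w = (case w of [] \<Rightarrow> (False, []) | x # r \<Rightarrow> if x = b then strip p r else (False, []))"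

lemma fp_strip: "fp (strip p)"
proof (induction p)
  case Nil
  have "fp (\<lambda>w :: bool list. (True, w))" by (intro fp_intros)
  then show ?case by (rule fp_eqI) simp
next
  case (Cons b p)
  have "fp (\<lambda>w. case w of [] \<Rightarrow> (False, []) | x # r \<Rightarrow> if x = b then strip p r else (False, []))"
    by (intro fp_intros fp_comp[OF _ Cons.IH])
  then show ?case by (rule fp_eqI) simp
qed

lemma strip_append: "strip p (p @ w) = (True, w)"
  by (induction p) auto

lemma strip_prefix: "fst (strip p w) \<Longrightarrow> \<exists>r. w = p @ r"
  by (induction p arbitrary: w) (auto split: list.splits if_splits)

lemma vs_nonempty: "vs ([] :: 'a::venc list) \<le> vs (w :: 'a list)"
  using vsz_pos[of "ve w"] by simp

lemma vs_strip: "vs (snd (strip p w)) \<le> vs w"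
proof (induction p arbitrary: w)
  case (Cons b p)
  have "vs (snd (strip p r)) \<le> vs (x # r)" for x r
    using Cons[of r] by simp
  then show ?case using vsz_pos[of "ve w"] by (auto split: list.splits simp del: ve_list.simps) auto
qed simp

lemma vs_drop: "vs (drop n w) \<le> vs w"
  by (induction w arbitrary: n) (auto simp: drop_Cons' intro: le_SucI trans_le_add2)

fun parse_unaries :: "nat \<Rightarrow> bool list \<Rightarrow> nat list \<times> bool list" where
  "parse_unaries 0 w = ([], w)"
| "parse_unaries (Suc k) w = (fst (parse_unary w) # fst (parse_unaries k (snd (parse_unary w))),
     snd (parse_unaries k (snd (parse_unary w))))"

lemma fp_parse_unaries: "fp (parse_unaries k)"
proof (induction k)
  case 0
  have "fp (\<lambda>w :: bool list. ([] :: nat list, w))" by (intro fp_intros)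
  then show ?case by (rule fp_eqI) simp
next
  case (Suc k)
  have "fp (\<lambda>w. (fst (parse_unary w) # fst (parse_unaries k (snd (parse_unary w))),
     snd (parse_unaries k (snd (parse_unary w)))))"
    by (intro fp_intros fp_comp[OF _ Suc.IH])
  then show ?case by (rule fp_eqI) simp
qed

lemma parse_unaries_enc [simp]: "parse_unaries (length us) (concat (map enc_unary us) @ w) = (us, w)"
  by (induction us) auto

lemma vs_parse_unaries: "vs (snd (parse_unaries k w)) \<le> vs w"
proof (induction k arbitrary: w)
  case (Suc k)
  then show ?case
    using le_trans[OF Suc[of "snd (parse_unary w)"]] vs_drop[of _ w] by (simp add: parse_unary_def)
qed simp

fun parse_con :: "nat \<Rightarrow> brel list \<Rightarrow> bool list \<Rightarrow> (nat \<times> nat list) \<times> bool list" where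
  "parse_con i [] w = ((0, []), [])"
| "parse_con i (R # Rs) w = (if fst (strip (enc_rel R) w)
     then ((i, fst (parse_unaries (fst R) (snd (strip (enc_rel R) w)))),
       snd (parse_unaries (fst R) (snd (strip (enc_rel R) w))))
     else parse_con (Suc i) Rs w)"

lemma fp_parse_con: "fp (parse_con i Rs)"
proof (induction Rs arbitrary: i)
  case Nil
  have "fp (\<lambda>w :: bool list. ((0 :: nat, [] :: nat list), [] :: bool list))" by (intro fp_intros)
  then show ?case by (rule fp_eqI) simp
next
  case (Cons R Rs)
  have "fp (\<lambda>w. if fst (strip (enc_rel R) w)
     then ((i, fst (parse_unaries (fst R) (snd (strip (enc_rel R) w)))),
       snd (parse_unaries (fst R) (snd (strip (enc_rel R) w))))
     else parse_con (Suc i) Rs w)"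
    by (intro fp_intros Cons.IH fp_comp[OF _ fp_parse_unaries] fp_comp[OF _ fp_strip])
  then show ?case by (rule fp_eqI) simp
qed

lemma vs_parse_con: "vs (snd (parse_con i Rs w)) \<le> vs w"
proof (induction Rs arbitrary: i)
  case (Cons R Rs)
  then show ?case
    using le_trans[OF vs_parse_unaries[of "fst R" "snd (strip (enc_rel R) w)"] vs_strip[of "enc_rel R" w]]
    by simp
qed (use vs_nonempty[of w] in simp)

text \<open>The unary arity fixes the length of the truth table, and the truth table fixes the
  relation, as all its tuples have the right length. Hence no encoding is a proper prefix of
  another, and the first match in \<open>parse_con\<close> is the correct one.\<close>

lemma enc_rel_prefix:
  assumes "enc_rel R @ u = enc_rel R' @ v" "boolean_relation R" "boolean_relation R'"
  shows "R = R'"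
proof -
  have "parse_unary (enc_rel R @ u) = parse_unary (enc_rel R' @ v)"
    using assms(1) by simp
  then have 1: "fst R = fst R'"
    "map (\<lambda>t. t \<in> snd R) (List.n_lists (fst R) [False, True]) @ u =
     map (\<lambda>t. t \<in> snd R') (List.n_lists (fst R') [False, True]) @ v"
    unfolding enc_rel_def append_assoc parse_unary_enc prod.inject by blast+
  have "map (\<lambda>t. t \<in> snd R) (List.n_lists (fst R) [False, True]) =
     map (\<lambda>t. t \<in> snd R') (List.n_lists (fst R) [False, True])"
    by (metis 1 append_eq_append_conv length_map)
  then have "t \<in> snd R \<longleftrightarrow> t \<in> snd R'" if "length t = fst R" for t
    using that by (auto simp: set_n_lists)
  then have "snd R = snd R'"
    using assms(2,3) 1(1) by (auto simp: boolean_relation_def)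
  with 1 show ?thesis by (simp add: prod_eq_iff)
qed

lemma parse_con_enc:
  assumes "R \<in> set Rs" "\<forall>R\<in>set Rs. boolean_relation R" "length us = fst R"
  shows "\<exists>j<length Rs. Rs ! j = R \<and> parse_con i Rs (enc_constraint (R, us) @ w) = ((i + j, us), w)"
  using assms
proof (induction Rs arbitrary: i)
  case (Cons R' Rs)
  show ?case
  proof (cases "R' = R")
    case True
    then show ?thesis
      using Cons.prems by (intro exI[of _ 0])
        (auto simp: enc_constraint_def strip_append simp flip: \<open>length us = fst R\<close>)
  next
    case False
    have "\<not> fst (strip (enc_rel R') (enc_constraint (R, us) @ w))"
    proof
      assume "fst (strip (enc_rel R') (enc_constraint (R, us) @ w))"
      from strip_prefix[OF this] enc_rel_prefix[of R _ R'] Cons.prems False show False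
        by (auto simp: enc_constraint_def)
    qed
    moreover have "R \<in> set Rs" using Cons.prems False by auto
    moreover from this obtain j where "j < length Rs" "Rs ! j = R"
        "parse_con (Suc i) Rs (enc_constraint (R, us) @ w) = ((Suc i + j, us), w)"
      using Cons.IH[of "Suc i"] Cons.prems by auto
    ultimately show ?thesis
      by (intro exI[of _ "Suc j"]) simp
  qed
qed simp

text \<open>An instance in parsed form: the number of variables, the binary digits of the threshold, and
  the constraints, with relations replaced by their positions in a list of relations.\<close>

type_synonym pinst = "nat \<times> bool list \<times> (nat \<times> nat list) list"

definition parse_cons_step :: "brel list \<Rightarrow> bool list \<times> (nat \<times> nat list) list \<Rightarrow> bool list \<times> (nat \<times> nat list) list" where
  "parse_cons_step Rs s = (case fst s of [] \<Rightarrow> s | x # r \<Rightarrow>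
     (if x then (snd (parse_con 0 Rs r), fst (parse_con 0 Rs r) # snd s) else s))"

lemma parse_cons_step_simps [simp]:
  "parse_cons_step Rs (False # w, a) = (False # w, a)"
  "parse_cons_step Rs (True # w, a) = (snd (parse_con 0 Rs w), fst (parse_con 0 Rs w) # a)"
  by (simp_all add: parse_cons_step_def)

definition parse_cons :: "brel list \<Rightarrow> bool list \<Rightarrow> (nat \<times> nat list) list" where
  "parse_cons Rs w = rev (snd ((parse_cons_step Rs ^^ length w) (w, [])))"

lemma fp_parse_cons: "fp (parse_cons Rs)"
proof -
  obtain p where p: "\<And>w. vs (parse_con 0 Rs w) \<le> poly p (vs w)"
    using fp_size[OF fp_parse_con[of 0 Rs]] unfolding pbd_def by blast
  have "fp (\<lambda>w. ((\<lambda>s. parse_cons_step Rs s) ^^ length w) (w, []))"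
  \<comment> \<open>The unread input never grows, which bounds every parsed constraint by one
    polynomial in the original input.\<close>
  proof (rule fp_funpow_inv[where G = "\<lambda>w. 1 + poly p (vs w)" and I = "\<lambda>w s. vs (fst s) \<le> vs w"])
    show "fp (\<lambda>p. parse_cons_step Rs (fst p))"
      unfolding parse_cons_step_def by (intro fp_intros fp_comp[OF _ fp_parse_con])
    fix w :: "bool list" and s :: "bool list \<times> (nat \<times> nat list) list"
    assume I: "vs (fst s) \<le> vs w"
    show "vs (fst (parse_cons_step Rs s)) \<le> vs w \<and>
        vs (parse_cons_step Rs s) \<le> vs s + (1 + poly p (vs w))"
    proof (cases "fst s")
      case (Cons x r)
      have 1: "vs (snd (parse_con 0 Rs r)) \<le> vs r" by (rule vs_parse_con)
      have 2: "vs (parse_con 0 Rs r) \<le> poly p (vs w)"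
        by (rule le_trans[OF p poly_nat_mono]) (use I Cons in simp)
      obtain a b where ab: "parse_con 0 Rs r = (a, b)" by (cases "parse_con 0 Rs r")
      show ?thesis
        using 1 2 I Cons unfolding ab by (cases s) (auto simp: parse_cons_step_def ab)
    qed (use I in \<open>auto simp: parse_cons_step_def\<close>)
  qed (auto intro!: fp_intros pbd_intros pbd_poly)
  then have "fp (\<lambda>w. rev (snd (((\<lambda>s. parse_cons_step Rs s) ^^ length w) (w, []))))"
    by (intro fp_intros)
  then show ?thesis by (rule fp_eqI) (simp add: parse_cons_def)
qed

lemma parse_cons_enc:
  assumes "\<forall>R\<in>set Rs. boolean_relation R"
    and "\<And>R us. (R, us) \<in> set cs \<Longrightarrow> R \<in> set Rs \<and> length us = fst R"
  shows "\<exists>ds. parse_cons Rs (concat (map (\<lambda>c. True # enc_constraint c) cs) @ [False]) = ds \<and>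
     (\<forall>d\<in>set ds. fst d < length Rs) \<and> map (\<lambda>d. (Rs ! fst d, snd d)) ds = cs"
proof -
  let ?w = "\<lambda>cs. concat (map (\<lambda>c. True # enc_constraint c) cs) @ [False]"
  have "\<exists>ds. (parse_cons_step Rs ^^ k) (?w cs, a) = ([False], rev ds @ a) \<and>
     (\<forall>d\<in>set ds. fst d < length Rs) \<and> map (\<lambda>d. (Rs ! fst d, snd d)) ds = cs"
    if "length cs \<le> k" "\<And>R us. (R, us) \<in> set cs \<Longrightarrow> R \<in> set Rs \<and> length us = fst R" for k a cs
    using that
  proof (induction k arbitrary: cs a)
    case (Suc k)
    show ?case
    proof (cases cs)
      case Nil
      have "(parse_cons_step Rs ^^ k) ([False], a) = ([False], a)"
        using Suc.IH[of "[]" a] by simp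
      then show ?thesis by (simp add: Nil del: funpow.simps add: funpow_Suc_right)
    next
      case (Cons c cs')
      obtain R us where c: "c = (R, us)" by (cases c)
      obtain j where j: "j < length Rs" "Rs ! j = R"
          "parse_con 0 Rs (enc_constraint (R, us) @ ?w cs') = ((0 + j, us), ?w cs')"
        using parse_con_enc[of R Rs us 0 "?w cs'"] assms(1) Suc.prems(2)[of R us] Cons c by auto
      obtain ds where ds: "(parse_cons_step Rs ^^ k) (?w cs', (j, us) # a) = ([False], rev ds @ (j, us) # a)"
          "\<forall>d\<in>set ds. fst d < length Rs" "map (\<lambda>d. (Rs ! fst d, snd d)) ds = cs'"
        using Suc.IH[of cs' "(j, us) # a"] Suc.prems Cons by auto
      have "(parse_cons_step Rs ^^ Suc k) (?w cs, a) = ([False], rev ((j, us) # ds) @ a)"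
        using ds(1) j(3) by (simp add: Cons c del: funpow.simps add: funpow_Suc_right)
      then show ?thesis
        using ds j by (intro exI[of _ "(j, us) # ds"]) (auto simp: Cons c)
    qed
  qed auto
  moreover have "length cs \<le> length (?w cs)"
    by (induction cs) auto
  ultimately obtain ds where "(parse_cons_step Rs ^^ length (?w cs)) (?w cs, []) = ([False], rev ds @ [])"
     "(\<forall>d\<in>set ds. fst d < length Rs)" "map (\<lambda>d. (Rs ! fst d, snd d)) ds = cs"
    using assms(2) by blast
  then show ?thesis by (auto simp: parse_cons_def)
qed

definition parse_inst :: "brel list \<Rightarrow> bool list \<Rightarrow> pinst" where
  "parse_inst Rs w = (fst (parse_unary w), fst (parse_bits (snd (parse_unary w))),
     parse_cons Rs (snd (parse_bits (snd (parse_unary w)))))"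

lemma fp_parse_inst [fp_intros]: "fp f \<Longrightarrow> fp (\<lambda>e. parse_inst Rs (f e))"
  unfolding parse_inst_def by (intro fp_intros fp_comp[OF _ fp_parse_cons])

definition inst_cons :: "brel list \<Rightarrow> (nat \<times> nat list) list \<Rightarrow> (brel \<times> nat list) list" where
  "inst_cons Rs ds = map (\<lambda>d. (Rs ! fst d, snd d)) ds"

text \<open>The positions in \<open>ds\<close> are left open, since a relation may occur several
  times in \<open>Rs\<close>; only the constraints they denote are determined.\<close>

lemma parse_inst_enc:
  assumes "\<forall>R\<in>set Rs. boolean_relation R" "I \<in> instances (set Rs)"
  obtains ds where "parse_inst Rs (enc_inst I) = (num_vars I, bits (threshold I), ds)"
    "\<forall>d\<in>set ds. fst d < length Rs" "inst_cons Rs ds = constraints I"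
proof -
  have "\<And>R us. (R, us) \<in> set (constraints I) \<Longrightarrow> R \<in> set Rs \<and> length us = fst R"
    using assms(2) by (auto simp: instances_def)
  from parse_cons_enc[OF assms(1) this] that show thesis
    by (auto simp: parse_inst_def enc_inst_def enc_binary_def inst_cons_def)
qed

definition print_inst :: "brel list \<Rightarrow> pinst \<Rightarrow> bool list" where
  "print_inst Rs P = map (\<lambda>_. True) [0..<fst P] @ [False] @
     concat (map (\<lambda>b. [True, b]) (fst (snd P))) @ [False] @
     concat (map (\<lambda>c. True # nthd [] (map enc_rel Rs) (fst c) @
       concat (map (\<lambda>u. map (\<lambda>_. True) [0..<u] @ [False]) (snd c))) (snd (snd P))) @ [False]"

lemma fp_print_inst [fp_intros]: "fp f \<Longrightarrow> fp (\<lambda>e. print_inst Rs (f e))"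
  unfolding print_inst_def by (intro fp_intros)

lemma print_inst_enc:
  assumes "\<forall>d\<in>set ds. fst d < length Rs"
  shows "print_inst Rs (n, bits k, ds) = enc_inst \<lparr>num_vars = n, constraints = inst_cons Rs ds, threshold = k\<rparr>"
proof -
  have u: "map (\<lambda>_. True) [0..<m] @ [False] = enc_unary m" for m
    by (simp add: enc_unary_def map_replicate_const)
  have "concat (map (\<lambda>c. True # nthd [] (map enc_rel Rs) (fst c) @
       concat (map (\<lambda>u. map (\<lambda>_. True) [0..<u] @ [False]) (snd c))) ds) =
    concat (map (\<lambda>c. True # enc_constraint c) (inst_cons Rs ds))"
    unfolding u inst_cons_def map_map comp_def
    using assms by (intro arg_cong[of _ _ concat] map_cong) (auto simp: nthd_eq enc_constraint_def)
  then show ?thesis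
    unfolding print_inst_def using u[of n] by (simp add: enc_inst_def enc_binary_def)
qed

text \<open>Increment on digits, least significant first. The threshold may be exponential in the
  length of its encoding, so it must not be converted into a unary number.\<close>

fun add_carry :: "bool \<Rightarrow> bool list \<Rightarrow> bool list" where
  "add_carry c [] = (if c then [True] else [])"
| "add_carry c (b # bs) = (b \<noteq> c) # add_carry (b \<and> c) bs"

lemma add_carry_False: "add_carry False bs = bs"
  by (induction bs) auto

lemma add_carry_bits: "add_carry True (bits n) = bits (Suc n)"
proof (induction n rule: less_induct)
  case (less n)
  have b: "bits m = (if m = 0 then [] else odd m # bits (m div 2))" for m
    by (rule bits.simps)
  show ?case
  proof (cases "n = 0")
    case True
    then show ?thesis by (subst b, subst b, subst b) simp
  next
    case False
    then show ?thesis
      using less[of "n div 2"] by (cases "odd n"; subst b, subst (2) b) (auto simp: add_carry_False)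
  qed
qed

lemma fp_add_carry [fp_intros]:
  assumes "fp f" shows "fp (\<lambda>e. add_carry True (f e))"
proof -
  let ?st = "\<lambda>b (s :: bool \<times> bool list). (b \<and> fst s, (if b then \<not> fst s else fst s) # snd s)"
  have "fp (\<lambda>e. fold (\<lambda>b s. ?st b s) (f e) (True, []))"
  proof (rule fp_fold[where G = "\<lambda>e. 10"])
    show "vs (?st b s) \<le> vs s + 10" for b s
      by (cases s) (auto simp: ve_bool_def)
  qed (intro fp_intros assms pbd_intros)+
  note f = this
  define fin where "fin = (\<lambda>s :: bool \<times> bool list. rev (if fst s then True # snd s else snd s))"
  have "fp (\<lambda>e. fin (fold ?st (f e) (True, [])))"
    unfolding fin_def by (intro fp_intros f)
  moreover have "fin (fold ?st bs (c, ys)) = rev ys @ add_carry c bs" for bs c ys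
  proof (induction bs arbitrary: c ys)
    case (Cons b bs)
    then show ?case by (cases b; cases c) simp_all
  qed (simp add: fin_def)
  ultimately show ?thesis by simp
qed

fun bval :: "bool list \<Rightarrow> nat" where
  "bval [] = 0"
| "bval (b # bs) = of_bool b + 2 * bval bs"

lemma bval_bits [simp]: "bval (bits n) = n"
proof (induction n rule: less_induct)
  case (less n)
  then show ?case by (subst bits.simps) (auto simp: of_bool_def odd_two_times_div_two_succ)
qed

text \<open>Horner evaluation is cut off at \<open>Suc (g e)\<close>. This keeps the unary
  accumulator small, and a value that was cut off still exceeds \<open>g e\<close>.\<close>

lemma fp_bval_le [fp_intros]:
  assumes "fp f" "fp g" shows "fp (\<lambda>e. bval (f e) \<le> g e)"
proof -
  let ?st = "\<lambda>b s k. if (if b then Suc (s + s) else s + s) \<le> Suc k then (if b then Suc (s + s) else s + s) else Suc k"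
  have "fp (\<lambda>e. fold (\<lambda>b s. ?st b s (g e)) (rev (f e)) 0)"
  proof (rule fp_fold_inv[where G = "\<lambda>e. vs (Suc (g e))" and I = "\<lambda>e s. s \<le> Suc (g e)"])
    show "fp (\<lambda>p. ?st (fst p) (fst (snd p)) (g (snd (snd p))))"
      by (intro fp_intros fp_comp[OF _ assms(2)])
    show "?st b s (g e) \<le> Suc (g e) \<and> vs (?st b s (g e)) \<le> vs s + vs (Suc (g e))" for b s e
      by (auto simp: vs_nat simp del: ve_nat.simps)
  qed (intro fp_intros assms pbd_intros fp_size | simp)+
  note f = this
  have "fp (\<lambda>e. fold (\<lambda>b s. ?st b s (g e)) (rev (f e)) 0 \<le> g e)"
    by (intro fp_intros assms f)
  moreover have "fold (\<lambda>b s. ?st b s k) (rev bs) 0 = min (bval bs) (Suc k)" for bs k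
    by (induction bs) (auto simp: min_def)
  ultimately show ?thesis
    by (auto simp: min_le_iff_disj elim!: fp_eqI)
qed

section \<open>Polymorphisms and gadgets\<close>

definition pol :: "brel set \<Rightarrow> nat \<Rightarrow> (bool list \<Rightarrow> bool) \<Rightarrow> bool" where
  "pol \<Gamma> s f \<longleftrightarrow> (\<forall>R\<in>\<Gamma>. \<forall>ts. length ts = s \<and> set ts \<subseteq> snd R \<longrightarrow>
     map (\<lambda>j. f (map (\<lambda>t. t ! j) ts)) [0..<fst R] \<in> snd R)"

lemma pol_cong:
  assumes "\<And>xs. length xs = s \<Longrightarrow> f xs = g xs"
  shows "pol \<Gamma> s f \<longleftrightarrow> pol \<Gamma> s g"
proof -
  have "map (\<lambda>j. f (map (\<lambda>t. t ! j) ts)) [0..<n] = map (\<lambda>j. g (map (\<lambda>t. t ! j) ts)) [0..<n]"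
    if "length ts = s" for ts :: "bool list list" and n
    using assms that by simp
  then show ?thesis unfolding pol_def by metis
qed

lemma pol_proj:
  assumes "\<forall>R\<in>\<Gamma>. boolean_relation R" "i < s"
  shows "pol \<Gamma> s (\<lambda>xs. xs ! i)"
  unfolding pol_def
proof (intro ballI allI impI)
  fix R ts assume R: "R \<in> \<Gamma>" "length ts = s \<and> set ts \<subseteq> snd R"
  then have t: "ts ! i \<in> snd R" using assms(2) by auto
  then have "length (ts ! i) = fst R"
    using assms(1) R by (auto simp: boolean_relation_def)
  then have "map (\<lambda>j. map (\<lambda>t. t ! j) ts ! i) [0..<fst R] = ts ! i"
    using R assms(2) by (intro nth_equalityI) auto
  with t show "map (\<lambda>j. map (\<lambda>t. t ! j) ts ! i) [0..<fst R] \<in> snd R" by simp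
qed

lemma pol_comp:
  assumes "pol \<Gamma> s f" "\<And>g. g \<in> set gs \<Longrightarrow> pol \<Gamma> r g" "length gs = s"
  shows "pol \<Gamma> r (\<lambda>xs. f (map (\<lambda>g. g xs) gs))"
  unfolding pol_def
proof (intro ballI allI impI)
  fix R ts assume R: "R \<in> \<Gamma>" "length ts = r \<and> set ts \<subseteq> snd R"
  let ?us = "map (\<lambda>g. map (\<lambda>j. g (map (\<lambda>t. t ! j) ts)) [0..<fst R]) gs"
  have "set ?us \<subseteq> snd R" "length ?us = s"
    using assms(2,3) R unfolding pol_def by auto
  then have "map (\<lambda>j. f (map (\<lambda>t. t ! j) ?us)) [0..<fst R] \<in> snd R"
    using assms(1) R unfolding pol_def by blast
  also have "map (\<lambda>j. f (map (\<lambda>t. t ! j) ?us)) [0..<fst R] =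
      map (\<lambda>j. f (map (\<lambda>g. g (map (\<lambda>t. t ! j) ts)) gs)) [0..<fst R]"
    by (auto simp: comp_def intro!: arg_cong[of _ _ f])
  finally show "map (\<lambda>j. f (map (\<lambda>g. g (map (\<lambda>t. t ! j) ts)) gs)) [0..<fst R] \<in> snd R" .
qed

text \<open>Binary and ternary functions as tables, listed in lexicographic order of the arguments.\<close>

definition sel2 :: "bool \<Rightarrow> bool \<Rightarrow> bool \<Rightarrow> bool \<Rightarrow> bool \<Rightarrow> bool \<Rightarrow> bool" where
  "sel2 a b c d x y = (if x then (if y then d else c) else (if y then b else a))"

definition sel3 :: "bool \<Rightarrow> bool \<Rightarrow> bool \<Rightarrow> bool \<Rightarrow> bool \<Rightarrow> bool \<Rightarrow> bool \<Rightarrow> bool \<Rightarrow> bool \<Rightarrow> bool \<Rightarrow> bool \<Rightarrow> bool" where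
  "sel3 a b c d a' b' c' d' x y z = (if x then sel2 a' b' c' d' y z else sel2 a b c d y z)"

definition pol2 :: "brel set \<Rightarrow> bool \<Rightarrow> bool \<Rightarrow> bool \<Rightarrow> bool \<Rightarrow> bool" where
  "pol2 \<Gamma> a b c d \<longleftrightarrow> pol \<Gamma> 2 (\<lambda>xs. sel2 a b c d (xs ! 0) (xs ! 1))"

definition pol3 :: "brel set \<Rightarrow> bool \<Rightarrow> bool \<Rightarrow> bool \<Rightarrow> bool \<Rightarrow> bool \<Rightarrow> bool \<Rightarrow> bool \<Rightarrow> bool \<Rightarrow> bool" where
  "pol3 \<Gamma> a b c d a' b' c' d' \<longleftrightarrow> pol \<Gamma> 3 (\<lambda>xs. sel3 a b c d a' b' c' d' (xs ! 0) (xs ! 1) (xs ! 2))"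

lemma length_2_cases: "length xs = 2 \<Longrightarrow> (\<And>a b. xs = [a, b] \<Longrightarrow> P) \<Longrightarrow> P"
  by (auto simp: numeral_2_eq_2 length_Suc_conv)

lemma length_3_cases: "length xs = 3 \<Longrightarrow> (\<And>a b c. xs = [a, b, c] \<Longrightarrow> P) \<Longrightarrow> P"
  by (auto simp: numeral_3_eq_3 length_Suc_conv)

lemma pol_2_iff: "pol \<Gamma> 2 f \<longleftrightarrow> pol2 \<Gamma> (f [False, False]) (f [False, True]) (f [True, False]) (f [True, True])"
  unfolding pol2_def by (rule pol_cong) (auto simp: sel2_def elim!: length_2_cases)

lemma pol_3_iff: "pol \<Gamma> 3 f \<longleftrightarrow> pol3 \<Gamma>
    (f [False, False, False]) (f [False, False, True]) (f [False, True, False]) (f [False, True, True])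
    (f [True, False, False]) (f [True, False, True]) (f [True, True, False]) (f [True, True, True])"
  unfolding pol3_def by (rule pol_cong) (auto simp: sel2_def sel3_def elim!: length_3_cases)

text \<open>Superposition on the level of tables: for literal truth values, simplification evaluates
  the table of the composed function.\<close>

lemma pol2_comp2:
  assumes "pol2 \<Gamma> a b c d" "pol2 \<Gamma> a1 b1 c1 d1" "pol2 \<Gamma> a2 b2 c2 d2"
  shows "pol2 \<Gamma> (sel2 a b c d a1 a2) (sel2 a b c d b1 b2) (sel2 a b c d c1 c2) (sel2 a b c d d1 d2)"
proof -
  have "pol \<Gamma> 2 (\<lambda>xs. (\<lambda>xs. sel2 a b c d (xs ! 0) (xs ! 1)) (map (\<lambda>g. g xs)
     [\<lambda>xs. sel2 a1 b1 c1 d1 (xs ! 0) (xs ! 1), \<lambda>xs. sel2 a2 b2 c2 d2 (xs ! 0) (xs ! 1)]))"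
    using assms unfolding pol2_def by (intro pol_comp[where s = 2]) auto
  then show ?thesis unfolding pol_2_iff by (simp add: sel2_def)
qed

lemma pol3_comp2:
  assumes "pol3 \<Gamma> a b c d a' b' c' d'" "pol2 \<Gamma> a1 b1 c1 d1" "pol2 \<Gamma> a2 b2 c2 d2" "pol2 \<Gamma> a3 b3 c3 d3"
  shows "pol2 \<Gamma> (sel3 a b c d a' b' c' d' a1 a2 a3) (sel3 a b c d a' b' c' d' b1 b2 b3)
    (sel3 a b c d a' b' c' d' c1 c2 c3) (sel3 a b c d a' b' c' d' d1 d2 d3)"
proof -
  have "pol \<Gamma> 2 (\<lambda>xs. (\<lambda>xs. sel3 a b c d a' b' c' d' (xs ! 0) (xs ! 1) (xs ! 2)) (map (\<lambda>g. g xs)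
     [\<lambda>xs. sel2 a1 b1 c1 d1 (xs ! 0) (xs ! 1), \<lambda>xs. sel2 a2 b2 c2 d2 (xs ! 0) (xs ! 1),
      \<lambda>xs. sel2 a3 b3 c3 d3 (xs ! 0) (xs ! 1)]))"
    using assms unfolding pol2_def pol3_def by (intro pol_comp[where s = 3]) auto
  then show ?thesis unfolding pol_2_iff by (simp add: sel2_def)
qed

lemma pol2_comp3:
  assumes "pol2 \<Gamma> a b c d" "pol3 \<Gamma> p0 p1 p2 p3 p4 p5 p6 p7" "pol3 \<Gamma> q0 q1 q2 q3 q4 q5 q6 q7"
  shows "pol3 \<Gamma> (sel2 a b c d p0 q0) (sel2 a b c d p1 q1) (sel2 a b c d p2 q2) (sel2 a b c d p3 q3)
    (sel2 a b c d p4 q4) (sel2 a b c d p5 q5) (sel2 a b c d p6 q6) (sel2 a b c d p7 q7)"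
proof -
  have "pol \<Gamma> 3 (\<lambda>xs. (\<lambda>xs. sel2 a b c d (xs ! 0) (xs ! 1)) (map (\<lambda>g. g xs)
     [\<lambda>xs. sel3 p0 p1 p2 p3 p4 p5 p6 p7 (xs ! 0) (xs ! 1) (xs ! 2),
      \<lambda>xs. sel3 q0 q1 q2 q3 q4 q5 q6 q7 (xs ! 0) (xs ! 1) (xs ! 2)]))"
    using assms unfolding pol2_def pol3_def by (intro pol_comp[where s = 2]) auto
  then show ?thesis unfolding pol_3_iff by (simp add: sel2_def sel3_def)
qed

lemma pol3_comp3:
  assumes "pol3 \<Gamma> a b c d a' b' c' d'" "pol3 \<Gamma> p0 p1 p2 p3 p4 p5 p6 p7" "pol3 \<Gamma> q0 q1 q2 q3 q4 q5 q6 q7"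
    "pol3 \<Gamma> r0 r1 r2 r3 r4 r5 r6 r7"
  shows "pol3 \<Gamma> (sel3 a b c d a' b' c' d' p0 q0 r0) (sel3 a b c d a' b' c' d' p1 q1 r1)
    (sel3 a b c d a' b' c' d' p2 q2 r2) (sel3 a b c d a' b' c' d' p3 q3 r3)
    (sel3 a b c d a' b' c' d' p4 q4 r4) (sel3 a b c d a' b' c' d' p5 q5 r5)
    (sel3 a b c d a' b' c' d' p6 q6 r6) (sel3 a b c d a' b' c' d' p7 q7 r7)"
proof -
  have "pol \<Gamma> 3 (\<lambda>xs. (\<lambda>xs. sel3 a b c d a' b' c' d' (xs ! 0) (xs ! 1) (xs ! 2)) (map (\<lambda>g. g xs)
     [\<lambda>xs. sel3 p0 p1 p2 p3 p4 p5 p6 p7 (xs ! 0) (xs ! 1) (xs ! 2),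
      \<lambda>xs. sel3 q0 q1 q2 q3 q4 q5 q6 q7 (xs ! 0) (xs ! 1) (xs ! 2),
      \<lambda>xs. sel3 r0 r1 r2 r3 r4 r5 r6 r7 (xs ! 0) (xs ! 1) (xs ! 2)]))"
    using assms unfolding pol3_def by (intro pol_comp[where s = 3]) auto
  then show ?thesis unfolding pol_3_iff by (simp add: sel2_def sel3_def)
qed

lemma pol_projs:
  assumes "\<forall>R\<in>\<Gamma>. boolean_relation R"
  shows "pol2 \<Gamma> False False True True" "pol2 \<Gamma> False True False True"
    "pol3 \<Gamma> False False False False True True True True"
    "pol3 \<Gamma> False False True True False False True True"
    "pol3 \<Gamma> False True False True False True False True"
  using pol_proj[OF assms, of 0 2] pol_proj[OF assms, of 1 2] pol_proj[OF assms, of 0 3]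
    pol_proj[OF assms, of 1 3] pol_proj[OF assms, of 2 3]
  unfolding pol_2_iff pol_3_iff by simp_all

text \<open>A gadget is a list of constraints whose variables are positions in a list of variables to be
  supplied later.\<close>

type_synonym gadget = "(nat \<times> nat list) list"

definition gsat :: "brel list \<Rightarrow> gadget \<Rightarrow> (nat \<Rightarrow> bool) \<Rightarrow> bool" where
  "gsat Rs G v \<longleftrightarrow> (\<forall>g\<in>set G. map v (snd g) \<in> snd (Rs ! fst g))"

definition gok :: "brel list \<Rightarrow> nat \<Rightarrow> gadget \<Rightarrow> bool" where
  "gok Rs m G \<longleftrightarrow> (\<forall>g\<in>set G. fst g < length Rs \<and> length (snd g) = fst (Rs ! fst g) \<and> set (snd g) \<subseteq> {..<m})"

definition tuples :: "brel \<Rightarrow> bool list list" where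
  "tuples R = filter (\<lambda>t. t \<in> snd R) (List.n_lists (fst R) [False, True])"

lemma set_tuples: "boolean_relation R \<Longrightarrow> set (tuples R) = snd R"
  by (auto simp: tuples_def set_n_lists boolean_relation_def)

text \<open>The indicator construction: it forces \<open>v \<circ> \<iota>\<close> to be a polymorphism, without auxiliary
  variables.\<close>

definition indicator :: "brel list \<Rightarrow> nat \<Rightarrow> (bool list \<Rightarrow> nat) \<Rightarrow> gadget" where
  "indicator Rs s \<iota> = concat (map (\<lambda>i. map (\<lambda>ts. (i, map (\<lambda>j. \<iota> (map (\<lambda>t. t ! j) ts)) [0..<fst (Rs ! i)]))
     (List.n_lists s (tuples (Rs ! i)))) [0..<length Rs])"

lemma gsat_indicator:
  assumes "\<forall>R\<in>set Rs. boolean_relation R"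
  shows "gsat Rs (indicator Rs s \<iota>) v \<longleftrightarrow> pol (set Rs) s (\<lambda>x. v (\<iota> x))"
proof -
  have "gsat Rs (indicator Rs s \<iota>) v \<longleftrightarrow> (\<forall>i<length Rs. \<forall>ts. length ts = s \<and> set ts \<subseteq> snd (Rs ! i) \<longrightarrow>
      map (\<lambda>j. v (\<iota> (map (\<lambda>t. t ! j) ts))) [0..<fst (Rs ! i)] \<in> snd (Rs ! i))"
    using assms by (auto simp: gsat_def indicator_def set_n_lists set_tuples comp_def)
  also have "\<dots> \<longleftrightarrow> pol (set Rs) s (\<lambda>x. v (\<iota> x))"
    unfolding pol_def all_set_conv_all_nth ..
  finally show ?thesis .
qed

lemma gok_indicator: "(\<And>x. \<iota> x < m) \<Longrightarrow> gok Rs m (indicator Rs s \<iota>)"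
  by (auto simp: gok_def indicator_def)

lemma gsat_append: "gsat Rs (G @ H) v \<longleftrightarrow> gsat Rs G v \<and> gsat Rs H v"
  by (auto simp: gsat_def)

lemma gok_append: "gok Rs m (G @ H) \<longleftrightarrow> gok Rs m G \<and> gok Rs m H"
  by (auto simp: gok_def)

lemma gok_mono: "gok Rs m G \<Longrightarrow> m \<le> n \<Longrightarrow> gok Rs n G"
  by (fastforce simp: gok_def)

lemma gsat_cong: "gok Rs m G \<Longrightarrow> (\<And>j. j < m \<Longrightarrow> v j = w j) \<Longrightarrow> gsat Rs G v \<longleftrightarrow> gsat Rs G w"
proof -
  assume a: "gok Rs m G" "\<And>j. j < m \<Longrightarrow> v j = w j"
  then have eq: "map v (snd g) = map w (snd g)" if "g \<in> set G" for g
    using that by (auto simp: gok_def)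
  show ?thesis unfolding gsat_def by (rule ball_cong[OF refl]) (simp only: eq)
qed

definition place :: "gadget \<Rightarrow> nat list \<Rightarrow> (nat \<times> nat list) list" where
  "place G L = map (\<lambda>g. (fst g, map (\<lambda>j. nthd 0 L j) (snd g))) G"

lemma fp_place [fp_intros]: "fp f \<Longrightarrow> fp (\<lambda>e. place G (f e))"
proof -
  have "fp (\<lambda>L. map (\<lambda>g. (fst g, map (\<lambda>j. nthd 0 L j) (snd g))) G)"
    by (intro fp_intros)
  then have "fp (place G)" by (rule fp_eqI) (simp add: place_def)
  then show "fp f \<Longrightarrow> fp (\<lambda>e. place G (f e))" by (rule fp_comp[rotated])
qed

text \<open>Every constraint is replaced by the gadget \<open>G1\<close> on its variables and two fresh variables; the
  gadget \<open>G2\<close> is attached to every variable, the first fresh one included, that occurs in no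
  constraint.\<close>

definition new_cons :: "gadget \<Rightarrow> gadget \<Rightarrow> nat \<Rightarrow> (nat \<times> nat list) list \<Rightarrow> (nat \<times> nat list) list" where
  "new_cons G1 G2 n cs = concat (map (\<lambda>c. place G1 (snd c @ [n, Suc n])) cs) @
     concat (map (\<lambda>v. if \<exists>c\<in>set cs. \<exists>u\<in>set (snd c). u = v then [] else place G2 [v, n, Suc n]) [0..<Suc n])"

definition reduce_pinst :: "nat \<Rightarrow> gadget \<Rightarrow> gadget \<Rightarrow> pinst \<Rightarrow> pinst" where
  "reduce_pinst m G1 G2 P =
     (fst P + m, add_carry True (fst (snd P)), new_cons G1 G2 (fst P) (snd (snd P)))"

lemma fp_reduce_pinst [fp_intros]: "fp f \<Longrightarrow> fp (\<lambda>e. reduce_pinst m G1 G2 (f e))"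
proof -
  have "fp (reduce_pinst m G1 G2)"
    by (rule fp_eqI[OF _ reduce_pinst_def]) (unfold new_cons_def, intro fp_intros)
  then show "fp f \<Longrightarrow> fp (\<lambda>e. reduce_pinst m G1 G2 (f e))"
    by (rule fp_comp[rotated])
qed

lemma gsat_place: "(\<forall>d\<in>set (place G L). map h (snd d) \<in> snd (Rs ! fst d)) \<longleftrightarrow> gsat Rs G (\<lambda>j. h (nthd 0 L j))"
  by (auto simp: place_def gsat_def comp_def)

section \<open>Reductions from gadgets with one or two fresh variables\<close>

definition weight :: "inst \<Rightarrow> (nat \<Rightarrow> bool) \<Rightarrow> nat" where
  "weight I h = (\<Sum>x\<in>var I. of_bool (h x))"

locale gadget_reduction =
  fixes R :: brel and Rs :: "brel list" and m :: nat and G1 G2 :: gadget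
  assumes R: "boolean_relation R"
    and Rs: "\<forall>R\<in>set Rs. boolean_relation R"
    and m: "m \<in> {1, 2}"
    and G1: "gok Rs (fst R + m) G1"
    and G2: "gok Rs (Suc m) G2"
begin

text \<open>The increment of the threshold accounts for exactly one true fresh variable, also when
  there are two of them.\<close>

definition red :: "inst \<Rightarrow> inst" where
  "red I = \<lparr>num_vars = num_vars I + m,
     constraints = inst_cons Rs (new_cons G1 G2 (num_vars I) (map (\<lambda>c. (0, snd c)) (constraints I))),
     threshold = Suc (threshold I)\<rparr>"

lemma weight_red: "weight (red I) h = (\<Sum>x<num_vars I + m. of_bool (h x))"
  by (simp add: weight_def var_def red_def)

lemma new_cons_snd: "map snd cs = map snd cs' \<Longrightarrow> new_cons G1 G2 n cs = new_cons G1 G2 n cs'"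
proof -
  assume a: "map snd cs = map snd cs'"
  have b: "map (\<lambda>c. place G1 (snd c @ [n, Suc n])) cs = map (\<lambda>u. place G1 (u @ [n, Suc n])) (map snd cs)" for cs :: "(nat \<times> nat list) list"
    by simp
  have c: "(\<exists>c\<in>set cs. \<exists>u\<in>set (snd c). u = v) \<longleftrightarrow> (\<exists>l\<in>set (map snd cs). \<exists>u\<in>set l. u = v)" for cs :: "(nat \<times> nat list) list" and v
    by simp
  show ?thesis unfolding new_cons_def b c a ..
qed

definition occurs :: "inst \<Rightarrow> nat \<Rightarrow> bool" where
  "occurs I v \<longleftrightarrow> (\<exists>c\<in>set (constraints I). v \<in> set (snd c))"

lemma place_ok:
  assumes "gok Rs k G" "k \<le> length L" "\<And>j. j < k \<Longrightarrow> L ! j < n" "d \<in> set (place G L)"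
  shows "fst d < length Rs \<and> length (snd d) = fst (Rs ! fst d) \<and> set (snd d) \<subseteq> {..<n}"
  using assms by (fastforce simp: place_def gok_def nthd_eq)

lemma con_vars:
  assumes "I \<in> instances {R}" "c \<in> set (constraints I)"
  shows "length (snd c) = fst R" "set (snd c) \<subseteq> {..<num_vars I}" "fst c = R"
  using assms by (auto simp: instances_def var_def case_prod_beta)

lemma new_cons_ok:
  assumes I: "I \<in> instances {R}"
    and d: "d \<in> set (new_cons G1 G2 (num_vars I) (map (\<lambda>c. (0, snd c)) (constraints I)))"
  shows "fst d < length Rs \<and> length (snd d) = fst (Rs ! fst d) \<and> set (snd d) \<subseteq> {..<num_vars I + m}"
proof -
  let ?n = "num_vars I"
  have "(\<exists>c\<in>set (constraints I). d \<in> set (place G1 (snd c @ [?n, Suc ?n]))) \<or>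
      (\<exists>v\<le>?n. d \<in> set (place G2 [v, ?n, Suc ?n]))"
    using d unfolding new_cons_def by (auto simp del: upt_Suc simp: less_Suc_eq_le split: if_splits)
  then consider c where "c \<in> set (constraints I)" "d \<in> set (place G1 (snd c @ [?n, Suc ?n]))"
    | v where "v \<le> ?n" "d \<in> set (place G2 [v, ?n, Suc ?n])"
    by blast
  then show ?thesis
  proof cases
    case 1
    note c = con_vars[OF I 1(1)]
    show ?thesis
    proof (rule place_ok[OF G1 _ _ 1(2)])
      show "(snd c @ [?n, Suc ?n]) ! j < ?n + m" if "j < fst R + m" for j
        using that c m nth_mem[of j "snd c"] by (auto simp: nth_append nth_Cons' subset_iff trans_less_add1)
    qed (use c m in auto)
  next
    case 2
    show ?thesis
      by (rule place_ok[OF G2 _ _ 2(2)]) (use 2(1) m in \<open>auto simp: less_Suc_eq nth_Cons'\<close>)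
  qed
qed

lemma red_instances: "I \<in> instances {R} \<Longrightarrow> red I \<in> instances (set Rs)"
  using new_cons_ok[of I] by (auto simp: instances_def[of "set Rs"] red_def inst_cons_def var_def)

lemma solution_red:
  assumes "I \<in> instances {R}"
  shows "solution (red I) h \<longleftrightarrow>
    (\<forall>c\<in>set (constraints I). gsat Rs G1 (\<lambda>j. h (nthd 0 (snd c @ [num_vars I, Suc (num_vars I)]) j))) \<and>
    (\<forall>v\<le>num_vars I. \<not> occurs I v \<longrightarrow> gsat Rs G2 (\<lambda>j. h (nthd 0 [v, num_vars I, Suc (num_vars I)] j)))"
proof -
  have "solution (red I) h \<longleftrightarrow> (\<forall>d\<in>set (new_cons G1 G2 (num_vars I) (map (\<lambda>c. (0, snd c)) (constraints I))).
      map h (snd d) \<in> snd (Rs ! fst d))"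
    by (simp add: solution_def red_def inst_cons_def case_prod_beta)
  also have "\<dots> \<longleftrightarrow>
     (\<forall>c\<in>set (constraints I). \<forall>d\<in>set (place G1 (snd c @ [num_vars I, Suc (num_vars I)])). map h (snd d) \<in> snd (Rs ! fst d)) \<and>
     (\<forall>v\<le>num_vars I. \<not> occurs I v \<longrightarrow>
       (\<forall>d\<in>set (place G2 [v, num_vars I, Suc (num_vars I)]). map h (snd d) \<in> snd (Rs ! fst d)))"
    unfolding new_cons_def occurs_def by (auto simp del: upt_Suc simp: less_Suc_eq_le ball_Un)
  finally show ?thesis unfolding gsat_place .
qed

lemma red_computable: "polytime_computable enc_inst (instances {R}) enc_inst red"
proof (rule polytime_computableI)
  show "fp (\<lambda>w. print_inst Rs (reduce_pinst m G1 G2 (parse_inst [R] w)))"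
    by (intro fp_intros)
  fix I assume I: "I \<in> instances {R}"
  obtain ds where ds: "parse_inst [R] (enc_inst I) = (num_vars I, bits (threshold I), ds)"
      "\<forall>d\<in>set ds. fst d < length [R]" "inst_cons [R] ds = constraints I"
    using parse_inst_enc[of "[R]" I] I R by auto
  have "map snd ds = map snd (map (\<lambda>c. (0 :: nat, snd c)) (constraints I))"
    unfolding ds(3)[symmetric] inst_cons_def by simp
  from new_cons_snd[OF this] show "print_inst Rs (reduce_pinst m G1 G2 (parse_inst [R] (enc_inst I))) = enc_inst (red I)"
    using new_cons_ok[OF I]
    by (simp add: ds(1) reduce_pinst_def add_carry_bits print_inst_enc red_def)
qed

lemma cv_reducible:
  assumes "\<And>I. I \<in> instances {R} \<Longrightarrow> (\<exists>h. solution I h \<and> threshold I \<le> weight I h) \<longleftrightarrow>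
     (\<exists>h. solution (red I) h \<and> Suc (threshold I) \<le> weight (red I) h)"
  shows "U_Max_Ones {R} \<le>\<^sub>C\<^sub>V U_Max_Ones (set Rs)"
  unfolding CV_reducible_def CV_reduction_def
proof (intro exI conjI ballI)
  show "red I \<in> fst (U_Max_Ones (set Rs))" if "I \<in> fst (U_Max_Ones {R})" for I
    using that red_instances by (simp add: U_Max_Ones_def)
  show "polytime_computable enc_inst (fst (U_Max_Ones {R})) enc_inst red"
    using red_computable by (simp add: U_Max_Ones_def)
  show "(I \<in> snd (U_Max_Ones {R})) = (red I \<in> snd (U_Max_Ones (set Rs)))" if "I \<in> fst (U_Max_Ones {R})" for I
    using that assms[of I] red_instances[of I]
    by (simp add: U_Max_Ones_def weight_def) (simp add: red_def)
  show "\<bar>int (card (var (red I))) - int (card (var I))\<bar> \<le> int m" for I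
    by (simp add: red_def var_def)
qed

end

text \<open>Setting the fresh variable to true is always possible and gains one; forgetting it loses
  at most one and still leaves a solution. The optimum therefore rises by exactly one.\<close>

lemma cv_reducible_one:
  assumes R: "boolean_relation R" and Rs: "\<forall>R\<in>set Rs. boolean_relation R"
    and G: "gok Rs (Suc (fst R)) G"
    and 1: "\<And>t b. length t = fst R \<Longrightarrow> gsat Rs G (\<lambda>j. (t @ [b]) ! j) \<Longrightarrow> t \<in> snd R"
    and 2: "\<And>t. t \<in> snd R \<Longrightarrow> gsat Rs G (\<lambda>j. (t @ [True]) ! j)"
  shows "U_Max_Ones {R} \<le>\<^sub>C\<^sub>V U_Max_Ones (set Rs)"
proof -
  interpret gadget_reduction R Rs 1 G "[]"
    by unfold_locales (use R Rs G in \<open>auto simp: gok_def\<close>)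
  show ?thesis
  proof (rule cv_reducible)
    fix I assume I: "I \<in> instances {R}"
    let ?n = "num_vars I"
    have sat: "gsat Rs G (\<lambda>j. h (nthd 0 (snd c @ [?n, Suc ?n]) j)) \<longleftrightarrow>
        gsat Rs G (\<lambda>j. (map h (snd c) @ [h ?n]) ! j)" if "c \<in> set (constraints I)" for h c
      by (rule gsat_cong[OF G]) (use con_vars[OF I that] in \<open>auto simp: nthd_eq nth_append less_Suc_eq\<close>)
    have sol: "solution (red I) h \<longleftrightarrow> (\<forall>c\<in>set (constraints I). gsat Rs G (\<lambda>j. (map h (snd c) @ [h ?n]) ! j))" for h
      unfolding solution_red[OF I] using sat by (auto simp: gsat_def[of Rs "[]"])
    have solI: "solution I h \<longleftrightarrow> (\<forall>c\<in>set (constraints I). map h (snd c) \<in> snd R)" for h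
      using con_vars[OF I] by (auto simp: solution_def case_prod_beta)
    have val: "weight (red I) h = weight I h + of_bool (h ?n)" for h
      unfolding weight_red by (simp add: weight_def var_def)
    show "(\<exists>h. solution I h \<and> threshold I \<le> weight I h) \<longleftrightarrow>
       (\<exists>h. solution (red I) h \<and> Suc (threshold I) \<le> weight (red I) h)"
    proof
      assume "\<exists>h. solution I h \<and> threshold I \<le> weight I h"
      then obtain h where h: "solution I h" "threshold I \<le> weight I h" by blast
      let ?h = "h(?n := True)"
      have eq: "map ?h (snd c) = map h (snd c)" if "c \<in> set (constraints I)" for c
        using con_vars(2)[OF I that] by auto
      have "gsat Rs G (\<lambda>j. (map ?h (snd c) @ [?h ?n]) ! j)" if "c \<in> set (constraints I)" for c
        unfolding eq[OF that] fun_upd_same using h(1) 2 that unfolding solI by blast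
      then have "solution (red I) ?h" unfolding sol by blast
      moreover have "weight I ?h = weight I h"
        by (auto simp: weight_def var_def intro!: sum.cong)
      ultimately show "\<exists>h. solution (red I) h \<and> Suc (threshold I) \<le> weight (red I) h"
        using h(2) val[of ?h] by (intro exI[of _ ?h]) simp
    next
      assume "\<exists>h. solution (red I) h \<and> Suc (threshold I) \<le> weight (red I) h"
      then obtain h where h: "solution (red I) h" "Suc (threshold I) \<le> weight (red I) h" by blast
      have "solution I h"
        using h(1) 1[of "map h (snd _)"] con_vars(1)[OF I] unfolding sol solI by fastforce
      moreover have "threshold I \<le> weight I h"
        using h(2) val[of h] by (auto simp: of_bool_def split: if_splits)
      ultimately show "\<exists>h. solution I h \<and> threshold I \<le> weight I h" by blast
    qed
  qed
qed

text \<open>The first fresh variable is a switch. Switched off, \<open>G1\<close> forces every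
  constrained variable to 0 and \<open>G2\<close> ties all others to the switch, so the weight is 0
  and misses the raised threshold. Switched on, \<open>G1\<close> is exactly \<open>R\<close>. The
  second fresh variable serves \<open>G2\<close> as a constant 0.\<close>

lemma cv_reducible_two:
  assumes R: "boolean_relation R" and Rs: "\<forall>R\<in>set Rs. boolean_relation R"
    and g1: "gok Rs (Suc (fst R)) G1" and g2: "gok Rs 3 G2"
    and 1: "\<And>t. length t = fst R \<Longrightarrow> gsat Rs G1 (\<lambda>j. (t @ [True]) ! j) \<longleftrightarrow> t \<in> snd R"
    and 2: "\<And>t. length t = fst R \<Longrightarrow> gsat Rs G1 (\<lambda>j. (t @ [False]) ! j) \<Longrightarrow> \<forall>b\<in>set t. \<not> b"
    and 3: "\<And>x y z. gsat Rs G2 (\<lambda>j. [x, y, z] ! j) \<longleftrightarrow> x = y \<and> \<not> z"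
  shows "U_Max_Ones {R} \<le>\<^sub>C\<^sub>V U_Max_Ones (set Rs)"
proof -
  interpret gadget_reduction R Rs 2 G1 G2
  proof unfold_locales
    show "gok Rs (fst R + 2) G1" "gok Rs (Suc 2) G2"
      using gok_mono[OF g1, of "fst R + 2"] g2 by (auto simp: numeral_3_eq_3)
  qed (use R Rs in auto)
  show ?thesis
  proof (rule cv_reducible)
    fix I assume I: "I \<in> instances {R}"
    let ?n = "num_vars I"
    have sat1: "gsat Rs G1 (\<lambda>j. h (nthd 0 (snd c @ [?n, Suc ?n]) j)) \<longleftrightarrow>
        gsat Rs G1 (\<lambda>j. (map h (snd c) @ [h ?n]) ! j)" if "c \<in> set (constraints I)" for h c
      by (rule gsat_cong[OF g1]) (use con_vars[OF I that] in \<open>auto simp: nthd_eq nth_append less_Suc_eq\<close>)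
    have sat2: "gsat Rs G2 (\<lambda>j. h (nthd 0 [v, ?n, Suc ?n] j)) \<longleftrightarrow> h v = h ?n \<and> \<not> h (Suc ?n)" for h v
      unfolding 3[symmetric] by (rule gsat_cong[OF g2]) (auto simp: nthd_eq nth_Cons')
    have sol: "solution (red I) h \<longleftrightarrow> (\<forall>c\<in>set (constraints I). gsat Rs G1 (\<lambda>j. (map h (snd c) @ [h ?n]) ! j)) \<and>
        (\<forall>v\<le>?n. \<not> occurs I v \<longrightarrow> h v = h ?n) \<and> \<not> h (Suc ?n)" for h
    proof -
      have "\<not> occurs I ?n" using con_vars(2)[OF I] by (auto simp: occurs_def)
      then show ?thesis unfolding solution_red[OF I] sat2 using sat1 by blast
    qed
    have solI: "solution I h \<longleftrightarrow> (\<forall>c\<in>set (constraints I). map h (snd c) \<in> snd R)" for h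
      using con_vars[OF I] by (auto simp: solution_def case_prod_beta)
    have val: "weight (red I) h = weight I h + of_bool (h ?n) + of_bool (h (Suc ?n))" for h
      unfolding weight_red by (simp add: weight_def var_def numeral_2_eq_2)
    show "(\<exists>h. solution I h \<and> threshold I \<le> weight I h) \<longleftrightarrow>
       (\<exists>h. solution (red I) h \<and> Suc (threshold I) \<le> weight (red I) h)"
    proof
      assume "\<exists>h. solution I h \<and> threshold I \<le> weight I h"
      then obtain h where h: "solution I h" "threshold I \<le> weight I h" by blast
      \<comment> \<open>Unconstrained variables have to follow the switch; making them true can only
        increase the weight.\<close>
      let ?h = "\<lambda>v. if v = ?n then True else if v = Suc ?n then False else occurs I v \<longrightarrow> h v"
      have eq: "map ?h (snd c) = map h (snd c)" if "c \<in> set (constraints I)" for c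
        using con_vars(2)[OF I that] that by (auto simp: occurs_def)
      have "gsat Rs G1 (\<lambda>j. (map ?h (snd c) @ [?h ?n]) ! j)" if "c \<in> set (constraints I)" for c
        using h(1) 1[of "map h (snd c)"] con_vars(1)[OF I] that
        unfolding eq[OF that] solI by simp
      then have "solution (red I) ?h" unfolding sol by simp
      moreover have "weight I h \<le> weight I ?h"
        unfolding weight_def by (rule sum_mono) (auto simp: var_def)
      ultimately show "\<exists>h. solution (red I) h \<and> Suc (threshold I) \<le> weight (red I) h"
        using h(2) val[of ?h] by (intro exI[of _ ?h]) simp
    next
      assume "\<exists>h. solution (red I) h \<and> Suc (threshold I) \<le> weight (red I) h"
      then obtain h where h: "solution (red I) h" "Suc (threshold I) \<le> weight (red I) h" by blast
      have "h ?n"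
      proof (rule ccontr)
        assume n: "\<not> h ?n"
        have "\<not> h v" if "v < ?n" for v
        proof (cases "occurs I v")
          case True
          then obtain c where c: "c \<in> set (constraints I)" "v \<in> set (snd c)"
            by (auto simp: occurs_def)
          have "gsat Rs G1 (\<lambda>j. (map h (snd c) @ [False]) ! j)"
            using h(1) n c(1) unfolding sol by fastforce
          from 2[OF _ this] con_vars(1)[OF I c(1)] c(2) show ?thesis by auto
        next
          case False
          then show ?thesis using h(1) n that unfolding sol by auto
        qed
        then have "weight I h = 0" by (simp add: weight_def var_def)
        then show False using h n val[of h] unfolding sol by simp
      qed
      then have "solution I h"
        using h(1) 1 con_vars(1)[OF I] unfolding sol solI by simp
      moreover have "threshold I \<le> weight I h"
        using h(2) h(1) val[of h] unfolding sol by (auto simp: of_bool_def split: if_splits)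
      ultimately show "\<exists>h. solution I h \<and> threshold I \<le> weight I h" by blast
    qed
  qed
qed

section \<open>The seven relations as tables of polymorphisms\<close>

definition iota2 :: "nat \<Rightarrow> nat \<Rightarrow> nat \<Rightarrow> nat \<Rightarrow> bool list \<Rightarrow> nat" where
  "iota2 a b c d x = (if x ! 0 then (if x ! 1 then d else c) else (if x ! 1 then b else a))"

definition iota3 :: "nat \<Rightarrow> nat \<Rightarrow> nat \<Rightarrow> nat \<Rightarrow> nat \<Rightarrow> nat \<Rightarrow> nat \<Rightarrow> nat \<Rightarrow> bool list \<Rightarrow> nat" where
  "iota3 a b c d a' b' c' d' x = (if x ! 0 then iota2 a' b' c' d' (tl x) else iota2 a b c d (tl x))"

lemma gsat_iota2:
  assumes "\<forall>R\<in>set Rs. boolean_relation R"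
  shows "gsat Rs (indicator Rs 2 (iota2 a b c d)) v \<longleftrightarrow> pol2 (set Rs) (v a) (v b) (v c) (v d)"
  unfolding gsat_indicator[OF assms] pol_2_iff by (simp add: iota2_def)

lemma gsat_iota3:
  assumes "\<forall>R\<in>set Rs. boolean_relation R"
  shows "gsat Rs (indicator Rs 3 (iota3 a b c d a' b' c' d')) v \<longleftrightarrow>
    pol3 (set Rs) (v a) (v b) (v c) (v d) (v a') (v b') (v c') (v d')"
  unfolding gsat_indicator[OF assms] pol_3_iff by (simp add: iota2_def iota3_def)

lemma gok_iota2: "{a, b, c, d} \<subseteq> {..<m} \<Longrightarrow> gok Rs m (indicator Rs s (iota2 a b c d))"
  by (rule gok_indicator) (auto simp: iota2_def)

lemma gok_iota3: "{a, b, c, d, a', b', c', d'} \<subseteq> {..<m} \<Longrightarrow> gok Rs m (indicator Rs s (iota3 a b c d a' b' c' d'))"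
  by (rule gok_indicator) (auto simp: iota2_def iota3_def)

lemma R_IS2_1_simps: "fst R_IS2_1 = 3" "boolean_relation R_IS2_1"
  "[x1, x2, c0] \<in> snd R_IS2_1 \<longleftrightarrow> \<not> (x1 \<and> x2) \<and> \<not> c0"
  by (auto simp: R_IS2_1_def boolean_relation_def)

lemma R_II2_simps: "fst R_II2 = 8" "boolean_relation R_II2"
  "[x1, x2, x3, x4, x5, x6, c0, c1] \<in> snd R_II2 \<longleftrightarrow>
     (x1, x2, x3) \<in> {(False, False, True), (False, True, False), (True, False, False)} \<and>
     x4 = (\<not> x1) \<and> x5 = (\<not> x2) \<and> x6 = (\<not> x3) \<and> \<not> c0 \<and> c1"
  by (auto simp: R_II2_def boolean_relation_def)

lemma R_IN2_simps: "fst R_IN2 = 8" "boolean_relation R_IN2"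
  "[x1, x2, x3, x4, x5, x6, x7, x8] \<in> snd R_IN2 \<longleftrightarrow>
     even (of_bool x1 + of_bool x2 + of_bool x3 + of_bool x4 :: nat) \<and>
     x5 = (\<not> x1) \<and> x6 = (\<not> x2) \<and> x7 = (\<not> x3) \<and> x8 = (\<not> x4) \<and> ((x1 \<and> x4) \<longleftrightarrow> (x2 \<and> x3))"
  by (auto simp: R_IN2_def boolean_relation_def)

lemma R_IL0_simps: "fst R_IL0 = 4" "boolean_relation R_IL0"
  "[x1, x2, x3, c0] \<in> snd R_IL0 \<longleftrightarrow> even (of_bool x1 + of_bool x2 + of_bool x3 :: nat) \<and> \<not> c0"
  by (auto simp: R_IL0_def boolean_relation_def)

lemma R_IL2_simps: "fst R_IL2 = 8" "boolean_relation R_IL2"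
  "[x1, x2, x3, x4, x5, x6, c0, c1] \<in> snd R_IL2 \<longleftrightarrow>
     even (of_bool x1 + of_bool x2 + of_bool x3 :: nat) \<and>
     x4 = (\<not> x1) \<and> x5 = (\<not> x2) \<and> x6 = (\<not> x3) \<and> \<not> c0 \<and> c1"
  by (auto simp: R_IL2_def boolean_relation_def)

lemma R_IL3_simps: "fst R_IL3 = 8" "boolean_relation R_IL3"
  "[x1, x2, x3, x4, x5, x6, x7, x8] \<in> snd R_IL3 \<longleftrightarrow>
     even (of_bool x1 + of_bool x2 + of_bool x3 + of_bool x4 :: nat) \<and>
     x5 = (\<not> x1) \<and> x6 = (\<not> x2) \<and> x7 = (\<not> x3) \<and> x8 = (\<not> x4)"
  by (auto simp: R_IL3_def boolean_relation_def)

lemma R_ID2_simps: "fst R_ID2 = 6" "boolean_relation R_ID2"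
  "[x1, x2, x3, x4, c0, c1] \<in> snd R_ID2 \<longleftrightarrow>
     (x1 \<or> x2) \<and> x3 = (\<not> x1) \<and> x4 = (\<not> x2) \<and> \<not> c0 \<and> c1"
  by (auto simp: R_ID2_def boolean_relation_def)

lemma length_4_cases: "length xs = 4 \<Longrightarrow> (\<And>a b c d. xs = [a, b, c, d] \<Longrightarrow> P) \<Longrightarrow> P"
  by (auto simp: eval_nat_numeral length_Suc_conv)

lemma length_6_cases: "length xs = 6 \<Longrightarrow> (\<And>a b c d e f. xs = [a, b, c, d, e, f] \<Longrightarrow> P) \<Longrightarrow> P"
  by (auto simp: eval_nat_numeral length_Suc_conv)

lemma length_8_cases: "length xs = 8 \<Longrightarrow> (\<And>a b c d e f g h. xs = [a, b, c, d, e, f, g, h] \<Longrightarrow> P) \<Longrightarrow> P"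
  by (auto simp: eval_nat_numeral length_Suc_conv)

text \<open>The gadget sees only the variables of the constraint, so the fresh variable is free and
  may be true.\<close>

lemma cv_reducible_exact:
  assumes R: "boolean_relation R" and Rs: "\<forall>R\<in>set Rs. boolean_relation R"
    and G: "gok Rs (fst R) G"
    and 1: "\<And>t b. length t = fst R \<Longrightarrow> gsat Rs G (\<lambda>j. (t @ [b]) ! j) \<longleftrightarrow> t \<in> snd R"
  shows "U_Max_Ones {R} \<le>\<^sub>C\<^sub>V U_Max_Ones (set Rs)"
proof (rule cv_reducible_one[OF R Rs gok_mono[OF G]])
  show "gsat Rs G (\<lambda>j. (t @ [True]) ! j)" if "t \<in> snd R" for t
    using that 1[of t] R by (auto simp: boolean_relation_def)
qed (use 1 in auto)

section \<open>Languages outside the tractable cases\<close>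

locale intractable =
  fixes Rs :: "brel list"
  assumes Rs: "\<forall>R\<in>set Rs. boolean_relation R"
    and no_one: "\<not> pol2 (set Rs) True True True True"
    and no_or: "\<not> pol2 (set Rs) False True True True"
    and no_maj_minority: "\<not> (pol3 (set Rs) False False False True False True True True \<and>
      pol3 (set Rs) False True True False True False False True)"
begin

abbreviation "P2 \<equiv> pol2 (set Rs)"
abbreviation "P3 \<equiv> pol3 (set Rs)"

lemmas projs = pol_projs[OF Rs]

lemmas sels = sel2_def sel3_def

text \<open>This is the unary polymorphism \<open>f(x, x)\<close>, written as a binary
  table.\<close>

lemma diag: "P2 a b c d \<Longrightarrow> P2 a a d d"
  using pol2_comp2[OF _ projs(1,1), of a b c d] by (simp add: sels)

lemma swap: "P2 a b c d \<Longrightarrow> P2 a c b d"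
  using pol2_comp2[OF _ projs(2,1), of a b c d] by (simp add: sels)

lemma diag_cases: "P2 a b c d \<Longrightarrow> \<not> (a \<and> d)"
  using diag[of a b c d] no_one by auto

text \<open>These are the three ways of identifying two arguments; \<open>minors0\<close> sets one
  argument to 0 instead.\<close>

lemma minors:
  assumes "P3 a0 a1 a2 a3 a4 a5 a6 a7"
  shows "P2 a0 a1 a6 a7" "P2 a0 a2 a5 a7" "P2 a0 a4 a3 a7"
  using pol3_comp2[OF assms projs(1) projs(1) projs(2)] pol3_comp2[OF assms projs(1) projs(2) projs(1)]
    pol3_comp2[OF assms projs(2) projs(1) projs(1)]
  by (simp_all add: sels)

lemma minors0:
  assumes "P3 a0 a1 a2 a3 a4 a5 a6 a7" "P2 False False False False"
  shows "P2 a0 a1 a2 a3" "P2 a0 a1 a4 a5" "P2 a0 a2 a4 a6"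
  using pol3_comp2[OF assms(1) assms(2) projs(1) projs(2)] pol3_comp2[OF assms(1) projs(1) assms(2) projs(2)]
    pol3_comp2[OF assms(1) projs(1) projs(2) assms(2)]
  by (simp_all add: sels)

lemma zero_no_neg:
  assumes "P2 False False False False" shows "\<not> P2 True True False False"
  using pol2_comp2[OF _ assms assms, of True True False False] no_one by (auto simp: sels)

text \<open>Once negation and exclusive or are excluded, a binary polymorphism is 0 at (0,0) and not
  1 at both mixed arguments. If its value at (1,1) is 1, conjunction and the two projections realise
  all three admissible pairs; a fresh variable placed there may therefore be true.\<close>

lemma and_case:
  assumes a: "P2 False False False True"
  shows "U_Max_Ones {R_IS2_1} \<le>\<^sub>C\<^sub>V U_Max_Ones (set Rs)"
proof -
  have no_neg: "\<not> P2 True True False False"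
  proof
    assume n: "P2 True True False False"
    \<comment> \<open>The conjunction of the two negations is the negation of disjunction.\<close>
    have nx: "P2 True True False False" "P2 True False True False"
      using n pol2_comp2[OF n projs(2,2)] by (simp_all add: sels)
    have "P2 True False False False"
      using pol2_comp2[OF a nx] by (simp add: sels)
    from pol2_comp2[OF n this this] show False using no_or by (simp add: sels)
  qed
  have no_xor: "\<not> P2 False True True False"
  proof
    assume x: "P2 False True True False"
    \<comment> \<open>The sum modulo 2 of \<open>x + y\<close> and \<open>x * y\<close> is
      disjunction.\<close>
    from pol2_comp2[OF x x a] show False using no_or by (simp add: sels)
  qed
  have P2: "\<not> a \<and> \<not> (b \<and> c)" if p: "P2 a b c d" for a b c d
    using diag[OF p] diag_cases[OF p] no_neg no_or no_xor p
    by (cases a; cases b; cases c; cases d) auto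
  have P2': "P2 False b c True" if "\<not> (b \<and> c)" for b c
    using that a projs by (cases b; cases c) auto
  let ?G = "indicator Rs 2 (iota2 2 0 1 3)"
  show ?thesis
  proof (rule cv_reducible_one[OF R_IS2_1_simps(2) Rs])
    show "gok Rs (Suc (fst R_IS2_1)) ?G"
      by (rule gok_iota2) (simp add: R_IS2_1_simps)
    show "t \<in> snd R_IS2_1" if "length t = fst R_IS2_1" "gsat Rs ?G (\<lambda>j. (t @ [b]) ! j)" for t b
      using that P2 unfolding gsat_iota2[OF Rs] R_IS2_1_simps(1)
      by (elim length_3_cases) (auto simp: R_IS2_1_simps)
    show "gsat Rs ?G (\<lambda>j. (t @ [True]) ! j)" if "t \<in> snd R_IS2_1" for t
    proof -
      have "length t = 3" using that R_IS2_1_simps by (auto simp: boolean_relation_def)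
      then show ?thesis
        using that P2' unfolding gsat_iota2[OF Rs]
        by (elim length_3_cases) (simp add: R_IS2_1_simps)
    qed
  qed
qed

text \<open>The binary polymorphisms are 0, the projections and possibly exclusive or. With it they
  form a linear space, which is \<open>R_IL0\<close>. Without it the ternary ones are 0 and the
  projections; the zero table is not in \<open>R_II2\<close>, and the switch of
  \<open>cv_reducible_two\<close> disposes of it.\<close>

lemma zero_case:
  assumes a: "\<not> P2 False False False True" and z: "P2 False False False False"
  shows "U_Max_Ones {R_IL0} \<le>\<^sub>C\<^sub>V U_Max_Ones (set Rs) \<or> U_Max_Ones {R_II2} \<le>\<^sub>C\<^sub>V U_Max_Ones (set Rs)"
proof -
  note no_neg = zero_no_neg[OF z]
  \<comment> \<open>Conjunction of \<open>x\<close> with the negation of (\<open>x\<close> and not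
    \<open>y\<close>) is conjunction of \<open>x\<close> and \<open>y\<close>.\<close>
  have no_andn: "\<not> P2 False False True False"
    using pol2_comp2[OF _ projs(1), of False False True False False False True False] a by (auto simp: sels)
  have P2: "\<not> a \<and> d = (b \<noteq> c)  \<or> \<not> a \<and> b \<and> c \<and> \<not> d" if p: "P2 a b c d" for a b c d
    using diag[OF p] diag_cases[OF p] no_neg no_or no_andn a swap[OF p] p
    by (cases a; cases b; cases c; cases d) auto
  show ?thesis
  proof (cases "P2 False True True False")
    case True
    have P2': "P2 a b c d \<longleftrightarrow> even (of_bool b + of_bool c + of_bool d :: nat) \<and> \<not> a" for a b c d
    proof
      show "P2 a b c d \<Longrightarrow> even (of_bool b + of_bool c + of_bool d :: nat) \<and> \<not> a"
        using P2[of a b c d] by (cases b; cases c; cases d) auto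
      show "even (of_bool b + of_bool c + of_bool d :: nat) \<and> \<not> a \<Longrightarrow> P2 a b c d"
        using True z projs by (cases b; cases c; cases d) auto
    qed
    have "U_Max_Ones {R_IL0} \<le>\<^sub>C\<^sub>V U_Max_Ones (set Rs)"
    proof (rule cv_reducible_exact[OF R_IL0_simps(2) Rs])
      show "gok Rs (fst R_IL0) (indicator Rs 2 (iota2 3 0 1 2))"
        by (rule gok_iota2) (simp add: R_IL0_simps)
      show "gsat Rs (indicator Rs 2 (iota2 3 0 1 2)) (\<lambda>j. (t @ [b]) ! j) \<longleftrightarrow> t \<in> snd R_IL0"
        if "length t = fst R_IL0" for t b
        using that unfolding gsat_iota2[OF Rs] P2' R_IL0_simps(1)
        by (elim length_4_cases) (simp add: R_IL0_simps)
    qed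
    then show ?thesis by blast
  next
    case False
    have P2': "P2 a b c d \<longleftrightarrow> \<not> a \<and> \<not> (b \<and> c) \<and> d = (b \<or> c)" for a b c d
    proof
      show "P2 a b c d \<Longrightarrow> \<not> a \<and> \<not> (b \<and> c) \<and> d = (b \<or> c)"
        using P2[of a b c d] False projs z by (cases b; cases c; cases d; cases a) auto
      show "\<not> a \<and> \<not> (b \<and> c) \<and> d = (b \<or> c) \<Longrightarrow> P2 a b c d"
        using projs z by (cases b; cases c) auto
    qed
    have z3: "P3 False False False False False False False False"
      using pol2_comp3[OF z projs(3,3)] by (simp add: sels)
    have P3: "P3 a0 a1 a2 a3 a4 a5 a6 a7 \<longleftrightarrow>
        (a0, a1, a2, a3, a4, a5, a6, a7) \<in> {
          (False, False, False, False, False, False, False, False),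
          (False, False, False, False, True, True, True, True),
          (False, False, True, True, False, False, True, True),
          (False, True, False, True, False, True, False, True)}" for a0 a1 a2 a3 a4 a5 a6 a7
    proof
      assume p: "P3 a0 a1 a2 a3 a4 a5 a6 a7"
      show "(a0, a1, a2, a3, a4, a5, a6, a7) \<in> {
          (False, False, False, False, False, False, False, False),
          (False, False, False, False, True, True, True, True),
          (False, False, True, True, False, False, True, True),
          (False, True, False, True, False, True, False, True)}"
        using minors[OF p, unfolded P2'] minors0[OF p z, unfolded P2']
        by (cases a1; cases a2; cases a4) simp_all
    qed (use z3 projs in auto)
    \<comment> \<open>The entry at (1,1,1) distinguishes projections from 0. It is the switch 8 in
      the first copy and \<open>c1\<close> in the second, which makes the two equal.\<close>
    let ?G1 = "indicator Rs 3 (iota3 6 0 1 5 2 4 3 8) @ indicator Rs 3 (iota3 6 0 1 5 2 4 3 7)"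
    \<comment> \<open>With the entries z, x, z, y only the zero table and the second projection are
      possible, hence \<open>x = y\<close> and z is 0.\<close>
    let ?G2 = "indicator Rs 2 (iota2 2 0 2 1)"
    have "U_Max_Ones {R_II2} \<le>\<^sub>C\<^sub>V U_Max_Ones (set Rs)"
    proof (rule cv_reducible_two[OF R_II2_simps(2) Rs])
      show "gok Rs (Suc (fst R_II2)) ?G1"
        unfolding gok_append by (intro conjI gok_iota3) (simp_all add: R_II2_simps)
      show "gok Rs 3 ?G2"
        by (rule gok_iota2) simp
      show "gsat Rs ?G1 (\<lambda>j. (t @ [True]) ! j) \<longleftrightarrow> t \<in> snd R_II2" if "length t = fst R_II2" for t
        using that unfolding gsat_append gsat_iota3[OF Rs] P3 R_II2_simps(1)
        by (elim length_8_cases) (auto simp: R_II2_simps)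
      show "\<forall>b\<in>set t. \<not> b" if "length t = fst R_II2" "gsat Rs ?G1 (\<lambda>j. (t @ [False]) ! j)" for t
        using that unfolding gsat_append gsat_iota3[OF Rs] P3 R_II2_simps(1)
        by (elim length_8_cases) auto
      show "gsat Rs ?G2 (\<lambda>j. [x, y, z] ! j) \<longleftrightarrow> x = y \<and> \<not> z" for x y z
        unfolding gsat_iota2[OF Rs] P2' by auto
    qed
    then show ?thesis by blast
  qed
qed

section \<open>Languages without conjunction and constant 0\<close>

context
  assumes no_and: "\<not> P2 False False False True" and no_zero: "\<not> P2 False False False False"
begin

lemma sel2_neg: "sel2 True True False False x x = (\<not> x)"
  by (simp add: sel2_def)

lemma neg_table3: "P2 True True False False \<Longrightarrow> P3 a b c d e f g h \<Longrightarrow>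
    P3 (\<not> a) (\<not> b) (\<not> c) (\<not> d) (\<not> e) (\<not> f) (\<not> g) (\<not> h)"
  using pol2_comp3[of "set Rs" True True False False a b c d e f g h a b c d e f g h] by (simp add: sel2_neg)

text \<open>The value at (1,1) is 1, for otherwise the diagonal would be constant 0; of the four
  remaining tables, conjunction and disjunction are excluded.\<close>

lemma idem_table2: "P2 False b c d \<Longrightarrow> d \<and> c = (\<not> b)"
  using diag[of False b c d] no_zero no_and no_or by (cases b; cases c; cases d) auto

text \<open>Each identification of two arguments is a projection. So the table is determined by its
  values at (0,0,1), (0,1,0) and (1,0,0): one true value is a projection, none is majority, three
  are minority, and two give a Pixley operation.\<close>

lemma idem_table3:
  assumes "P3 False a1 a2 a3 a4 a5 a6 a7"
  shows "a7 \<and> a6 = (\<not> a1) \<and> a5 = (\<not> a2) \<and> a3 = (\<not> a4)"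
  using minors[OF assms] idem_table2 by blast

text \<open>A Pixley operation \<open>p\<close> satisfies p(x,x,z) = z, p(x,z,z) = x and p(x,z,x) =
  x. Then p(x, p(x,y,z), z) is majority \<open>m\<close>, and p(p(x,y,z), m(x,y,z), y) is
  minority.\<close>

lemma no_pixley: "\<not> P3 False True False False True True False True"
proof
  assume p: "P3 False True False False True True False True"
  have m: "P3 False False False True False True True True"
    using pol3_comp3[OF p projs(3) p projs(5)] by (simp add: sels)
  have "P3 False True True False True False False True"
    using pol3_comp3[OF p p m projs(4)] by (simp add: sels)
  with m no_maj_minority show False by blast
qed

text \<open>The three cases differ by a permutation of the arguments.\<close>

lemma no_two:
  assumes p: "P3 False a1 a2 a3 a4 a5 a6 a7"
  shows "\<not> (a1 \<and> a2 \<and> \<not> a4)" "\<not> (a1 \<and> \<not> a2 \<and> a4)" "\<not> (\<not> a1 \<and> a2 \<and> a4)"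
proof -
  note t = idem_table3[OF p]
  show "\<not> (a1 \<and> a2 \<and> \<not> a4)"
    using pol3_comp3[OF p projs(4) projs(3) projs(5)] no_pixley t by (auto simp: sels)
  show "\<not> (a1 \<and> \<not> a2 \<and> a4)"
    using p no_pixley t by auto
  show "\<not> (\<not> a1 \<and> a2 \<and> a4)"
    using pol3_comp3[OF p projs(3) projs(5) projs(4)] no_pixley t by (auto simp: sels)
qed

text \<open>The full-adder identity expresses minority by majority and negation: x + y + z = maj(not
  maj(x,y,z), maj(x,y,not z), z).\<close>

lemma neg_no_maj:
  assumes n: "P2 True True False False"
  shows "\<not> P3 False False False True False True True True"
proof
  assume m: "P3 False False False True False True True True"
  note nz = neg_table3[OF n projs(5), simplified] and nm = neg_table3[OF n m, simplified]
  from pol3_comp3[OF m projs(3) projs(4) nz]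
  have "P3 False False True False True False True True" by (simp add: sels)
  from pol3_comp3[OF m nm this projs(5)]
  have "P3 False True True False True False False True" by (simp add: sels)
  with m no_maj_minority show False by blast
qed

lemma idem_iff:
  assumes "P3 False False False True False True True True \<longleftrightarrow> m"
    and "P3 False True True False True False False True \<longleftrightarrow> n"
  shows "P3 False a1 a2 a3 a4 a5 a6 a7 \<longleftrightarrow> a7 \<and> a6 = (\<not> a1) \<and> a5 = (\<not> a2) \<and> a3 = (\<not> a4) \<and>
    ((a1, a2, a4) \<in> {(True, False, False), (False, True, False), (False, False, True)} \<or>
     \<not> a1 \<and> \<not> a2 \<and> \<not> a4 \<and> m \<or> a1 \<and> a2 \<and> a4 \<and> n)" (is "_ \<longleftrightarrow> ?r")
proof
  assume p: "P3 False a1 a2 a3 a4 a5 a6 a7"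
  show ?r
    using idem_table3[OF p] no_two[OF p] p assms by (cases a1; cases a2; cases a4) auto
qed (use projs assms in auto)

text \<open>If the value at (0,0,0) is 1, the diagonal must be negation, as constant 1 is excluded;
  the complement of the table is then again a polymorphism, with value 0 there.\<close>

lemma table_iff:
  "P3 a0 a1 a2 a3 a4 a5 a6 a7 \<longleftrightarrow> \<not> a0 \<and> P3 False a1 a2 a3 a4 a5 a6 a7 \<or>
     a0 \<and> P2 True True False False \<and> P3 False (\<not> a1) (\<not> a2) (\<not> a3) (\<not> a4) (\<not> a5) (\<not> a6) (\<not> a7)"
proof (cases a0)
  case True
  have "P2 True True False False" if "P3 True a1 a2 a3 a4 a5 a6 a7"
    using diag[OF minors(1)[OF that]] no_one by (cases a7) auto
  then show ?thesis
    using True neg_table3[of True a1 a2 a3 a4 a5 a6 a7]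
      neg_table3[of False "\<not> a1" "\<not> a2" "\<not> a3" "\<not> a4" "\<not> a5" "\<not> a6" "\<not> a7"] by auto
qed simp

lemma idempotent_case:
  assumes n: "\<not> P2 True True False False"
  shows "U_Max_Ones {R_II2} \<le>\<^sub>C\<^sub>V U_Max_Ones (set Rs) \<or> U_Max_Ones {R_IL2} \<le>\<^sub>C\<^sub>V U_Max_Ones (set Rs) \<or>
    U_Max_Ones {R_ID2} \<le>\<^sub>C\<^sub>V U_Max_Ones (set Rs)"
proof -
  consider "P3 False False False True False True True True" "\<not> P3 False True True False True False False True"
    | "\<not> P3 False False False True False True True True" "P3 False True True False True False False True"
    | "\<not> P3 False False False True False True True True" "\<not> P3 False True True False True False False True"
    using no_maj_minority by blast
  then show ?thesis
  proof cases
    case 1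
    then have m: "P3 False False False True False True True True \<longleftrightarrow> True"
      "P3 False True True False True False False True \<longleftrightarrow> False" by auto
    \<comment> \<open>Using \<open>c0\<close> also at (0,0,1) excludes the third projection. The
      remaining projections and majority are the tables whose entries \<open>x3\<close> and
      \<open>x4\<close> at (0,1,0) and (1,0,0) are not both true.\<close>
    let ?G = "indicator Rs 3 (iota3 4 4 2 1 3 0 5 5)"
    have "U_Max_Ones {R_ID2} \<le>\<^sub>C\<^sub>V U_Max_Ones (set Rs)"
    proof (rule cv_reducible_exact[OF R_ID2_simps(2) Rs])
      show "gok Rs (fst R_ID2) ?G"
        by (rule gok_iota3) (simp add: R_ID2_simps)
      show "gsat Rs ?G (\<lambda>j. (t @ [b]) ! j) \<longleftrightarrow> t \<in> snd R_ID2" if "length t = fst R_ID2" for t b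
        using that unfolding gsat_iota3[OF Rs] table_iff[of "_ ! _"] idem_iff[OF m] R_ID2_simps(1)
        by (elim length_6_cases) (auto simp: R_ID2_simps n)
    qed
    then show ?thesis by blast
  next
    case 2
    then have m: "P3 False False False True False True True True \<longleftrightarrow> False"
      "P3 False True True False True False False True \<longleftrightarrow> True" by auto
    \<comment> \<open>The complements \<open>x4\<close>, \<open>x5\<close>, \<open>x6\<close> sit at
      (0,0,1), (0,1,0), (1,0,0). An odd number of them is true, hence an even number of
      \<open>x1\<close>, \<open>x2\<close>, \<open>x3\<close>.\<close>
    let ?G = "indicator Rs 3 (iota3 6 3 4 2 5 1 0 7)"
    have "U_Max_Ones {R_IL2} \<le>\<^sub>C\<^sub>V U_Max_Ones (set Rs)"
    proof (rule cv_reducible_exact[OF R_IL2_simps(2) Rs])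
      show "gok Rs (fst R_IL2) ?G"
        by (rule gok_iota3) (simp add: R_IL2_simps)
      show "gsat Rs ?G (\<lambda>j. (t @ [b]) ! j) \<longleftrightarrow> t \<in> snd R_IL2" if "length t = fst R_IL2" for t b
        using that unfolding gsat_iota3[OF Rs] table_iff[of "_ ! _"] idem_iff[OF m] R_IL2_simps(1)
        by (elim length_8_cases) (auto simp: R_IL2_simps n of_bool_def)
    qed
    then show ?thesis by blast
  next
    case 3
    then have m: "P3 False False False True False True True True \<longleftrightarrow> False"
      "P3 False True True False True False False True \<longleftrightarrow> False" by auto
    \<comment> \<open>Only projections are left: exactly one of the entries at (0,0,1), (0,1,0),
      (1,0,0) is true.\<close>
    let ?G = "indicator Rs 3 (iota3 6 0 1 5 2 4 3 7)"
    have "U_Max_Ones {R_II2} \<le>\<^sub>C\<^sub>V U_Max_Ones (set Rs)"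
    proof (rule cv_reducible_exact[OF R_II2_simps(2) Rs])
      show "gok Rs (fst R_II2) ?G"
        by (rule gok_iota3) (simp add: R_II2_simps)
      show "gsat Rs ?G (\<lambda>j. (t @ [b]) ! j) \<longleftrightarrow> t \<in> snd R_II2" if "length t = fst R_II2" for t b
        using that unfolding gsat_iota3[OF Rs] table_iff[of "_ ! _"] idem_iff[OF m] R_II2_simps(1)
        by (elim length_8_cases) (auto simp: R_II2_simps n)
    qed
    then show ?thesis by blast
  qed
qed

lemma negation_case:
  assumes n: "P2 True True False False"
  shows "U_Max_Ones {R_IN2} \<le>\<^sub>C\<^sub>V U_Max_Ones (set Rs) \<or> U_Max_Ones {R_IL3} \<le>\<^sub>C\<^sub>V U_Max_Ones (set Rs)"
proof (cases "P3 False True True False True False False True")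
  case True
  then have m: "P3 False False False True False True True True \<longleftrightarrow> False"
    "P3 False True True False True False False True \<longleftrightarrow> True" using neg_no_maj[OF n] by auto
  \<comment> \<open>The entry at (1,1,1) is \<open>x1\<close>, and \<open>x2\<close>,
    \<open>x3\<close>, \<open>x4\<close> sit at the arguments with a single 1. An idempotent table
    has \<open>x1\<close> true and an odd number of the others true; negation preserves evenness of
    the sum.\<close>
  let ?G = "indicator Rs 3 (iota3 4 1 2 7 3 6 5 0)"
  have "U_Max_Ones {R_IL3} \<le>\<^sub>C\<^sub>V U_Max_Ones (set Rs)"
  proof (rule cv_reducible_exact[OF R_IL3_simps(2) Rs])
    show "gok Rs (fst R_IL3) ?G"
      by (rule gok_iota3) (simp add: R_IL3_simps)
    show "gsat Rs ?G (\<lambda>j. (t @ [b]) ! j) \<longleftrightarrow> t \<in> snd R_IL3" if "length t = fst R_IL3" for t b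
      using that unfolding gsat_iota3[OF Rs] table_iff[of "_ ! _"] idem_iff[OF m] R_IL3_simps(1)
      by (elim length_8_cases) (auto simp: R_IL3_simps n of_bool_def)
  qed
  then show ?thesis by blast
next
  case False
  then have m: "P3 False False False True False True True True \<longleftrightarrow> False"
    "P3 False True True False True False False True \<longleftrightarrow> False" using neg_no_maj[OF n] by auto
  \<comment> \<open>The coordinates \<open>x1\<close> to \<open>x4\<close> list f(0,y,z). Of the
    eight even tuples the last condition of \<open>R_IN2\<close> excludes exclusive or and its
    negation, which leaves the projections and their negations.\<close>
  let ?G = "indicator Rs 3 (iota3 0 1 2 3 7 6 5 4)"
  have "U_Max_Ones {R_IN2} \<le>\<^sub>C\<^sub>V U_Max_Ones (set Rs)"
  proof (rule cv_reducible_exact[OF R_IN2_simps(2) Rs])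
    show "gok Rs (fst R_IN2) ?G"
      by (rule gok_iota3) (simp add: R_IN2_simps)
    show "gsat Rs ?G (\<lambda>j. (t @ [b]) ! j) \<longleftrightarrow> t \<in> snd R_IN2" if "length t = fst R_IN2" for t b
      using that unfolding gsat_iota3[OF Rs] table_iff[of "_ ! _"] idem_iff[OF m] R_IN2_simps(1)
      by (elim length_8_cases) (auto simp: R_IN2_simps n of_bool_def)
  qed
  then show ?thesis by blast
qed

end

lemma intractable_reducible:
  "\<exists>R\<in>{R_IS2_1, R_II2, R_IN2, R_IL0, R_IL2, R_IL3, R_ID2}. U_Max_Ones {R} \<le>\<^sub>C\<^sub>V U_Max_Ones (set Rs)"
  using and_case zero_case idempotent_case negation_case by blast

end

section \<open>The tractable cases\<close>

subsection \<open>Propagation of forced literals\<close>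

lemma fp_comp2:
  assumes "fp (\<lambda>p. h (fst p) (snd p))" "fp f" "fp g"
  shows "fp (\<lambda>e. h (f e) (g e))"
  using fp_comp[OF fp_pair[OF assms(2,3)] assms(1)] by simp

text \<open>A literal \<open>(v, b)\<close> stands for the requirement that the variable \<open>v\<close> takes the value \<open>b\<close>.\<close>

type_synonym lits = "(nat \<times> bool) list"

definition compatible :: "lits \<Rightarrow> nat list \<Rightarrow> bool list \<Rightarrow> bool" where
  "compatible F us t \<longleftrightarrow> (\<forall>q\<in>set (zip us t). \<not> (\<exists>p\<in>set F. fst p = fst q \<and> snd p = (\<not> snd q)))"

definition ctuples :: "bool list list list \<Rightarrow> lits \<Rightarrow> nat \<times> nat list \<Rightarrow> bool list list" where
  "ctuples Ts F d = filter (\<lambda>t. compatible F (snd d) t) (nthd [] Ts (fst d))"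

definition positions :: "nat list \<Rightarrow> (nat \<times> bool) list" where
  "positions us = concat (map (\<lambda>j. [(j, False), (j, True)]) [0..<length us])"

text \<open>If no tuple is compatible, both literals of every position are forced; the contradiction
  is left to \<open>feasible\<close>.\<close>

definition forced :: "bool list list list \<Rightarrow> lits \<Rightarrow> nat \<times> nat list \<Rightarrow> lits" where
  "forced Ts F d = map (\<lambda>x. (nthd 0 (snd d) (fst x), snd x))
     (filter (\<lambda>x. \<forall>t\<in>set (ctuples Ts F d). nthd False t (fst x) = snd x) (positions (snd d)))"

definition propagate :: "bool list list list \<Rightarrow> (nat \<times> nat list) list \<Rightarrow> lits \<Rightarrow> lits" where
  "propagate Ts ds F = concat (map (\<lambda>d. forced Ts F d) ds) @ F"

text \<open>There are \<open>n + n\<close> literals over \<open>n\<close> variables, so this many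
  rounds exhaust them as a set.\<close>

definition closure :: "bool list list list \<Rightarrow> nat \<Rightarrow> (nat \<times> nat list) list \<Rightarrow> lits \<Rightarrow> lits" where
  "closure Ts n ds F = ((\<lambda>F. propagate Ts ds F) ^^ (n + n)) F"

text \<open>An upper bound on the weight of every consistent solution: undecided variables are
  counted as true.\<close>

definition score :: "nat \<Rightarrow> lits \<Rightarrow> nat" where
  "score n F = length (filter (\<lambda>v. \<not> (\<exists>p\<in>set F. fst p = v \<and> \<not> snd p)) [0..<n])"

definition feasible :: "bool list list list \<Rightarrow> (nat \<times> nat list) list \<Rightarrow> lits \<Rightarrow> bool" where
  "feasible Ts ds F \<longleftrightarrow> (\<forall>d\<in>set ds. \<not> ctuples Ts F d = [])"

definition branch :: "bool list list list \<Rightarrow> nat \<Rightarrow> (nat \<times> nat list) list \<Rightarrow> nat \<Rightarrow> lits \<Rightarrow> lits" where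
  "branch Ts n ds v F = (if \<exists>p\<in>set F. fst p = v then F
     else if score n (closure Ts n ds ((v, False) # F)) \<le> score n (closure Ts n ds ((v, True) # F))
     then closure Ts n ds ((v, True) # F) else closure Ts n ds ((v, False) # F))"

definition greedy :: "bool list list list \<Rightarrow> nat \<Rightarrow> (nat \<times> nat list) list \<Rightarrow> lits" where
  "greedy Ts n ds = fold (\<lambda>v F. branch Ts n ds v F) [0..<n] (closure Ts n ds [])"

definition accepts :: "bool list list list \<Rightarrow> pinst \<Rightarrow> lits \<Rightarrow> bool" where
  "accepts Ts P F \<longleftrightarrow> feasible Ts (snd (snd P)) F \<and> bval (fst (snd P)) \<le> score (fst P) F"

lemma fp_ctuples: "fp (\<lambda>p. ctuples Ts (fst p) (snd p))"
  unfolding ctuples_def compatible_def by (intro fp_intros)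

lemma fp_positions: "fp f \<Longrightarrow> fp (\<lambda>e. positions (f e))"
  unfolding positions_def by (intro fp_intros)

lemma fp_forced: "fp (\<lambda>p. forced Ts (fst p) (snd p))"
  unfolding forced_def by (intro fp_intros fp_positions fp_comp2[OF fp_ctuples])

lemma fp_propagate: "fp (\<lambda>p. propagate Ts (fst p) (snd p))"
  unfolding propagate_def by (intro fp_intros fp_comp2[OF fp_forced])

lemma vs_append_eq: "Suc (vs (xs @ ys)) = vs xs + vs ys"
  by (induction xs) auto

lemma vs_filter: "vs (map f (filter P l)) \<le> vs (map f l)"
  by (induction l) auto

lemma vs_concat_mono:
  assumes "\<And>x. x \<in> set l \<Longrightarrow> vs (f x) \<le> vs (g x)"
  shows "vs (concat (map f l)) \<le> vs (concat (map g l))"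
  using assms
proof (induction l)
  case (Cons x l)
  then have "vs (f x) \<le> vs (g x)" "vs (concat (map f l)) \<le> vs (concat (map g l))" by auto
  then show ?case
    using vs_append_eq[of "f x" "concat (map f l)"] vs_append_eq[of "g x" "concat (map g l)"] by simp
qed simp

definition all_lits :: "(nat \<times> nat list) list \<Rightarrow> lits" where
  "all_lits ds = concat (map (\<lambda>d. map (\<lambda>x. (nthd 0 (snd d) (fst x), snd x)) (positions (snd d))) ds)"

lemma fp_all_lits: "fp f \<Longrightarrow> fp (\<lambda>e. all_lits (f e))"
  unfolding all_lits_def by (intro fp_intros fp_positions)

text \<open>The increase does not depend on \<open>F\<close>, so iteration stays polynomial although
  repeated literals are never removed.\<close>

lemma vs_propagate: "vs (propagate Ts ds F) \<le> vs F + vs (all_lits ds)"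
proof -
  have "vs (concat (map (\<lambda>d. forced Ts F d) ds)) \<le> vs (all_lits ds)"
    unfolding all_lits_def by (rule vs_concat_mono) (auto simp: forced_def intro: vs_filter)
  then show ?thesis
    using vs_append[of "concat (map (\<lambda>d. forced Ts F d) ds)" F] unfolding propagate_def by linarith
qed

lemma vs_closure: "vs (closure Ts n ds F) \<le> vs F + (n + n) * vs (all_lits ds)"
proof -
  have "vs (((\<lambda>F. propagate Ts ds F) ^^ k) F) \<le> vs F + k * vs (all_lits ds)" for k
  proof (induction k)
    case (Suc k)
    then show ?case
      using vs_propagate[of Ts ds "((\<lambda>F. propagate Ts ds F) ^^ k) F"] by simp
  qed simp
  then show ?thesis unfolding closure_def .
qed

lemma fp_closure: "fp (\<lambda>p. closure Ts (fst (fst p)) (snd (fst p)) (snd p))"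
  unfolding closure_def
proof (rule fp_funpow[where G = "\<lambda>p. vs (all_lits (snd (fst p)))"])
  show "fp (\<lambda>p. propagate Ts (snd (fst (snd p))) (fst p))"
    by (intro fp_intros fp_comp2[OF fp_propagate])
qed (intro fp_intros pbd_intros fp_size fp_all_lits vs_propagate)+

lemma fp_score: "fp (\<lambda>p. score (fst p) (snd p))"
  unfolding score_def by (intro fp_intros)

lemma fp_closure':
  assumes "fp n" "fp ds" "fp F" shows "fp (\<lambda>e. closure Ts (n e) (ds e) (F e))"
  using fp_comp2[OF fp_closure fp_pair[OF assms(1,2)] assms(3)] by simp

lemma fp_greedy: "fp (\<lambda>p. greedy Ts (fst p) (snd p))"
  unfolding greedy_def
proof (rule fp_fold[where G = "\<lambda>p. 5 + vs (fst p) + (fst p + fst p) * vs (all_lits (snd p))"])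
  show "fp (\<lambda>q. branch Ts (fst (snd (snd q))) (snd (snd (snd q))) (fst q) (fst (snd q)))"
    unfolding branch_def by (intro fp_intros fp_closure' fp_comp2[OF fp_score])
  show "pbd (\<lambda>p. 5 + vs (fst p) + (fst p + fst p) * vs (all_lits (snd p)))"
  proof (rule pbd_mono)
    show "pbd (\<lambda>p. 5 + vs (fst p) + (vs (fst p) + vs (fst p)) * vs (all_lits (snd p)))"
      by (intro pbd_intros fp_size fp_intros fp_all_lits)
  qed (intro add_mono mult_right_mono order.refl, auto simp: vs_nat)
  show "vs (branch Ts (fst p) (snd p) v F) \<le> vs F + (5 + vs (fst p) + (fst p + fst p) * vs (all_lits (snd p)))"
    if "v \<in> set [0..<fst p]" for v F p
  proof -
    have "vs (closure Ts (fst p) (snd p) ((v, b) # F)) \<le>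
        vs F + (5 + vs (fst p) + (fst p + fst p) * vs (all_lits (snd p)))" for b
    proof -
      have "vs ((v, b) # F) \<le> vs F + (5 + vs (fst p))"
        using that vs_bool[of b] by (simp add: vs_nat)
      then show ?thesis using vs_closure[of Ts "fst p" "snd p" "(v, b) # F"] by linarith
    qed
    then show ?thesis unfolding branch_def by auto
  qed
qed (intro fp_intros fp_closure')+

lemma fp_accepts:
  assumes "fp P" "fp F" shows "fp (\<lambda>e. accepts Ts (P e) (F e))"
proof (rule fp_comp2[OF _ assms])
  show "fp (\<lambda>p. accepts Ts (fst p) (snd p))"
    unfolding accepts_def feasible_def
    by (intro fp_intros fp_comp2[OF fp_ctuples] fp_comp2[OF fp_score])
qed

text \<open>The constraints \<open>ds\<close> over the variables \<open>{..<n}\<close>, with the tuples of the relations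
  listed in \<open>Ts\<close>.\<close>

locale constraint_network =
  fixes Ts :: "bool list list list" and n :: nat and ds :: "(nat \<times> nat list) list"
  assumes ds: "\<And>d. d \<in> set ds \<Longrightarrow> fst d < length Ts \<and> set (snd d) \<subseteq> {..<n}"
    and Ts: "\<And>d t. d \<in> set ds \<Longrightarrow> t \<in> set (Ts ! fst d) \<Longrightarrow> length t = length (snd d)"
begin

definition sol :: "(nat \<Rightarrow> bool) \<Rightarrow> bool" where
  "sol h \<longleftrightarrow> (\<forall>d\<in>set ds. map h (snd d) \<in> set (Ts ! fst d))"

definition consistent :: "(nat \<Rightarrow> bool) \<Rightarrow> lits \<Rightarrow> bool" where
  "consistent h F \<longleftrightarrow> (\<forall>p\<in>set F. h (fst p) = snd p)"

definition closed :: "lits \<Rightarrow> bool" where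
  "closed F \<longleftrightarrow> (\<forall>d\<in>set ds. set (forced Ts F d) \<subseteq> set F)"

definition decided :: "lits \<Rightarrow> nat \<Rightarrow> bool" where
  "decided F v \<longleftrightarrow> (\<exists>p\<in>set F. fst p = v)"

lemma ctuples_iff:
  assumes "d \<in> set ds"
  shows "t \<in> set (ctuples Ts F d) \<longleftrightarrow>
    t \<in> set (Ts ! fst d) \<and> (\<forall>j<length (snd d). (snd d ! j, \<not> t ! j) \<notin> set F)"
proof -
  have e: "(\<exists>p\<in>set F. fst p = a \<and> snd p = b) \<longleftrightarrow> (a, b) \<in> set F" for a b
    by (auto intro: bexI[of _ "(a, b)"])
  have "compatible F (snd d) t \<longleftrightarrow> (\<forall>j<length (snd d). (snd d ! j, \<not> t ! j) \<notin> set F)"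
    if "t \<in> set (Ts ! fst d)"
    using Ts[OF assms that] unfolding compatible_def e by (auto simp: set_zip)
  then show ?thesis
    using ds[OF assms] by (auto simp: ctuples_def nthd_eq)
qed

lemma forced_iff:
  assumes "d \<in> set ds"
  shows "(v, b) \<in> set (forced Ts F d) \<longleftrightarrow>
    (\<exists>j<length (snd d). v = snd d ! j \<and> (\<forall>t\<in>set (ctuples Ts F d). t ! j = b))"
proof -
  have p: "x \<in> set (positions us) \<longleftrightarrow> fst x < length us" for x us
    by (cases x; cases "snd x") (auto simp: positions_def)
  have n: "nthd False t j = t ! j" if "j < length (snd d)" "t \<in> set (ctuples Ts F d)" for t j
    using that Ts[OF assms] ctuples_iff[OF assms, of t F] by (simp add: nthd_eq)
  show ?thesis
    by (auto simp: forced_def p nthd_eq[of 0] n image_iff)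
qed

lemma forced_vars: "d \<in> set ds \<Longrightarrow> set (forced Ts F d) \<subseteq> {..<n} \<times> UNIV"
  using ds[of d] by (auto simp: forced_iff) (meson lessThan_iff nth_mem subset_iff)

lemma set_propagate: "set (propagate Ts ds F) = (\<Union>d\<in>set ds. set (forced Ts F d)) \<union> set F"
  by (auto simp: propagate_def)

lemma forced_cong:
  assumes "set F = set G" "d \<in> set ds"
  shows "set (forced Ts F d) = set (forced Ts G d)"
proof -
  have "set (ctuples Ts F d) = set (ctuples Ts G d)"
    using assms by (auto simp: ctuples_iff)
  then have "x \<in> set (forced Ts F d) \<longleftrightarrow> x \<in> set (forced Ts G d)" for x
    using assms(2) by (cases x) (simp only: forced_iff)
  then show ?thesis by blast
qed

lemma closed_cong:
  assumes "set F = set G" shows "closed F \<longleftrightarrow> closed G"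
  unfolding closed_def by (rule ball_cong[OF refl]) (simp only: forced_cong[OF assms] assms)

lemma closed_closure:
  assumes "set F \<subseteq> {..<n} \<times> UNIV"
  shows "closed (closure Ts n ds F)" "set (closure Ts n ds F) \<subseteq> {..<n} \<times> UNIV" "set F \<subseteq> set (closure Ts n ds F)"
proof -
  let ?F = "\<lambda>k. ((\<lambda>F. propagate Ts ds F) ^^ k) F"
  have vars: "set (?F k) \<subseteq> {..<n} \<times> UNIV" for k
  proof (induction k)
    case (Suc k)
    then show ?case
      using forced_vars unfolding funpow.simps comp_apply set_propagate by blast
  qed (use assms in simp)
  have sub: "set F \<subseteq> set (?F k)" for k
    by (induction k) (auto simp: set_propagate)
  have fin: "finite ({..<n} \<times> (UNIV :: bool set))" by simp
  have "closed (?F k) \<or> k \<le> card (set (?F k))" for k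
  proof (induction k)
    case (Suc k)
    show ?case
    proof (cases "closed (?F k)")
      case True
      then have "set (?F (Suc k)) = set (?F k)"
        unfolding funpow.simps comp_apply set_propagate closed_def by blast
      with True show ?thesis using closed_cong by blast
    next
      case False
      then have "set (?F k) \<subset> set (?F (Suc k))"
        unfolding funpow.simps comp_apply set_propagate closed_def by blast
      then have "card (set (?F k)) < card (set (?F (Suc k)))" by (intro psubset_card_mono) auto
      with False Suc show ?thesis by simp
    qed
  qed simp
  from this[of "n + n"] show "closed (closure Ts n ds F)"
  proof
    \<comment> \<open>With this many elements every literal is present and nothing can be
      added.\<close>
    assume "n + n \<le> card (set (?F (n + n)))"
    moreover have "card ({..<n} \<times> (UNIV :: bool set)) = n + n"
      by (simp add: card_cartesian_product)
    ultimately have "set (?F (n + n)) = {..<n} \<times> UNIV"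
      using vars card_seteq[OF fin] by simp
    then show ?thesis using forced_vars unfolding closed_def closure_def by blast
  qed (simp add: closure_def)
  show "set (closure Ts n ds F) \<subseteq> {..<n} \<times> UNIV" "set F \<subseteq> set (closure Ts n ds F)"
    using vars sub unfolding closure_def by blast+
qed

lemma sol_ctuples:
  assumes "sol h" "consistent h F" "d \<in> set ds"
  shows "map h (snd d) \<in> set (ctuples Ts F d)"
  using assms unfolding ctuples_iff[OF assms(3)] sol_def consistent_def by fastforce

lemma consistent_closure:
  assumes "sol h" "consistent h F" shows "consistent h (closure Ts n ds F)"
proof -
  have "consistent h (((\<lambda>F. propagate Ts ds F) ^^ k) F)" for k
  proof (induction k)
    case (Suc k)
    let ?F = "((\<lambda>F. propagate Ts ds F) ^^ k) F"
    have "h v = b" if "d \<in> set ds" "(v, b) \<in> set (forced Ts ?F d)" for v b d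
      using that sol_ctuples[OF assms(1) Suc that(1)] by (fastforce simp: forced_iff)
    then show ?case using Suc by (auto simp: consistent_def set_propagate)
  qed (use assms in simp)
  then show ?thesis by (simp add: closure_def)
qed

lemma score_eq: "score n F = card {v. v < n \<and> (v, False) \<notin> set F}"
proof -
  have "score n F = card (set (filter (\<lambda>v. \<not> (\<exists>p\<in>set F. fst p = v \<and> \<not> snd p)) [0..<n]))"
    unfolding score_def by (rule distinct_card[symmetric]) simp
  also have "set (filter (\<lambda>v. \<not> (\<exists>p\<in>set F. fst p = v \<and> \<not> snd p)) [0..<n]) = {v. v < n \<and> (v, False) \<notin> set F}"
  proof -
    have "(\<exists>p\<in>set F. fst p = v \<and> \<not> snd p) \<longleftrightarrow> (v, False) \<in> set F" for v
      by (auto intro: bexI[of _ "(v, False)"])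
    then show ?thesis by auto
  qed
  finally show ?thesis .
qed

lemma sol_feasible: "sol h \<Longrightarrow> consistent h F \<Longrightarrow> feasible Ts ds F"
  unfolding feasible_def using sol_ctuples by fastforce

lemma sol_score: "consistent h F \<Longrightarrow> card {v. v < n \<and> h v} \<le> score n F"
  unfolding score_eq by (intro card_mono) (auto simp: consistent_def)

subsection \<open>Languages closed under a constant or under disjunction\<close>

lemma or_closed_list:
  assumes "\<And>t u. t \<in> S \<Longrightarrow> u \<in> S \<Longrightarrow> map (\<lambda>j. t ! j \<or> u ! j) [0..<k] \<in> S"
    and "\<And>t. t \<in> S \<Longrightarrow> length t = k" "ts \<noteq> []" "set ts \<subseteq> S"
  shows "map (\<lambda>j. \<exists>t\<in>set ts. t ! j) [0..<k] \<in> S"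
  using assms(3,4)
proof (induction ts rule: list_nonempty_induct)
  case (single t)
  then have "map (\<lambda>j. \<exists>t\<in>set [t]. t ! j) [0..<k] = t"
    using assms(2)[of t] by (auto intro!: nth_equalityI)
  then show ?case using single by simp
next
  case (cons t ts)
  have "map (\<lambda>j. t ! j \<or> map (\<lambda>j. \<exists>t\<in>set ts. t ! j) [0..<k] ! j) [0..<k] \<in> S"
    using cons by (intro assms(1)) auto
  also have "map (\<lambda>j. t ! j \<or> map (\<lambda>j. \<exists>t\<in>set ts. t ! j) [0..<k] ! j) [0..<k] =
      map (\<lambda>j. \<exists>t\<in>set (t # ts). t ! j) [0..<k]"
    by auto
  finally show ?case .
qed

text \<open>In each constraint the disjunction of all compatible tuples is false exactly where
  \<open>False\<close> is forced. Hence making true all variables that are not forced to be false is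
  a solution, and its weight attains the upper bound \<open>score\<close>.\<close>

lemma or_closed_correct:
  assumes "\<And>d t u. d \<in> set ds \<Longrightarrow> t \<in> set (Ts ! fst d) \<Longrightarrow> u \<in> set (Ts ! fst d) \<Longrightarrow>
      map (\<lambda>j. t ! j \<or> u ! j) [0..<length (snd d)] \<in> set (Ts ! fst d)"
  shows "(\<exists>h. sol h \<and> k \<le> card {v. v < n \<and> h v}) \<longleftrightarrow>
    feasible Ts ds (closure Ts n ds []) \<and> k \<le> score n (closure Ts n ds [])" (is "?l \<longleftrightarrow> ?r")
proof
  let ?F = "closure Ts n ds []"
  assume ?l
  then obtain h where h: "sol h" "k \<le> card {v. v < n \<and> h v}" by blast
  then have "consistent h ?F" using consistent_closure[of h "[]"] by (simp add: consistent_def)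
  then show ?r using h sol_feasible sol_score le_trans by blast
next
  let ?F = "closure Ts n ds []"
  let ?h = "\<lambda>v. (v, False) \<notin> set ?F"
  assume r: ?r
  have "map ?h (snd d) \<in> set (Ts ! fst d)" if d: "d \<in> set ds" for d
  proof -
    let ?ts = "ctuples Ts ?F d"
    have "map (\<lambda>j. \<exists>t\<in>set ?ts. t ! j) [0..<length (snd d)] \<in> set (Ts ! fst d)"
      using r d assms[OF d] Ts[OF d] ctuples_iff[OF d]
      by (intro or_closed_list) (auto simp: feasible_def)
    also have "map (\<lambda>j. \<exists>t\<in>set ?ts. t ! j) [0..<length (snd d)] = map ?h (snd d)"
    proof (rule nth_equalityI)
      fix j assume "j < length (map (\<lambda>j. \<exists>t\<in>set ?ts. t ! j) [0..<length (snd d)])"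
      then have j: "j < length (snd d)" by simp
      have "(\<exists>t\<in>set ?ts. t ! j) \<longleftrightarrow> (snd d ! j, False) \<notin> set ?F"
      proof
        assume "\<exists>t\<in>set ?ts. t ! j"
        then obtain t where t: "t \<in> set ?ts" "t ! j" by blast
        then have "(snd d ! j, \<not> t ! j) \<notin> set ?F"
          using j ctuples_iff[OF d] by blast
        with t(2) show "(snd d ! j, False) \<notin> set ?F" by simp
      next
        assume "(snd d ! j, False) \<notin> set ?F"
        then have "(snd d ! j, False) \<notin> set (forced Ts ?F d)"
          using closed_closure(1)[of "[]"] d by (auto simp: closed_def)
        then show "\<exists>t\<in>set ?ts. t ! j" using j d unfolding forced_iff[OF d] by blast
      qed
      then show "map (\<lambda>j. \<exists>t\<in>set ?ts. t ! j) [0..<length (snd d)] ! j = map ?h (snd d) ! j"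
        using j by simp
    qed simp
    finally show ?thesis .
  qed
  then have "sol ?h" by (simp add: sol_def)
  then show ?l using r unfolding score_eq by blast
qed

lemma one_closed_correct:
  assumes "\<And>d t. d \<in> set ds \<Longrightarrow> t \<in> set (Ts ! fst d) \<Longrightarrow> replicate (length (snd d)) True \<in> set (Ts ! fst d)"
  shows "(\<exists>h. sol h \<and> k \<le> card {v. v < n \<and> h v}) \<longleftrightarrow>
    feasible Ts ds (closure Ts n ds []) \<and> k \<le> score n (closure Ts n ds [])" (is "?l \<longleftrightarrow> ?r")
proof
  let ?F = "closure Ts n ds []"
  assume ?l
  then obtain h where h: "sol h" "k \<le> card {v. v < n \<and> h v}" by blast
  then have "consistent h ?F" using consistent_closure[of h "[]"] by (simp add: consistent_def)
  then show ?r using h sol_feasible sol_score le_trans by blast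
next
  let ?F = "closure Ts n ds []"
  assume r: ?r
  have "map (\<lambda>_. True) (snd d) \<in> set (Ts ! fst d)" if d: "d \<in> set ds" for d
  proof -
    have "ctuples Ts ?F d \<noteq> []" using r d by (auto simp: feasible_def)
    then obtain t where "t \<in> set (ctuples Ts ?F d)" by (metis list.set_sel(1))
    then have "t \<in> set (Ts ! fst d)" using ctuples_iff[OF d] by blast
    from assms[OF d this] show ?thesis by (simp add: map_replicate_const)
  qed
  then have "sol (\<lambda>_. True)" by (simp add: sol_def)
  moreover have "score n ?F \<le> card {v. v < n \<and> True}"
    unfolding score_eq by (intro card_mono) auto
  ultimately show ?l using r le_trans by (intro exI[of _ "\<lambda>_. True"]) auto
qed

subsection \<open>Languages closed under majority and minority\<close>

text \<open>Induction on the set of coordinates: for three of them take tuples that agree with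
  \<open>u\<close> except possibly at one of the three each. Everywhere at least two of the tuples
  agree with \<open>u\<close>, and so does their majority.\<close>

lemma baker_pixley:
  fixes S :: "bool list set"
  assumes maj: "\<And>t u w. t \<in> S \<Longrightarrow> u \<in> S \<Longrightarrow> w \<in> S \<Longrightarrow>
      map (\<lambda>j. (t ! j \<and> u ! j) \<or> (t ! j \<and> w ! j) \<or> (u ! j \<and> w ! j)) [0..<k] \<in> S"
    and len: "\<And>t. t \<in> S \<Longrightarrow> length t = k" "length u = k" and ne: "S \<noteq> {}"
    and pairs: "\<And>i j. i < k \<Longrightarrow> j < k \<Longrightarrow> \<exists>t\<in>S. t ! i = u ! i \<and> t ! j = u ! j"
  shows "u \<in> S"
proof -
  have "\<exists>t\<in>S. \<forall>i\<in>I. t ! i = u ! i" if "I \<subseteq> {..<k}" for I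
    using that
  proof (induction "card I" arbitrary: I rule: less_induct)
    case less
    have fin: "finite I" using less.prems finite_subset by blast
    show ?case
    proof (cases "\<exists>i1 i2 i3. i1 \<in> I \<and> i2 \<in> I \<and> i3 \<in> I \<and> i1 \<noteq> i2 \<and> i1 \<noteq> i3 \<and> i2 \<noteq> i3")
      case True
      then obtain i1 i2 i3 where i: "i1 \<in> I" "i2 \<in> I" "i3 \<in> I" "i1 \<noteq> i2" "i1 \<noteq> i3" "i2 \<noteq> i3"
        by blast
      have ex: "\<exists>t\<in>S. \<forall>i\<in>I - {x}. t ! i = u ! i" if "x \<in> I" for x
      proof (rule less.hyps)
        show "card (I - {x}) < card I" using that fin by (rule card_Diff1_less[rotated])
        show "I - {x} \<subseteq> {..<k}" using less.prems by blast
      qed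
      obtain t1 t2 t3 where t: "t1 \<in> S" "t2 \<in> S" "t3 \<in> S" "\<forall>i\<in>I - {i1}. t1 ! i = u ! i"
          "\<forall>i\<in>I - {i2}. t2 ! i = u ! i" "\<forall>i\<in>I - {i3}. t3 ! i = u ! i"
        using ex[OF i(1)] ex[OF i(2)] ex[OF i(3)] by blast
      let ?m = "map (\<lambda>j. (t1 ! j \<and> t2 ! j) \<or> (t1 ! j \<and> t3 ! j) \<or> (t2 ! j \<and> t3 ! j)) [0..<k]"
      have "?m ! x = u ! x" if x: "x \<in> I" for x
      proof -
        have "x < k" using x less.prems by auto
        moreover have "t1 ! x = u ! x \<and> t2 ! x = u ! x \<or> t1 ! x = u ! x \<and> t3 ! x = u ! x \<or>
            t2 ! x = u ! x \<and> t3 ! x = u ! x"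
          using t(4-6) i(4-6) x by blast
        ultimately show ?thesis by auto
      qed
      moreover have "?m \<in> S" by (rule maj[OF t(1-3)])
      ultimately show ?thesis by blast
    next
      case False
      then obtain a b where "I \<subseteq> {a, b}" "I = {} \<or> a \<in> I \<and> b \<in> I"
        by blast
      with pairs[of a b] ne less.prems show ?thesis by blast
    qed
  qed
  from this[of "{..<k}"] obtain t where "t \<in> S" "\<forall>i<k. t ! i = u ! i" by auto
  moreover from this have "t = u" using len by (intro nth_equalityI) auto
  ultimately show ?thesis by simp
qed

definition flip_lit :: "lits \<Rightarrow> nat \<times> bool \<Rightarrow> nat \<times> bool" where
  "flip_lit F p = (fst p, if decided F (fst p) then snd p else \<not> snd p)"

definition flip_sol :: "lits \<Rightarrow> (nat \<Rightarrow> bool) \<Rightarrow> nat \<Rightarrow> bool" where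
  "flip_sol F h v = (if decided F v then h v else \<not> h v)"

definition flip_tuple :: "lits \<Rightarrow> nat list \<Rightarrow> bool list \<Rightarrow> bool list" where
  "flip_tuple F us t = map (\<lambda>j. if decided F (us ! j) then t ! j else \<not> t ! j) [0..<length us]"

lemma flip_lit_flip_lit [simp]: "flip_lit F (flip_lit F p) = p"
  by (simp add: flip_lit_def)

lemma decidedI: "(v, b) \<in> set F \<Longrightarrow> decided F v"
  by (auto simp: decided_def intro: bexI[of _ "(v, b)"])

lemma decidedE: "decided F v \<Longrightarrow> (\<And>b. (v, b) \<in> set F \<Longrightarrow> P) \<Longrightarrow> P"
  by (auto simp: decided_def)

lemma decided_mono: "decided F v \<Longrightarrow> set F \<subseteq> set G \<Longrightarrow> decided G v"
  by (auto simp: decided_def)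

lemma flip_lit_fixed: "p \<in> set F \<Longrightarrow> flip_lit F p = p"
  using decidedI[of "fst p" "snd p" F] by (simp add: flip_lit_def)

lemma ctuples_decided:
  assumes "d \<in> set ds" "t \<in> set (ctuples Ts F d)" "t' \<in> set (ctuples Ts F d)" "j < length (snd d)"
    "decided F (snd d ! j)"
  shows "t' ! j = t ! j"
proof -
  obtain b where b: "(snd d ! j, b) \<in> set F" using decidedE[OF assms(5)] by blast
  have "(snd d ! j, \<not> t ! j) \<notin> set F" "(snd d ! j, \<not> t' ! j) \<notin> set F"
    using assms(2-4) unfolding ctuples_iff[OF assms(1)] by blast+
  with b show ?thesis by (cases b; cases "t ! j"; cases "t' ! j") auto
qed

lemma ctuples_undecided:
  assumes "closed F" "d \<in> set ds" "j < length (snd d)" "\<not> decided F (snd d ! j)"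
  shows "\<exists>t\<in>set (ctuples Ts F d). t ! j = b"
proof (rule ccontr)
  assume "\<not> ?thesis"
  then have "(snd d ! j, \<not> b) \<in> set (forced Ts F d)"
    using assms(3) unfolding forced_iff[OF assms(2)] by auto
  then show False using assms(1,2,4) decidedI unfolding closed_def by blast
qed

context
  assumes maj: "\<And>d t u w. d \<in> set ds \<Longrightarrow> t \<in> set (Ts ! fst d) \<Longrightarrow> u \<in> set (Ts ! fst d) \<Longrightarrow> w \<in> set (Ts ! fst d) \<Longrightarrow>
      map (\<lambda>j. (t ! j \<and> u ! j) \<or> (t ! j \<and> w ! j) \<or> (u ! j \<and> w ! j)) [0..<length (snd d)] \<in> set (Ts ! fst d)"
    and minority: "\<And>d t u w. d \<in> set ds \<Longrightarrow> t \<in> set (Ts ! fst d) \<Longrightarrow> u \<in> set (Ts ! fst d) \<Longrightarrow> w \<in> set (Ts ! fst d) \<Longrightarrow>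
      map (\<lambda>j. (t ! j = (u ! j = w ! j))) [0..<length (snd d)] \<in> set (Ts ! fst d)"
begin

text \<open>Once \<open>F\<close> is closed, the undecided variables of a constraint are linked by equations and
  disequations only, so they can be flipped simultaneously.\<close>

lemma flip_tuple_ctuples:
  assumes F: "closed F" and d: "d \<in> set ds" and t: "t \<in> set (ctuples Ts F d)"
  shows "flip_tuple F (snd d) t \<in> set (ctuples Ts F d)"
proof -
  let ?k = "length (snd d)" and ?u = "flip_tuple F (snd d) t" and ?S = "set (Ts ! fst d)"
  have u: "?u ! j = (if decided F (snd d ! j) then t ! j else \<not> t ! j)" if "j < ?k" for j
    using that by (simp add: flip_tuple_def)
  have tS: "t \<in> ?S" using t ctuples_iff[OF d] by blast
  have ex: "\<exists>t'\<in>set (ctuples Ts F d). t' ! j = ?u ! j" if "j < ?k" for j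
    using ctuples_undecided[OF F d that] t u[OF that] by (cases "decided F (snd d ! j)") auto
  have "?u \<in> ?S"
  proof (rule baker_pixley[where k = ?k])
    fix i j assume ij: "i < ?k" "j < ?k"
    obtain t1 where t1: "t1 \<in> set (ctuples Ts F d)" "t1 ! i = ?u ! i" using ex[OF ij(1)] by blast
    obtain t2 where t2: "t2 \<in> set (ctuples Ts F d)" "t2 ! j = ?u ! j" using ex[OF ij(2)] by blast
    have S: "t1 \<in> ?S" "t2 \<in> ?S" using t1 t2 ctuples_iff[OF d] by blast+
    show "\<exists>t\<in>?S. t ! i = ?u ! i \<and> t ! j = ?u ! j"
    proof (cases "t1 ! j = ?u ! j \<or> t2 ! i = ?u ! i")
      case True
      then show ?thesis using t1(2) t2(2) S by blast
    next
      case False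
      have "\<not> decided F (snd d ! j)"
        using False ctuples_decided[OF d t t1(1) ij(2)] u[OF ij(2)] by auto
      moreover have "\<not> decided F (snd d ! i)"
        using False ctuples_decided[OF d t t2(1) ij(1)] u[OF ij(1)] by auto
      \<comment> \<open>At i the tuples \<open>t\<close> and \<open>t2\<close> both have the wrong
        value and cancel, which leaves \<open>t1\<close>; at j, \<open>t\<close> and
        \<open>t1\<close> cancel and leave \<open>t2\<close>.\<close>
      ultimately have "map (\<lambda>j. (t ! j = (t1 ! j = t2 ! j))) [0..<?k] ! i = ?u ! i"
          "map (\<lambda>j. (t ! j = (t1 ! j = t2 ! j))) [0..<?k] ! j = ?u ! j"
        using False t1(2) t2(2) ij u by auto
      then show ?thesis using minority[OF d tS S] by blast
    qed
  qed (use maj[OF d] Ts[OF d] tS in \<open>auto simp: flip_tuple_def\<close>)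
  moreover have "(snd d ! j, \<not> ?u ! j) \<notin> set F" if "j < ?k" for j
    using t that u[OF that] decidedI unfolding ctuples_iff[OF d] by (cases "decided F (snd d ! j)") auto
  ultimately show ?thesis unfolding ctuples_iff[OF d] by blast
qed

lemma flip_sol_sol:
  assumes "closed F" "sol h" "consistent h F"
  shows "sol (flip_sol F h)" "consistent (flip_sol F h) F"
proof -
  have "map (flip_sol F h) (snd d) \<in> set (Ts ! fst d)" if d: "d \<in> set ds" for d
  proof -
    have "flip_tuple F (snd d) (map h (snd d)) \<in> set (Ts ! fst d)"
      using flip_tuple_ctuples[OF assms(1) d sol_ctuples[OF assms(2,3) d]] ctuples_iff[OF d] by blast
    also have "flip_tuple F (snd d) (map h (snd d)) = map (flip_sol F h) (snd d)"
      by (rule nth_equalityI) (auto simp: flip_tuple_def flip_sol_def)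
    finally show ?thesis .
  qed
  then show "sol (flip_sol F h)" by (simp add: sol_def)
  show "consistent (flip_sol F h) F"
    using assms(3) by (auto simp: consistent_def flip_sol_def decided_def)
qed

text \<open>Flipping what \<open>F\<close> leaves undecided is a symmetry of the constraints. From
  here it is carried over to forced literals, propagation and closure; being an involution, it needs
  only one inclusion at each level.\<close>

lemma flip_ctuples_subset:
  assumes F: "closed F" and d: "d \<in> set ds" and G: "set F \<subseteq> set G" "set G' = flip_lit F ` set G"
    and t: "t \<in> set (ctuples Ts G d)"
  shows "flip_tuple F (snd d) t \<in> set (ctuples Ts G' d)"
proof -
  have "t \<in> set (ctuples Ts F d)" using t G(1) unfolding ctuples_iff[OF d] by blast
  from flip_tuple_ctuples[OF F d this] have S: "flip_tuple F (snd d) t \<in> set (Ts ! fst d)"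
    using ctuples_iff[OF d] by blast
  moreover have "(snd d ! j, \<not> flip_tuple F (snd d) t ! j) \<notin> set G'" if j: "j < length (snd d)" for j
  proof
    assume "(snd d ! j, \<not> flip_tuple F (snd d) t ! j) \<in> set G'"
    then obtain p where p: "p \<in> set G" "(snd d ! j, \<not> flip_tuple F (snd d) t ! j) = flip_lit F p"
      unfolding G(2) by blast
    then have "p = (snd d ! j, \<not> t ! j)"
      using j by (cases p) (auto simp: flip_lit_def flip_tuple_def split: if_splits)
    then show False using p(1) t j unfolding ctuples_iff[OF d] by blast
  qed
  ultimately show ?thesis unfolding ctuples_iff[OF d] by blast
qed

lemma flip_forced_subset:
  assumes F: "closed F" and d: "d \<in> set ds" and G: "set F \<subseteq> set G" "set G' = flip_lit F ` set G"
    and p: "p \<in> set (forced Ts G' d)"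
  shows "flip_lit F p \<in> set (forced Ts G d)"
proof -
  obtain v b where vb: "p = (v, b)" by (cases p)
  then obtain j where j: "j < length (snd d)" "v = snd d ! j" "\<forall>t\<in>set (ctuples Ts G' d). t ! j = b"
    using p unfolding vb forced_iff[OF d] by blast
  have "t ! j = (if decided F v then b else \<not> b)" if "t \<in> set (ctuples Ts G d)" for t
    using j(3) flip_ctuples_subset[OF F d G that] j(1,2)
    by (auto simp: flip_tuple_def split: if_splits)
  then show ?thesis
    using j(1,2) unfolding flip_lit_def vb fst_conv snd_conv forced_iff[OF d] by blast
qed

lemma flip_propagate:
  assumes F: "closed F" and G: "set F \<subseteq> set G" "set G' = flip_lit F ` set G"
  shows "set (propagate Ts ds G') = flip_lit F ` set (propagate Ts ds G)"
proof -
  have G': "set F \<subseteq> set G'"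
  proof
    fix p assume "p \<in> set F"
    then show "p \<in> set G'" using G flip_lit_fixed[of p F] by (metis image_eqI subsetD)
  qed
  have GG: "set G = flip_lit F ` set G'"
    unfolding G(2) by (auto simp: image_iff)
  have "flip_lit F p \<in> set (propagate Ts ds G)" if "p \<in> set (propagate Ts ds G')" for p
    using that flip_forced_subset[OF F _ G] GG unfolding set_propagate by blast
  moreover have "flip_lit F p \<in> set (propagate Ts ds G')" if "p \<in> set (propagate Ts ds G)" for p
    using that flip_forced_subset[OF F _ G' GG] G(2) unfolding set_propagate by blast
  ultimately show ?thesis
    by (auto simp: image_iff) (metis flip_lit_flip_lit)
qed

lemma flip_closure:
  assumes F: "closed F" and G: "set F \<subseteq> set G" "set G' = flip_lit F ` set G"
  shows "set (closure Ts n ds G') = flip_lit F ` set (closure Ts n ds G)"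
proof -
  let ?P = "\<lambda>F. propagate Ts ds F"
  have "set F \<subseteq> set ((?P ^^ k) G) \<and> set ((?P ^^ k) G') = flip_lit F ` set ((?P ^^ k) G)" for k
  proof (induction k)
    case (Suc k)
    then show ?case
      using flip_propagate[OF F, of "(?P ^^ k) G" "(?P ^^ k) G'"]
      unfolding funpow.simps comp_apply by (simp add: set_propagate[of "(?P ^^ k) G"] le_supI2)
  qed (use G in simp)
  then show ?thesis unfolding closure_def by blast
qed

text \<open>Weight and score differ by the undecided variables set to false. Solutions that agree on
  these can therefore be compared by score.\<close>

lemma card_sol_split:
  assumes "consistent h G"
  shows "card {v. v < n \<and> h v} + card {v. v < n \<and> \<not> decided G v \<and> \<not> h v} = score n G"
proof -
  have "{v. v < n \<and> (v, False) \<notin> set G} = {v. v < n \<and> h v} \<union> {v. v < n \<and> \<not> decided G v \<and> \<not> h v}"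
    using assms by (force simp: consistent_def decided_def)
  then show ?thesis
    unfolding score_eq by (simp add: card_Un_disjoint disjoint_iff)
qed

text \<open>If the chosen sign of \<open>v\<close> differs from that in \<open>h\<close>, flipping
  the variables decided by this choice alone gives another solution. The variables left undecided
  keep their values, so the weight changes by the difference of the two scores.\<close>

lemma branch_optimal:
  assumes F: "closed F" "set F \<subseteq> {..<n} \<times> UNIV" and v: "v < n"
    and h: "sol h" "consistent h F"
  shows "\<exists>h'. sol h' \<and> consistent h' (branch Ts n ds v F) \<and> card {v. v < n \<and> h v} \<le> card {v. v < n \<and> h' v}"
proof (cases "decided F v")
  case True
  then show ?thesis using h by (auto simp: branch_def decided_def)
next
  case False
  let ?C = "\<lambda>b. closure Ts n ds ((v, b) # F)"
  define b where "b = h v"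
  have sub: "set ((v, c) # F) \<subseteq> {..<n} \<times> UNIV" for c using F(2) v by auto
  have hb: "consistent h (?C b)"
    using h by (intro consistent_closure) (auto simp: consistent_def b_def)
  \<comment> \<open>As \<open>v\<close> is undecided in \<open>F\<close>, the flip exchanges its two
    literals and fixes \<open>F\<close>.\<close>
  have flip: "set (?C (\<not> b)) = flip_lit F ` set (?C b)"
  proof (rule flip_closure[OF F(1)])
    have "flip_lit F (v, b) = (v, \<not> b)" using False by (simp add: flip_lit_def)
    moreover have "flip_lit F ` set F = set F" using flip_lit_fixed by force
    ultimately show "set ((v, \<not> b) # F) = flip_lit F ` set ((v, b) # F)" by simp
  qed auto
  have dec: "decided (?C (\<not> b)) w \<longleftrightarrow> decided (?C b) w" for w
    unfolding decided_def flip by (auto simp: flip_lit_def)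
  have decF: "decided F w \<Longrightarrow> decided (?C c) w" for w c
    using closed_closure(3)[OF sub[of c]] by (auto simp: decided_def)
  let ?h1 = "flip_sol F h"
  have h1: "sol ?h1" by (rule flip_sol_sol[OF F(1) h])
  have c1: "consistent ?h1 (?C (\<not> b))"
    using hb unfolding consistent_def flip by (auto simp: flip_lit_def flip_sol_def)
  \<comment> \<open>The second flip restores \<open>h\<close> on all variables that the closure
    leaves undecided.\<close>
  let ?h2 = "flip_sol (?C (\<not> b)) ?h1"
  have h2: "sol ?h2" "consistent ?h2 (?C (\<not> b))"
    using flip_sol_sol[OF closed_closure(1)[OF sub] h1 c1] by auto
  have "\<not> decided (?C b) w \<Longrightarrow> ?h2 w = h w" for w
    using decF[of w b] by (auto simp: flip_sol_def dec)
  then have "{w. w < n \<and> \<not> decided (?C (\<not> b)) w \<and> \<not> ?h2 w} = {w. w < n \<and> \<not> decided (?C b) w \<and> \<not> h w}"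
    unfolding dec by auto
  from arg_cong[OF this, of card] have le: "card {v. v < n \<and> h v} \<le> card {v. v < n \<and> ?h2 v}" if "score n (?C b) \<le> score n (?C (\<not> b))"
    using that card_sol_split[OF hb] card_sol_split[OF h2(2)] by linarith
  have br: "branch Ts n ds v F = (if score n (?C False) \<le> score n (?C True) then ?C True else ?C False)"
    using False by (simp add: branch_def decided_def)
  show ?thesis
  proof (cases "branch Ts n ds v F = ?C b")
    case True
    then show ?thesis using h(1) hb by auto
  next
    case False
    then have "branch Ts n ds v F = ?C (\<not> b)" "score n (?C b) \<le> score n (?C (\<not> b))"
      unfolding br by (cases b; auto split: if_splits)+
    then show ?thesis using h2 le by auto
  qed
qed

lemma branch_props:
  assumes F: "closed F" "set F \<subseteq> {..<n} \<times> UNIV" and v: "v < n"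
  shows "closed (branch Ts n ds v F)" "set (branch Ts n ds v F) \<subseteq> {..<n} \<times> UNIV"
    "set F \<subseteq> set (branch Ts n ds v F)" "decided (branch Ts n ds v F) v"
proof -
  have sub: "set ((v, c) # F) \<subseteq> {..<n} \<times> UNIV" for c using F(2) v by auto
  note c = closed_closure[OF sub]
  show "closed (branch Ts n ds v F)" "set (branch Ts n ds v F) \<subseteq> {..<n} \<times> UNIV"
    unfolding branch_def using F c by auto
  have "set ((v, b) # F) \<subseteq> set (closure Ts n ds ((v, b) # F))" for b by (rule c(3))
  then show "set F \<subseteq> set (branch Ts n ds v F)" unfolding branch_def by auto
  have "decided (closure Ts n ds ((v, b) # F)) v" for b
    using c(3)[of b] by (intro decidedI[of v b]) auto
  then show "decided (branch Ts n ds v F) v"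
    unfolding branch_def by (simp add: decided_def[of F])
qed

lemma greedy_correct:
  "(\<exists>h. sol h \<and> k \<le> card {v. v < n \<and> h v}) \<longleftrightarrow>
    feasible Ts ds (greedy Ts n ds) \<and> k \<le> score n (greedy Ts n ds)" (is "?l \<longleftrightarrow> ?r")
proof -
  let ?F = "\<lambda>m. fold (\<lambda>v F. branch Ts n ds v F) [0..<m] (closure Ts n ds [])"
  have inv: "closed (?F m) \<and> set (?F m) \<subseteq> {..<n} \<times> UNIV \<and> (\<forall>v<m. decided (?F m) v)" if "m \<le> n" for m
    using that
  proof (induction m)
    case 0
    then show ?case using closed_closure[of "[]"] by simp
  next
    case (Suc m)
    then have IH: "closed (?F m)" "set (?F m) \<subseteq> {..<n} \<times> UNIV" "\<forall>v<m. decided (?F m) v" by auto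
    have e: "?F (Suc m) = branch Ts n ds m (?F m)" by simp
    note b = branch_props[OF IH(1,2), of m]
    have m: "m < n" using Suc.prems by simp
    have "decided (branch Ts n ds m (?F m)) v" if "v < Suc m" for v
    proof (cases "v = m")
      case True
      then show ?thesis using b(4)[OF m] by simp
    next
      case False
      then have "decided (?F m) v" using IH(3) that by simp
      then show ?thesis using b(3)[OF m] by (rule decided_mono)
    qed
    then show ?case using b(1,2)[OF m] unfolding e by blast
  qed
  have opt: "\<exists>h'. sol h' \<and> consistent h' (?F m) \<and> card {v. v < n \<and> h v} \<le> card {v. v < n \<and> h' v}"
    if "m \<le> n" "sol h" for m h
    using that
  proof (induction m)
    case 0
    then show ?case using consistent_closure[of h "[]"] by (auto simp: consistent_def)
  next
    case (Suc m)
    then obtain h' where h': "sol h'" "consistent h' (?F m)" "card {v. v < n \<and> h v} \<le> card {v. v < n \<and> h' v}"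
      by auto
    have "closed (?F m)" "set (?F m) \<subseteq> {..<n} \<times> UNIV" "m < n" using inv[of m] Suc.prems by auto
    from branch_optimal[OF this h'(1,2)] h'(3) show ?case by (auto intro: le_trans)
  qed
  show ?thesis
  proof
    assume ?l
    then obtain h where h: "sol h" "k \<le> card {v. v < n \<and> h v}" by blast
    obtain h' where "sol h'" "consistent h' (greedy Ts n ds)" "card {v. v < n \<and> h v} \<le> card {v. v < n \<and> h' v}"
      using opt[OF order.refl h(1)] unfolding greedy_def by blast
    then show ?r using h(2) sol_feasible sol_score[of h' "greedy Ts n ds"] by fastforce
  next
    assume r: ?r
    let ?G = "greedy Ts n ds"
    \<comment> \<open>All variables are decided now, so a compatible tuple of a constraint can only
      be the restriction of this assignment.\<close>
    let ?h = "\<lambda>v. (v, False) \<notin> set ?G"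
    have dec: "decided ?G v" if "v < n" for v using inv[of n] that by (simp add: greedy_def)
    have "map ?h (snd d) \<in> set (Ts ! fst d)" if d: "d \<in> set ds" for d
    proof -
      have "ctuples Ts ?G d \<noteq> []" using r d by (auto simp: feasible_def)
      then obtain t where t: "t \<in> set (ctuples Ts ?G d)" by (metis list.set_sel(1))
      have tS: "t \<in> set (Ts ! fst d)" using t ctuples_iff[OF d] by blast
      have "t ! j = ?h (snd d ! j)" if j: "j < length (snd d)" for j
      proof -
        have "snd d ! j < n" using ds[OF d] nth_mem[OF j] by blast
        from decidedE[OF dec[OF this]] obtain b where "(snd d ! j, b) \<in> set ?G" by blast
        moreover have "(snd d ! j, \<not> t ! j) \<notin> set ?G" using t j unfolding ctuples_iff[OF d] by blast
        ultimately show ?thesis by (cases b; cases "t ! j") auto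
      qed
      then have "map ?h (snd d) = t" using Ts[OF d tS] by (intro nth_equalityI) auto
      then show ?thesis using tS by simp
    qed
    then have "sol ?h" by (simp add: sol_def)
    then show ?l using r unfolding score_eq by blast
  qed
qed

end

end

subsection \<open>Tractable languages\<close>

lemma pol2D:
  assumes "pol2 \<Gamma> a b c d" "R \<in> \<Gamma>" "t \<in> snd R" "u \<in> snd R"
  shows "map (\<lambda>j. sel2 a b c d (t ! j) (u ! j)) [0..<fst R] \<in> snd R"
proof -
  have "length [t, u] = 2 \<and> set [t, u] \<subseteq> snd R" using assms by simp
  then have "map (\<lambda>j. sel2 a b c d (map (\<lambda>t. t ! j) [t, u] ! 0) (map (\<lambda>t. t ! j) [t, u] ! 1)) [0..<fst R] \<in> snd R"
    using assms(1,2) unfolding pol2_def pol_def by blast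
  then show ?thesis by simp
qed

lemma pol3D:
  assumes "pol3 \<Gamma> a b c d a' b' c' d'" "R \<in> \<Gamma>" "t \<in> snd R" "u \<in> snd R" "w \<in> snd R"
  shows "map (\<lambda>j. sel3 a b c d a' b' c' d' (t ! j) (u ! j) (w ! j)) [0..<fst R] \<in> snd R"
proof -
  have "length [t, u, w] = 3 \<and> set [t, u, w] \<subseteq> snd R" using assms by simp
  then have "map (\<lambda>j. sel3 a b c d a' b' c' d' (map (\<lambda>t. t ! j) [t, u, w] ! 0) (map (\<lambda>t. t ! j) [t, u, w] ! 1)
      (map (\<lambda>t. t ! j) [t, u, w] ! 2)) [0..<fst R] \<in> snd R"
    using assms(1,2) unfolding pol3_def pol_def by blast
  then show ?thesis by simp
qed

lemma weight_card: "weight I h = card {v. v < num_vars I \<and> h v}"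
  by (simp add: weight_def var_def Int_def lessThan_def)

lemma tractable_decidable:
  assumes Rs: "\<forall>R\<in>set Rs. boolean_relation R"
    and "pol2 (set Rs) True True True True \<or> pol2 (set Rs) False True True True \<or>
      pol3 (set Rs) False False False True False True True True \<and>
      pol3 (set Rs) False True True False True False False True"
  shows "\<exists>D. fp D \<and> (\<forall>J\<in>instances (set Rs). D (enc_inst J) \<longleftrightarrow> J \<in> snd (U_Max_Ones (set Rs)))"
proof -
  let ?Ts = "map tuples Rs" and ?P = "parse_inst Rs"
  let ?D = "\<lambda>A w. accepts ?Ts (?P w) (A (fst (?P w)) (snd (snd (?P w))))"
  \<comment> \<open>The three cases share the test \<open>accepts\<close> and differ only in the set
    \<open>A\<close> of literals to which it is applied.\<close>
  have dec: "\<exists>D. fp D \<and> (\<forall>J\<in>instances (set Rs). D (enc_inst J) \<longleftrightarrow> J \<in> snd (U_Max_Ones (set Rs)))"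
    if A: "fp (\<lambda>p. A (fst p) (snd p))"
      and correct: "\<And>n ds k. constraint_network ?Ts n ds \<Longrightarrow> \<forall>d\<in>set ds. fst d < length Rs \<and> length (snd d) = fst (Rs ! fst d) \<Longrightarrow>
        (\<exists>h. constraint_network.sol ?Ts ds h \<and> k \<le> card {v. v < n \<and> h v}) \<longleftrightarrow>
        feasible ?Ts ds (A n ds) \<and> k \<le> score n (A n ds)"
    for A
  proof (intro exI conjI ballI)
    show "fp (?D A)"
      by (intro fp_accepts fp_intros fp_comp2[OF A])
    fix J assume J: "J \<in> instances (set Rs)"
    obtain ds where ds: "?P (enc_inst J) = (num_vars J, bits (threshold J), ds)"
        "\<forall>d\<in>set ds. fst d < length Rs" "inst_cons Rs ds = constraints J"
      by (rule parse_inst_enc[OF Rs J])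
    have c: "length (snd d) = fst (Rs ! fst d) \<and> set (snd d) \<subseteq> {..<num_vars J}" if "d \<in> set ds" for d
    proof -
      have "(Rs ! fst d, snd d) \<in> set (constraints J)"
        unfolding ds(3)[symmetric] inst_cons_def using that by auto
      then show ?thesis using J by (auto simp: instances_def var_def)
    qed
    have T: "set (?Ts ! fst d) = snd (Rs ! fst d)" if "d \<in> set ds" for d
      using ds(2) Rs that by (simp add: set_tuples)
    have net: "constraint_network ?Ts (num_vars J) ds"
    proof
      show "fst d < length ?Ts \<and> set (snd d) \<subseteq> {..<num_vars J}" if "d \<in> set ds" for d
        using that c ds(2) by simp
      show "length t = length (snd d)" if "d \<in> set ds" "t \<in> set (?Ts ! fst d)" for d t
        using that c[OF that(1)] T[OF that(1)] ds(2) Rs by (auto simp: boolean_relation_def)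
    qed
    have "solution J h \<longleftrightarrow> constraint_network.sol ?Ts ds h" for h
      unfolding constraint_network.sol_def[OF net] solution_def ds(3)[symmetric] inst_cons_def
      using T by auto
    then show "?D A (enc_inst J) \<longleftrightarrow> J \<in> snd (U_Max_Ones (set Rs))"
      using correct[OF net, of "threshold J"] c ds(2) J
      by (simp add: ds(1) accepts_def U_Max_Ones_def weight_card flip: weight_def)
  qed
  have T: "set (?Ts ! fst d) = snd (Rs ! fst d)" "Rs ! fst d \<in> set Rs" if "fst d < length Rs" for d :: "nat \<times> nat list"
    using that Rs by (simp_all add: set_tuples)
  have cl: "fp (\<lambda>p. closure ?Ts (fst p) (snd p) [])"
    by (intro fp_closure' fp_intros)
  from assms(2) show ?thesis
  proof (elim disjE conjE)
    assume p: "pol2 (set Rs) True True True True"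
    show ?thesis
    proof (rule dec[OF cl])
      fix n k and ds :: "(nat \<times> nat list) list"
      assume net: "constraint_network ?Ts n ds" and d: "\<forall>d\<in>set ds. fst d < length Rs \<and> length (snd d) = fst (Rs ! fst d)"
      show "(\<exists>h. constraint_network.sol ?Ts ds h \<and> k \<le> card {v. v < n \<and> h v}) \<longleftrightarrow>
        feasible ?Ts ds (closure ?Ts n ds []) \<and> k \<le> score n (closure ?Ts n ds [])"
      proof (rule constraint_network.one_closed_correct[OF net])
        show "replicate (length (snd c)) True \<in> set (?Ts ! fst c)" if "c \<in> set ds" "t \<in> set (?Ts ! fst c)" for c t
          using that d T[of c] pol2D[OF p T(2)[of c], of t t] by (simp add: sel2_def map_replicate_const)
      qed
    qed
  next
    assume p: "pol2 (set Rs) False True True True"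
    have s: "sel2 False True True True x y = (x \<or> y)" for x y by (simp add: sel2_def)
    show ?thesis
    proof (rule dec[OF cl])
      fix n k and ds :: "(nat \<times> nat list) list"
      assume net: "constraint_network ?Ts n ds" and d: "\<forall>d\<in>set ds. fst d < length Rs \<and> length (snd d) = fst (Rs ! fst d)"
      show "(\<exists>h. constraint_network.sol ?Ts ds h \<and> k \<le> card {v. v < n \<and> h v}) \<longleftrightarrow>
        feasible ?Ts ds (closure ?Ts n ds []) \<and> k \<le> score n (closure ?Ts n ds [])"
      proof (rule constraint_network.or_closed_correct[OF net])
        show "map (\<lambda>j. t ! j \<or> u ! j) [0..<length (snd c)] \<in> set (?Ts ! fst c)"
          if "c \<in> set ds" "t \<in> set (?Ts ! fst c)" "u \<in> set (?Ts ! fst c)" for c t u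
          using that d T[of c] pol2D[OF p T(2)[of c], of t u] by (simp add: s)
      qed
    qed
  next
    assume p: "pol3 (set Rs) False False False True False True True True"
      and q: "pol3 (set Rs) False True True False True False False True"
    have s: "sel3 False False False True False True True True x y z = ((x \<and> y) \<or> (x \<and> z) \<or> (y \<and> z))"
      "sel3 False True True False True False False True x y z = (x = (y = z))" for x y z
      by (auto simp: sel2_def sel3_def)
    show ?thesis
    proof (rule dec[OF fp_greedy])
      fix n k and ds :: "(nat \<times> nat list) list"
      assume net: "constraint_network ?Ts n ds" and d: "\<forall>d\<in>set ds. fst d < length Rs \<and> length (snd d) = fst (Rs ! fst d)"
      show "(\<exists>h. constraint_network.sol ?Ts ds h \<and> k \<le> card {v. v < n \<and> h v}) \<longleftrightarrow>
        feasible ?Ts ds (greedy ?Ts n ds) \<and> k \<le> score n (greedy ?Ts n ds)"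
      proof (rule constraint_network.greedy_correct[OF net])
        fix c t u w assume c: "c \<in> set ds" "t \<in> set (?Ts ! fst c)" "u \<in> set (?Ts ! fst c)" "w \<in> set (?Ts ! fst c)"
        show "map (\<lambda>j. (t ! j \<and> u ! j) \<or> (t ! j \<and> w ! j) \<or> (u ! j \<and> w ! j)) [0..<length (snd c)] \<in> set (?Ts ! fst c)"
          using c d T[of c] pol3D[OF p T(2)[of c], of t u w] by (simp add: s)
        show "map (\<lambda>j. t ! j = (u ! j = w ! j)) [0..<length (snd c)] \<in> set (?Ts ! fst c)"
          using c d T[of c] pol3D[OF q T(2)[of c], of t u w] by (simp add: s)
      qed
    qed
  qed
qed

section \<open>Independent set in NP and the use of NP-hardness\<close>

definition verify_IS :: "bool list \<Rightarrow> bool list \<Rightarrow> bool" where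
  "verify_IS x y \<longleftrightarrow> (\<forall>d\<in>set (snd (snd (parse_inst [R_IS2_1] x))).
       \<not> (nthd False y (nthd 0 (snd d) 0) \<and> nthd False y (nthd 0 (snd d) 1)) \<and> \<not> nthd False y (nthd 0 (snd d) 2)) \<and>
     bval (fst (snd (parse_inst [R_IS2_1] x))) \<le>
       length (filter (\<lambda>v. nthd False y v) [0..<fst (parse_inst [R_IS2_1] x)])"

lemma fp_verify_IS: "fp (\<lambda>u. verify_IS (fst u) (snd u))"
  unfolding verify_IS_def by (intro fp_intros)

lemma verify_IS_correct:
  assumes I: "I \<in> instances {R_IS2_1}"
  shows "(\<exists>y. length y \<le> length (enc_inst I) \<and> verify_IS (enc_inst I) y) \<longleftrightarrow> I \<in> snd (U_Max_Ones {R_IS2_1})"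
proof -
  obtain ds where ds: "parse_inst [R_IS2_1] (enc_inst I) = (num_vars I, bits (threshold I), ds)"
      "\<forall>d\<in>set ds. fst d < length [R_IS2_1]" "inst_cons [R_IS2_1] ds = constraints I"
    using parse_inst_enc[of "[R_IS2_1]" I] I R_IS2_1_simps(2) by auto
  have con: "(R_IS2_1, snd d) \<in> set (constraints I)" if "d \<in> set ds" for d
    unfolding ds(3)[symmetric] inst_cons_def using that ds(2) by force
  have len: "length (snd d) = 3" "set (snd d) \<subseteq> {..<num_vars I}" if "d \<in> set ds" for d
    using con[OF that] I by (auto simp: instances_def var_def R_IS2_1_simps)
  have mem: "map h l \<in> snd R_IS2_1 \<longleftrightarrow>
      \<not> (h (nthd 0 l 0) \<and> h (nthd 0 l 1)) \<and> \<not> h (nthd 0 l 2)" if "length l = 3" for h l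
    using that by (elim length_3_cases) (simp add: R_IS2_1_simps nthd_eq)
  have sol: "solution I h \<longleftrightarrow> (\<forall>d\<in>set ds. map h (snd d) \<in> snd R_IS2_1)" for h
    unfolding solution_def ds(3)[symmetric] inst_cons_def using ds(2) by auto
  have sol': "solution I h \<longleftrightarrow> (\<forall>d\<in>set ds. \<not> (h (nthd 0 (snd d) 0) \<and> h (nthd 0 (snd d) 1)) \<and>
      \<not> h (nthd 0 (snd d) 2))" for h
    unfolding sol by (intro ball_cong refl mem len(1))
  have card: "length (filter P [0..<m]) = card {v. v < m \<and> P v}" for P m
    using distinct_card[of "filter P [0..<m]"] by (simp add: conj_commute)
  have verify: "verify_IS (enc_inst I) y \<longleftrightarrow> solution I (nthd False y) \<and> threshold I \<le> weight I (nthd False y)" for y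
    unfolding verify_IS_def ds(1) sol' weight_card fst_conv snd_conv card bval_bits ..
  show ?thesis
  proof
    assume "\<exists>y. length y \<le> length (enc_inst I) \<and> verify_IS (enc_inst I) y"
    then show "I \<in> snd (U_Max_Ones {R_IS2_1})"
      unfolding verify using I by (auto simp: U_Max_Ones_def weight_def)
  next
    assume "I \<in> snd (U_Max_Ones {R_IS2_1})"
    then obtain h where h: "solution I h" "threshold I \<le> weight I h"
      by (auto simp: U_Max_Ones_def weight_def)
    let ?y = "map h [0..<num_vars I]"
    have y: "nthd False ?y v = h v" if "v < num_vars I" for v using that by (simp add: nthd_eq)
    have "map (nthd False ?y) (snd d) = map h (snd d)" if "d \<in> set ds" for d
      using len(2)[OF that] by (intro map_cong) (auto simp: y)
    then have "solution I (nthd False ?y)" using h(1) unfolding sol by (metis (no_types, lifting))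
    moreover have "weight I (nthd False ?y) = weight I h"
      unfolding weight_card by (rule arg_cong[of _ _ card]) (use y in auto)
    \<comment> \<open>The number of variables is encoded in unary, so the list of values fits into
      the length of the input.\<close>
    moreover have "length ?y \<le> length (enc_inst I)"
      by (simp add: enc_inst_def enc_unary_def)
    ultimately show "\<exists>y. length y \<le> length (enc_inst I) \<and> verify_IS (enc_inst I) y"
      using h(2) unfolding verify by (intro exI[of _ ?y]) simp
  qed
qed

text \<open>A power of two exceeds every weight on n variables, and its digits can be written down
  without arithmetic.\<close>

lemma bits_power2: "bits (2 ^ n) = replicate n False @ [True]"
proof (induction n)
  case 0
  show ?case by (subst bits.simps, subst bits.simps) simp
next
  case (Suc n)
  then show ?case by (subst bits.simps) simp
qed

text \<open>A tractable language with an NP-hard problem yields a polynomial-time decision procedure for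
  independent set, whose answer is turned into a trivial instance with the same variables.\<close>

lemma tractable_reducible:
  assumes Rs: "\<forall>R\<in>set Rs. boolean_relation R"
    and D: "fp D" "\<And>J. J \<in> instances (set Rs) \<Longrightarrow> D (enc_inst J) \<longleftrightarrow> J \<in> snd (U_Max_Ones (set Rs))"
    and hard: "NP_hard (U_Max_Ones (set Rs))"
  shows "U_Max_Ones {R_IS2_1} \<le>\<^sub>C\<^sub>V U_Max_Ones (set Rs)"
proof -
  let ?L = "{x. \<exists>y. length y \<le> length x \<and> verify_IS x y}"
  obtain f where f: "polytime_computable id UNIV enc_inst f" "\<And>x. f x \<in> instances (set Rs)"
      "\<And>x. x \<in> ?L \<longleftrightarrow> f x \<in> snd (U_Max_Ones (set Rs))"
    using hard in_NP_I[OF fp_verify_IS] unfolding NP_hard_def by (auto simp: U_Max_Ones_def)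
  let ?yes = "\<lambda>x. D (enc_inst (f x))"
  have yes: "fp ?yes"
    by (rule fp_comp[OF fp_of_polytime_computable[OF f(1)] D(1)])
  \<comment> \<open>Without constraints the threshold 0 is always met and
    \<open>2 ^ num_vars I\<close> never, even if there are no variables.\<close>
  define g :: "inst \<Rightarrow> inst" where
    "g I = \<lparr>num_vars = num_vars I, constraints = [],
       threshold = (if ?yes (enc_inst I) then 0 else 2 ^ num_vars I)\<rparr>" for I
  have yes_iff: "?yes (enc_inst I) \<longleftrightarrow> I \<in> snd (U_Max_Ones {R_IS2_1})" if "I \<in> instances {R_IS2_1}" for I
    using D(2)[OF f(2)] f(3)[of "enc_inst I"] verify_IS_correct[OF that] by simp
  have "CV_reduction (U_Max_Ones {R_IS2_1}) (U_Max_Ones (set Rs)) g"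
    unfolding CV_reduction_def
  proof (intro conjI ballI exI)
    show g: "g I \<in> fst (U_Max_Ones (set Rs))" for I
      by (simp add: U_Max_Ones_def instances_def g_def)
    show "polytime_computable enc_inst (fst (U_Max_Ones {R_IS2_1})) enc_inst g"
    proof (rule polytime_computableI)
      show "fp (\<lambda>w. print_inst Rs (fst (parse_unary w),
          if ?yes w then [] else map (\<lambda>_. False) [0..<fst (parse_unary w)] @ [True], []))"
        by (intro fp_intros yes)
      fix I
      have "fst (parse_unary (enc_inst I)) = num_vars I"
        by (simp add: enc_inst_def)
      moreover have "(if ?yes (enc_inst I) then [] else map (\<lambda>_. False) [0..<num_vars I] @ [True]) =
          bits (threshold (g I))"
        by (simp add: g_def bits_power2 map_replicate_const bits.simps[of 0])
      ultimately show "print_inst Rs (fst (parse_unary (enc_inst I)), if ?yes (enc_inst I) then []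
          else map (\<lambda>_. False) [0..<fst (parse_unary (enc_inst I))] @ [True], []) = enc_inst (g I)"
        by (simp only:) (simp add: print_inst_enc inst_cons_def g_def)
    qed
    fix I assume I: "I \<in> fst (U_Max_Ones {R_IS2_1})"
    have "weight (g I) h < 2 ^ num_vars I" for h
    proof -
      have "weight (g I) h \<le> card {..<num_vars I}"
        unfolding weight_card by (intro card_mono) (auto simp: g_def)
      also have "\<dots> < 2 ^ num_vars I" by (simp add: less_exp)
      finally show ?thesis .
    qed
    then have "g I \<in> snd (U_Max_Ones (set Rs)) \<longleftrightarrow> ?yes (enc_inst I)"
      using g[of I] unfolding U_Max_Ones_def snd_conv fst_conv weight_def[symmetric]
      by (auto simp: g_def solution_def leD not_le)
    then show "I \<in> snd (U_Max_Ones {R_IS2_1}) \<longleftrightarrow> g I \<in> snd (U_Max_Ones (set Rs))"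
      using yes_iff I by (simp add: U_Max_Ones_def)
    show "\<bar>int (card (var (g I))) - int (card (var I))\<bar> \<le> 0"
      by (simp add: var_def g_def)
  qed
  then show ?thesis unfolding CV_reducible_def by blast
qed

theorem theorem3:
  fixes \<Gamma> :: "brel set"
  assumes "constraint_language \<Gamma>"
    and "NP_hard (U_Max_Ones \<Gamma>)"
  shows "\<exists>R\<in>{R_IS2_1, R_II2, R_IN2, R_IL0, R_IL2, R_IL3, R_ID2}.
           U_Max_Ones {R} \<le>\<^sub>C\<^sub>V U_Max_Ones \<Gamma>"
proof -
  obtain Rs where \<Gamma>: "\<Gamma> = set Rs"
    using assms(1) finite_list unfolding constraint_language_def by blast
  have Rs: "\<forall>R\<in>set Rs. boolean_relation R"
    using assms(1) by (simp add: constraint_language_def \<Gamma>)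
  show ?thesis
  proof (cases "pol2 \<Gamma> True True True True \<or> pol2 \<Gamma> False True True True \<or>
      pol3 \<Gamma> False False False True False True True True \<and> pol3 \<Gamma> False True True False True False False True")
    case True
    then obtain D where "fp D" "\<forall>J\<in>instances (set Rs). D (enc_inst J) \<longleftrightarrow> J \<in> snd (U_Max_Ones (set Rs))"
      using tractable_decidable[OF Rs] unfolding \<Gamma> by blast
    then show ?thesis
      using tractable_reducible[OF Rs] assms(2) unfolding \<Gamma> by blast
  next
    case False
    then interpret intractable Rs
      by unfold_locales (use Rs \<Gamma> in auto)
    show ?thesis unfolding \<Gamma> by (rule intractable_reducible)
  qed
qed


end
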